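(* Let $\mathcal{N}_{A\to B}$ be a nonzero completely positive linear map (not necessarily trace preserving) and let $\varepsilon\in(0,1)$. Then $$C_{\mathrm{retro}}(\mathcal{N})=\lim_{n\to\infty}\frac{1}{n}C_{\mathrm{retro}}^{\varepsilon}(\mathcal{N}^{\otimes n})=I_{\max}(\mathcal{N})+I_{\mathrm{doe}}^{\infty}(\mathcal{N}).$$
   Context: All quantum systems are finite-dimensional Hilbert spaces; $d_A\geq 1$ denotes the dimension of system $A$. A state is a positive semidefinite unit-trace operator; $\mathcal{D}_B$ is the set of states of $B$ and $\mathrm{aff}(\mathcal{D}_B)$ is the set of unit-trace Hermitian operators on $B$. A channel is a completely positive trace-preserving linear map. Maps act as the identity on systems not listed in their subscript. Primed systems are isomorphic copies ($A'\cong A$). $\Phi_{AA'}=\frac{1}{d_A}\sum_{i,j}|i\rangle\langle j|_A\otimes|i\rangle\langle j|_{A'}$ is the standard maximally entangled state, and $\pi_A=\mathbb{1}_A/d_A$. For a linear map $\mathcal{N}_{A\to B}$ its Choi operator is $\Phi^{\mathcal{N}}_{A'B}=\mathcal{N}_{A\to B}[\Phi_{A'A}]$. Max-information and Doeblin information of a completely positive map (operator inequalities in the Loewner order, $\inf\emptyset=+\infty$): $$I_{\max}(\mathcal{N})=\inf_{\lambda\in\mathbb{R},\,\sigma_B\in\mathcal{D}_B}\{\log_2\lambda:\Phi^{\mathcal{N}}_{A'B}\leq\lambda\,\pi_{A'}\otimes\sigma_B\},\qquad I_{\mathrm{doe}}(\mathcal{N})=\inf_{\lambda\in\mathbb{R},\,\tau_B\in\mathrm{aff}(\mathcal{D}_B)}\{\log_2\lambda:\pi_{A'}\otimes\tau_B\leq\lambda\,\Phi^{\mathcal{N}}_{A'B}\}.$$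 The regularized Doeblin information is $I_{\mathrm{doe}}^{\infty}(\mathcal{N})=\lim_{n\to\infty}\frac{1}{n}I_{\mathrm{doe}}(\mathcal{N}^{\otimes n})$ (the limit exists, by superadditivity of $I_{\mathrm{doe}}$ under tensor products). $I_{\mathrm{doe}}$ and $I_{\mathrm{doe}}^\infty$ may equal $+\infty$. Loop supermap: for a linear map $\mathcal{T}_{EA\to FA}$ and an operator $\rho_{RE}$ ($R$ any reference system, possibly trivial), $\Gamma_A\{\mathcal{T}_{EA\to FA}\}[\rho_{RE}]=\mathrm{Tr}_{AA'}\big[\Phi_{AA'}\,\mathcal{T}_{EA\to FA}[\rho_{RE}\otimes\Phi_{AA'}]\big]$. Retrocausal communication: a strategy is a pair of channels $(\mathcal{E}_{ML\to A},\mathcal{D}_{B\to\widehat{M}L})$ with $\widehat{M}\cong M$ and $L$ an arbitrary system. Write $\mathcal{G}_{M\to\widehat{M}}=\Gamma_A\{\mathcal{E}_{ML\to A}\circ\mathcal{D}_{B\to\widehat{M}L}\circ\mathcal{N}_{A\to B}\}$, where the composition is viewed as a map from $MA$ to $\widehat{M}A$. With $\{|m\rangle\}_{m=0}^{d_M-1}$ a fixed orthonormal basis of $M$ (and correspondingly of $\widehat{M}$), the worst-case classical error probability is $$p_{\mathrm{error}}((\mathcal{E},\mathcal{D}),\mathcal{N})=1-\min_{0\leq m\leq d_M-1}\frac{\mathrm{Tr}\big[|m\rangle\langle m|_{\widehat{M}}\,\mathcal{G}[|m\rangle\langle m|_M]\big]}{\mathrm{Tr}\big[\mathcal{G}[|m\rangle\langle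 m|_M]\big]}.$$ Only strategies for which all these denominators are nonzero are considered. The one-shot retrocausal classical capacity is $$C_{\mathrm{retro}}^{\varepsilon}(\mathcal{N})=\sup\{\log_2 d_M: p_{\mathrm{error}}((\mathcal{E}_{ML\to A},\mathcal{D}_{B\to\widehat{M}L}),\mathcal{N}_{A\to B})\leq\varepsilon\},$$ the supremum being over all positive integers $d_M,d_L$ and all strategies; for $\mathcal{N}^{\otimes n}$ the systems $A,B$ are replaced by $A^n,B^n$ ($n$-fold tensor powers). The asymptotic retrocausal classical capacity is $$C_{\mathrm{retro}}(\mathcal{N})=\inf_{\varepsilon\in(0,1)}\liminf_{n\to\infty}\frac{1}{n}C_{\mathrm{retro}}^{\varepsilon}(\mathcal{N}^{\otimes n}).$$ *)

theory Defs
  imports "Jordan_Normal_Form.Schur_Decomposition" "HOL-Library.Extended_Real"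
begin

(* A system is given by its dimension d and identified with C^d carrying the standard basis; an
   operator on it is an element of carrier_mat d d.  The product basis vector |i>|k> of systems of
   dimensions d and e has index i * e + k.  With this convention tensor products are strictly
   associative, so no reassociation of systems is ever needed.

   Linear maps between operator spaces are HOL functions on matrices; only their values on the
   operators of the input system are ever used. *)

section \<open>Operators\<close>

definition mtrace :: "complex mat \<Rightarrow> complex" where
  "mtrace A = (\<Sum>i<dim_row A. A $$ (i, i))"

definition hermitian :: "nat \<Rightarrow> complex mat \<Rightarrow> bool" where
  "hermitian d A \<longleftrightarrow> A \<in> carrier_mat d d \<and> mat_adjoint A = A"

(* The order on complex numbers is the one of Complex_Order: 0 \<le> z means that z is real and
   nonnegative, so Hermiticity is implied. *)
definition psd :: "nat \<Rightarrow> complex mat \<Rightarrow> bool" where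
  "psd d A \<longleftrightarrow> A \<in> carrier_mat d d \<and> (\<forall>v\<in>carrier_vec d. 0 \<le> (A *\<^sub>v v) \<bullet>c v)"

definition loewner_le :: "nat \<Rightarrow> complex mat \<Rightarrow> complex mat \<Rightarrow> bool" where
  "loewner_le d A B \<longleftrightarrow> A \<in> carrier_mat d d \<and> B \<in> carrier_mat d d \<and> psd d (B - A)"

definition states :: "nat \<Rightarrow> complex mat set" where
  "states d = {\<sigma>. psd d \<sigma> \<and> mtrace \<sigma> = 1}"

definition aff_states :: "nat \<Rightarrow> complex mat set" where
  "aff_states d = {\<tau>. hermitian d \<tau> \<and> mtrace \<tau> = 1}"

definition kron :: "complex mat \<Rightarrow> complex mat \<Rightarrow> complex mat" where
  "kron A B = mat (dim_row A * dim_row B) (dim_col A * dim_col B)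
     (\<lambda>(p, q). A $$ (p div dim_row B, q div dim_col B) * B $$ (p mod dim_row B, q mod dim_col B))"

(* |i><j| on C^d *)
definition mat_unit :: "nat \<Rightarrow> nat \<Rightarrow> nat \<Rightarrow> complex mat" where
  "mat_unit d i j = mat d d (\<lambda>(p, q). if p = i \<and> q = j then 1 else 0)"

definition max_ent :: "nat \<Rightarrow> complex mat" where
  "max_ent d = mat (d * d) (d * d)
     (\<lambda>pq. (1 / of_nat d) * (\<Sum>i<d. \<Sum>j<d. kron (mat_unit d i j) (mat_unit d i j) $$ pq))"

definition max_mixed :: "nat \<Rightarrow> complex mat" where
  "max_mixed d = (1 / of_nat d) \<cdot>\<^sub>m 1\<^sub>m d"

(* Partial trace over the second factor (dimension k) of a system of dimension d * k. *)
definition ptrace_snd :: "nat \<Rightarrow> nat \<Rightarrow> complex mat \<Rightarrow> complex mat" where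
  "ptrace_snd d k X = mat d d (\<lambda>(p, q). \<Sum>s<k. X $$ (p * k + s, q * k + s))"

section \<open>Linear maps on operators\<close>

type_synonym op_map = "complex mat \<Rightarrow> complex mat"

definition linear_op_map :: "nat \<Rightarrow> nat \<Rightarrow> op_map \<Rightarrow> bool" where
  "linear_op_map a b N \<longleftrightarrow>
     (\<forall>X\<in>carrier_mat a a. N X \<in> carrier_mat b b) \<and>
     (\<forall>X\<in>carrier_mat a a. \<forall>Y\<in>carrier_mat a a. N (X + Y) = N X + N Y) \<and>
     (\<forall>c. \<forall>X\<in>carrier_mat a a. N (c \<cdot>\<^sub>m X) = c \<cdot>\<^sub>m N X)"

(* The tensor product of N (from dimension a to b) and M (from dimension c to d), obtained from
   |i><j| \<otimes> |k><l| \<mapsto> N(|i><j|) \<otimes> M(|k><l|) by linearity. *)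
definition tensor_map :: "nat \<Rightarrow> nat \<Rightarrow> nat \<Rightarrow> nat \<Rightarrow> op_map \<Rightarrow> op_map \<Rightarrow> op_map" where
  "tensor_map a b c d N M X = mat (b * d) (b * d)
     (\<lambda>pq. \<Sum>i<a. \<Sum>j<a. \<Sum>k<c. \<Sum>l<c.
        X $$ (i * c + k, j * c + l) * kron (N (mat_unit a i j)) (M (mat_unit c k l)) $$ pq)"

(* id on a system of dimension r, tensored with N from dimension a to b *)
abbreviation id_tensor :: "nat \<Rightarrow> nat \<Rightarrow> nat \<Rightarrow> op_map \<Rightarrow> op_map" where
  "id_tensor r a b N \<equiv> tensor_map r r a b (\<lambda>X. X) N"

abbreviation tensor_id :: "nat \<Rightarrow> nat \<Rightarrow> nat \<Rightarrow> op_map \<Rightarrow> op_map" where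
  "tensor_id a b r N \<equiv> tensor_map a b r r N (\<lambda>X. X)"

(* N^{\<otimes>n}, from dimension a^n to b^n *)
fun tensor_power :: "nat \<Rightarrow> nat \<Rightarrow> op_map \<Rightarrow> nat \<Rightarrow> op_map" where
  "tensor_power a b N 0 = (\<lambda>X. X)"
| "tensor_power a b N (Suc n) = tensor_map a b (a ^ n) (b ^ n) N (tensor_power a b N n)"

definition cp_map :: "nat \<Rightarrow> nat \<Rightarrow> op_map \<Rightarrow> bool" where
  "cp_map a b N \<longleftrightarrow> linear_op_map a b N \<and>
     (\<forall>r X. psd (r * a) X \<longrightarrow> psd (r * b) (id_tensor r a b N X))"

definition channel :: "nat \<Rightarrow> nat \<Rightarrow> op_map \<Rightarrow> bool" where
  "channel a b N \<longleftrightarrow> cp_map a b N \<and> (\<forall>X\<in>carrier_mat a a. mtrace (N X) = mtrace X)"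

(* Reorders the tensor factors from (dimension d, dimension e) to (dimension e, dimension d). *)
definition swap_map :: "nat \<Rightarrow> nat \<Rightarrow> op_map" where
  "swap_map d e X = mat (e * d) (e * d)
     (\<lambda>(p, q). X $$ ((p mod d) * e + p div d, (q mod d) * e + q div d))"

(* The Choi operator, with the reference A' as first factor and B as second factor. *)
definition choi :: "nat \<Rightarrow> nat \<Rightarrow> op_map \<Rightarrow> complex mat" where
  "choi a b N = id_tensor a a b N (max_ent a)"

section \<open>Max-information and Doeblin information\<close>

(* The branch x \<le> 0 (log 0 = -\<infinity>) is only reached for the zero map: for a nonzero completely positive
   map, taking traces in the operator inequalities below forces x > 0. *)
definition elog2 :: "real \<Rightarrow> ereal" where
  "elog2 x = (if x > 0 then ereal (log 2 x) else - \<infinity>)"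

definition I_max :: "nat \<Rightarrow> nat \<Rightarrow> op_map \<Rightarrow> ereal" where
  "I_max a b N = Inf {elog2 x | x \<sigma>. \<sigma> \<in> states b \<and>
     loewner_le (a * b) (choi a b N) (complex_of_real x \<cdot>\<^sub>m kron (max_mixed a) \<sigma>)}"

definition I_doe :: "nat \<Rightarrow> nat \<Rightarrow> op_map \<Rightarrow> ereal" where
  "I_doe a b N = Inf {elog2 x | x \<tau>. \<tau> \<in> aff_states b \<and>
     loewner_le (a * b) (kron (max_mixed a) \<tau>) (complex_of_real x \<cdot>\<^sub>m choi a b N)}"

definition I_doe_reg :: "nat \<Rightarrow> nat \<Rightarrow> op_map \<Rightarrow> ereal" where
  "I_doe_reg a b N = lim (\<lambda>n. I_doe (a ^ n) (b ^ n) (tensor_power a b N n) / ereal (real n))"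

section \<open>Retrocausal communication\<close>

(* The loop over A (dimension a) of T from EA to FA, as a map from E (dimension e) to
   F (dimension f).  The factors are ordered E A A' resp. F A A'.  A reference system R is
   accommodated by tensoring the resulting map with the identity on R. *)
definition loop :: "nat \<Rightarrow> nat \<Rightarrow> nat \<Rightarrow> op_map \<Rightarrow> op_map" where
  "loop a e f T \<rho> = ptrace_snd f (a * a)
     (kron (1\<^sub>m f) (max_ent a) * tensor_id (e * a) (f * a) a T (kron \<rho> (max_ent a)))"

(* The looped map G from M to the output copy M^ of M (both of dimension m), for an encoder
   E from ML to A and a decoder D from B to M^L, where L has dimension l.  The factors run through
   M A, M B, M M^ L, M^ M L, M^ A. *)
definition retro_map :: "nat \<Rightarrow> nat \<Rightarrow> nat \<Rightarrow> nat \<Rightarrow> op_map \<Rightarrow> op_map \<Rightarrow> op_map \<Rightarrow> op_map" where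
  "retro_map a b m l E D N = loop a m m
     (id_tensor m (m * l) a E \<circ> tensor_id (m * m) (m * m) l (swap_map m m) \<circ>
      id_tensor m b (m * l) D \<circ> id_tensor m a b N)"

definition p_error :: "nat \<Rightarrow> nat \<Rightarrow> nat \<Rightarrow> nat \<Rightarrow> op_map \<Rightarrow> op_map \<Rightarrow> op_map \<Rightarrow> real" where
  "p_error a b m l E D N = 1 - Min ((\<lambda>k.
     Re (mtrace (mat_unit m k k * retro_map a b m l E D N (mat_unit m k k)) /
         mtrace (retro_map a b m l E D N (mat_unit m k k)))) ` {..<m})"

definition retro_strategy ::
    "nat \<Rightarrow> nat \<Rightarrow> nat \<Rightarrow> nat \<Rightarrow> op_map \<Rightarrow> op_map \<Rightarrow> op_map \<Rightarrow> bool" where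
  "retro_strategy a b m l E D N \<longleftrightarrow> channel (m * l) a E \<and> channel b (m * l) D \<and>
     (\<forall>k<m. mtrace (retro_map a b m l E D N (mat_unit m k k)) \<noteq> 0)"

definition C_retro_oneshot :: "real \<Rightarrow> nat \<Rightarrow> nat \<Rightarrow> op_map \<Rightarrow> ereal" where
  "C_retro_oneshot \<epsilon> a b N = Sup {ereal (log 2 (real m)) | m l E D.
     0 < m \<and> 0 < l \<and> retro_strategy a b m l E D N \<and> p_error a b m l E D N \<le> \<epsilon>}"

definition C_retro_rate :: "real \<Rightarrow> nat \<Rightarrow> nat \<Rightarrow> op_map \<Rightarrow> nat \<Rightarrow> ereal" where
  "C_retro_rate \<epsilon> a b N n =
     C_retro_oneshot \<epsilon> (a ^ n) (b ^ n) (tensor_power a b N n) / ereal (real n)"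

definition C_retro :: "nat \<Rightarrow> nat \<Rightarrow> op_map \<Rightarrow> ereal" where
  "C_retro a b N = (INF \<epsilon>\<in>{0<..<1}. liminf (C_retro_rate \<epsilon> a b N))"

end

theory Submission
  imports Defs
begin

text \<open>
  Write \<open>J\<close> for the unnormalised Choi operator of \<open>N\<close> and let \<open>V\<close> and \<open>q\<close> be the maximum and the
  minimum of \<open>Tr (J W)\<close> over the Choi operators \<open>W\<close> of channels from \<open>B\<close> to \<open>A\<close>.  Semidefinite
  duality gives \<open>I_max = log V\<close> and \<open>I_doe = - log q\<close>.  Closing the loop around encoder and decoder
  evaluates \<open>Tr (J W)\<close> on branches \<open>W\<close>, one for each message and output, which add up to a channel
  both over the outputs for a fixed message and over the diagonal where the output is the message.
  Hence \<open>m\<close> messages with error at most \<open>\<epsilon>\<close> satisfy \<open>m (1 - \<epsilon>) q \<le> V\<close>.  Conversely, guessing the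
  message uniformly in advance and running the maximiser if the guess is right and the minimiser
  otherwise succeeds with probability \<open>V / (V + (m - 1) q)\<close>.  Both bounds agree up to constants,
  \<open>V\<close> is multiplicative and \<open>q\<close> submultiplicative under tensor powers, so Fekete's lemma finishes the
  proof; if \<open>q\<close> vanishes for some power, all quantities are infinite.
\<close>

section \<open>Positive semidefinite kernels\<close>

text \<open>Why the two extrema behave differently: a certificate for \<open>V\<close> is an
  operator \<open>T\<close> with \<open>J \<le> 1 \<otimes> T\<close>. As \<open>J\<close> is
  positive, so is \<open>T\<close>, and certificates can be multiplied. A certificate for
  \<open>q\<close> is a Hermitian operator below \<open>J\<close> that may be indefinite, and order
  relations between indefinite operators do not survive tensoring. Only the inequality coming from
  product channels remains, so the Doeblin term alone is regularized. Duality is obtained from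
  Hahn-Banach in coordinates: the dual value is visibly sublinear in the objective, and a supporting
  functional at \<open>J\<close> is itself a maximising channel, so attainment comes along without a
  compactness argument. Operators are treated as kernels on index sets: restricting a register,
  regrouping tensor factors and padding a block are then all reindexings, and positivity passes
  through them by way of Gram vectors.\<close>

definition qform :: "'i set \<Rightarrow> ('i \<Rightarrow> 'i \<Rightarrow> complex) \<Rightarrow> ('i \<Rightarrow> complex) \<Rightarrow> complex" where
  "qform I F v = (\<Sum>i\<in>I. \<Sum>j\<in>I. cnj (v i) * F i j * v j)"

text \<open>The order on complex numbers makes nonnegativity include reality, so Hermiticity is a
  consequence rather than a conjunct. Test vectors are arbitrary functions; only their values on
  \<open>I\<close> enter.\<close>

definition psd_on :: "'i set \<Rightarrow> ('i \<Rightarrow> 'i \<Rightarrow> complex) \<Rightarrow> bool" where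
  "psd_on I F \<longleftrightarrow> (\<forall>v. 0 \<le> qform I F v)"

definition herm_on :: "'i set \<Rightarrow> ('i \<Rightarrow> 'i \<Rightarrow> complex) \<Rightarrow> bool" where
  "herm_on I F \<longleftrightarrow> (\<forall>i\<in>I. \<forall>j\<in>I. F j i = cnj (F i j))"

lemma herm_onI: "(\<And>i j. i \<in> I \<Longrightarrow> j \<in> I \<Longrightarrow> F j i = cnj (F i j)) \<Longrightarrow> herm_on I F"
  unfolding herm_on_def by blast

lemma herm_onD: "herm_on I F \<Longrightarrow> i \<in> I \<Longrightarrow> j \<in> I \<Longrightarrow> F j i = cnj (F i j)"
  unfolding herm_on_def by blast

lemma herm_on_add:
  assumes "herm_on I F" "herm_on I G"
  shows "herm_on I (\<lambda>i j. F i j + G i j)"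
proof (rule herm_onI)
  fix i j assume ij: "i \<in> I" "j \<in> I"
  show "F j i + G j i = cnj (F i j + G i j)"
    using herm_onD[OF assms(1) ij] herm_onD[OF assms(2) ij] by simp
qed

lemma herm_on_scale:
  assumes "herm_on I F"
  shows "herm_on I (\<lambda>i j. complex_of_real c * F i j)"
proof (rule herm_onI)
  fix i j assume ij: "i \<in> I" "j \<in> I"
  show "of_real c * F j i = cnj (of_real c * F i j)"
    using herm_onD[OF assms(1) ij] by simp
qed

section \<open>Quadratic forms, pivoting and the Gram factorisation\<close>

lemma qform_cong:
  assumes "\<And>i j. i \<in> I \<Longrightarrow> j \<in> I \<Longrightarrow> F i j = G i j" "\<And>i. i \<in> I \<Longrightarrow> v i = w i"
  shows "qform I F v = qform I G w"
  unfolding qform_def by (intro sum.cong refl) (auto simp: assms)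

lemma psd_on_cong:
  assumes "\<And>i j. i \<in> I \<Longrightarrow> j \<in> I \<Longrightarrow> F i j = G i j"
  shows "psd_on I F \<longleftrightarrow> psd_on I G"
proof -
  have "qform I F v = qform I G v" for v using assms by (intro qform_cong) auto
  then show ?thesis unfolding psd_on_def by simp
qed

lemma qform_add_unit:
  assumes "finite I" "k \<in> I"
  shows "qform I F (\<lambda>i. v i + (if i = k then t else 0)) = qform I F v
    + cnj t * (\<Sum>j\<in>I. F k j * v j) + t * (\<Sum>i\<in>I. cnj (v i) * F i k) + cnj t * t * F k k"
proof -
  let ?e = "\<lambda>i. if i = k then t else 0"
  have "qform I F (\<lambda>i. v i + ?e i) = (\<Sum>i\<in>I. \<Sum>j\<in>I.
     cnj (v i) * F i j * v j + cnj (?e i) * F i j * v j + cnj (v i) * F i j * ?e j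
       + cnj (?e i) * F i j * ?e j)"
    unfolding qform_def by (intro sum.cong refl) (simp add: algebra_simps)
  also have "\<dots> = qform I F v + (\<Sum>i\<in>I. \<Sum>j\<in>I. cnj (?e i) * F i j * v j)
     + (\<Sum>i\<in>I. \<Sum>j\<in>I. cnj (v i) * F i j * ?e j) + (\<Sum>i\<in>I. \<Sum>j\<in>I. cnj (?e i) * F i j * ?e j)"
    unfolding qform_def by (simp add: sum.distrib)
  also have "(\<Sum>i\<in>I. \<Sum>j\<in>I. cnj (?e i) * F i j * v j) = (\<Sum>i\<in>I. if i = k then cnj t * (\<Sum>j\<in>I. F i j * v j) else 0)"
    by (intro sum.cong refl) (simp add: sum_distrib_left mult.assoc)
  also have "\<dots> = cnj t * (\<Sum>j\<in>I. F k j * v j)" using assms by (simp add: sum.delta')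
  also have "(\<Sum>i\<in>I. \<Sum>j\<in>I. cnj (v i) * F i j * ?e j) = (\<Sum>i\<in>I. t * (cnj (v i) * F i k))"
    using assms by (intro sum.cong refl) (simp add: if_distrib sum.delta cong: if_cong)
  also have "\<dots> = t * (\<Sum>i\<in>I. cnj (v i) * F i k)" by (simp add: sum_distrib_left)
  also have "(\<Sum>i\<in>I. \<Sum>j\<in>I. cnj (?e i) * F i j * ?e j) = (\<Sum>i\<in>I. cnj (?e i) * F i k * t)"
    using assms by (intro sum.cong refl) (simp add: if_distrib sum.delta cong: if_cong)
  also have "\<dots> = (\<Sum>i\<in>I. if i = k then cnj t * F i k * t else 0)"
    by (intro sum.cong) auto
  also have "\<dots> = cnj t * t * F k k" using assms by (simp add: sum.delta')
  finally show ?thesis .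
qed

lemma qform_unit:
  assumes "finite I" "k \<in> I"
  shows "qform I F (\<lambda>i. if i = k then t else 0) = cnj t * t * F k k"
  using qform_add_unit[OF assms, of F "\<lambda>_. 0" t] by (simp add: qform_def)

lemma psd_on_diag:
  assumes "finite I" "psd_on I F" "k \<in> I"
  shows "0 \<le> F k k"
proof -
  have "0 \<le> qform I F (\<lambda>i. if i = k then 1 else 0)" using assms(2) unfolding psd_on_def by blast
  then show ?thesis unfolding qform_unit[OF assms(1,3)] by simp
qed

text \<open>The form is real on the vector with entry 1 at \<open>i\<close> and \<open>t\<close> at
  \<open>j\<close>; \<open>t = 1\<close> settles the imaginary parts and \<open>t = \<i>\<close> the
  real parts of the two off-diagonal entries.\<close>

lemma psd_on_herm:
  assumes I: "finite I" and F: "psd_on I F"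
  shows "herm_on I F"
  unfolding herm_on_def
proof (intro ballI)
  fix i j assume ij: "i \<in> I" "j \<in> I"
  show "F j i = cnj (F i j)"
  proof (cases "i = j")
    case True
    then show ?thesis using psd_on_diag[OF I F ij(1)] by (simp add: complex_eq_iff less_eq_complex_def)
  next
    case False
    have d: "Im (F i i) = 0" "Im (F j j) = 0"
      using psd_on_diag[OF I F] ij by (auto simp: less_eq_complex_def)
    have e: "0 \<le> F i i + cnj t * F j i + t * F i j + cnj t * t * F j j" for t
    proof -
      have q: "0 \<le> qform I F (\<lambda>n. (if n = i then 1 else 0) + (if n = j then t else 0))"
        using F unfolding psd_on_def by blast
      have s1: "(\<Sum>n\<in>I. F j n * (if n = i then 1 else 0)) = F j i"
        using I ij by (simp add: if_distrib sum.delta cong: if_cong)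
      have "(\<Sum>n\<in>I. cnj (if n = i then 1 else 0) * F n j) = (\<Sum>n\<in>I. if n = i then F n j else 0)"
        by (intro sum.cong) auto
      then have s2: "(\<Sum>n\<in>I. cnj (if n = i then 1 else 0) * F n j) = F i j" using I ij by (simp add: sum.delta')
      show ?thesis
        using q unfolding qform_add_unit[OF I ij(2)] qform_unit[OF I ij(1)] s1 s2 by simp
    qed
    have "Im (F i j) + Im (F j i) = 0" using e[of 1] d by (simp add: less_eq_complex_def)
    moreover have "Re (F i j) - Re (F j i) = 0" using e[of \<i>] d by (simp add: less_eq_complex_def)
    ultimately show ?thesis by (intro complex_eqI) simp_all
  qed
qed

text \<open>If the pivot vanishes, the form is affine in the weight put on coordinate
  \<open>k\<close>, hence unbounded below unless the whole row is zero.\<close>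

lemma psd_on_zero_pivot:
  assumes I: "finite I" and F: "psd_on I F" and kj: "k \<in> I" "j \<in> I" and 0: "F k k = 0"
  shows "F k j = 0"
proof (rule ccontr)
  assume nz: "F k j \<noteq> 0"
  have h: "F j k = cnj (F k j)" using psd_on_herm[OF I F] kj unfolding herm_on_def by blast
  have e: "0 \<le> F j j + cnj t * F k j + t * F j k" for t
  proof -
    have q: "0 \<le> qform I F (\<lambda>n. (if n = j then 1 else 0) + (if n = k then t else 0))"
      using F unfolding psd_on_def by blast
    have s1: "(\<Sum>n\<in>I. F k n * (if n = j then 1 else 0)) = F k j"
      using I kj by (simp add: if_distrib sum.delta cong: if_cong)
    have "(\<Sum>n\<in>I. cnj (if n = j then 1 else 0) * F n k) = (\<Sum>n\<in>I. if n = j then F n k else 0)"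
      by (intro sum.cong) auto
    then have s2: "(\<Sum>n\<in>I. cnj (if n = j then 1 else 0) * F n k) = F j k" using I kj by (simp add: sum.delta')
    show ?thesis
      using q unfolding qform_add_unit[OF I kj(1)] qform_unit[OF I kj(2)] 0 s1 s2 by simp
  qed
  define N where "N = (cmod (F k j))\<^sup>2"
  have N: "N > 0" using nz by (simp add: N_def)
  have N': "N = Re (F k j) * Re (F k j) + Im (F k j) * Im (F k j)"
    by (simp add: N_def cmod_power2 flip: power2_eq_square)
  \<comment> \<open>This \<open>s\<close> makes the form at the test vector equal to
    \<open>- Re (F j j) - 2\<close>, which is negative.\<close>
  define s where "s = (Re (F j j) + 1) / N"
  from e[of "- of_real s * F k j"]
  have "0 \<le> Re (F j j - of_real s * (cnj (F k j) * F k j) - of_real s * (F k j * cnj (F k j)))"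
    unfolding h by (simp add: less_eq_complex_def algebra_simps)
  also have "\<dots> = Re (F j j) - 2 * s * N"
    by (simp add: N' algebra_simps)
  also have "\<dots> = - Re (F j j) - 2" using N by (simp add: s_def field_simps)
  finally show False using psd_on_diag[OF I F kj(2)] by (simp add: less_eq_complex_def)
qed

text \<open>Completing the square: the Schur complement at \<open>v\<close> is the form of
  \<open>F\<close> at \<open>v\<close> with coordinate \<open>k\<close> shifted by
  \<open>- c / F k k\<close>, the shift that minimises the form.\<close>

lemma psd_on_schur_step:
  assumes I: "finite I" and F: "psd_on I F" and k: "k \<in> I" and nz: "F k k \<noteq> 0"
  shows "psd_on I (\<lambda>i j. F i j - F i k * cnj (F j k) / F k k)"
  unfolding psd_on_def
proof
  fix v
  define c where "c = (\<Sum>j\<in>I. F k j * v j)"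
  have h: "F j i = cnj (F i j)" if "i \<in> I" "j \<in> I" for i j
    using psd_on_herm[OF I F] that unfolding herm_on_def by blast
  have r: "cnj (F k k) = F k k" using h[OF k k] by simp
  have c': "(\<Sum>i\<in>I. cnj (v i) * F i k) = cnj c"
    unfolding c_def cnj_sum by (intro sum.cong refl) (simp add: h[OF k] mult.commute)
  have c'': "(\<Sum>j\<in>I. cnj (F j k) * v j) = c"
    unfolding c_def by (intro sum.cong refl) (simp add: h[OF k])
  have "qform I (\<lambda>i j. F i j - F i k * cnj (F j k) / F k k) v =
    qform I F v - (\<Sum>i\<in>I. \<Sum>j\<in>I. (cnj (v i) * F i k) * (cnj (F j k) * v j)) / F k k"
    unfolding qform_def sum_divide_distrib sum_subtractf[symmetric]
    by (intro sum.cong refl) (simp add: algebra_simps)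
  also have "\<dots> = qform I F v - cnj c * c / F k k"
    unfolding sum_product[symmetric] c' c'' ..
  also have "\<dots> = qform I F (\<lambda>i. v i + (if i = k then - c / F k k else 0))"
    unfolding qform_add_unit[OF I k] c' c_def[symmetric] using nz r by (simp add: field_simps)
  also have "0 \<le> \<dots>" using F unfolding psd_on_def by blast
  finally show "0 \<le> qform I (\<lambda>i j. F i j - F i k * cnj (F j k) / F k k) v" .
qed

text \<open>Gaussian elimination, where \<open>K\<close> collects the rows not yet cleared. A
  nonzero pivot splits off one rank-one factor, stored as \<open>f k\<close>; a zero pivot has its
  row cleared already and contributes the zero factor.\<close>

lemma psd_on_gram_aux:
  assumes I: "finite I" and K: "finite K"
  shows "K \<subseteq> I \<Longrightarrow> psd_on I F \<Longrightarrow> (\<And>i j. i \<in> I - K \<Longrightarrow> j \<in> I \<Longrightarrow> F i j = 0) \<Longrightarrow>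
    \<exists>f. \<forall>i\<in>I. \<forall>j\<in>I. F i j = (\<Sum>r\<in>K. f r i * cnj (f r j))"
  using K
proof (induction K arbitrary: F rule: finite_induct)
  case empty
  then show ?case by auto
next
  case (insert k K)
  have kI: "k \<in> I" using insert by auto
  note F = insert.prems(2)
  have h: "F j i = cnj (F i j)" if "i \<in> I" "j \<in> I" for i j
    using psd_on_herm[OF I F] that unfolding herm_on_def by blast
  show ?case
  proof (cases "F k k = 0")
    case True
    have "\<exists>f. \<forall>i\<in>I. \<forall>j\<in>I. F i j = (\<Sum>r\<in>K. f r i * cnj (f r j))"
    proof (rule insert.IH)
      show "F i j = 0" if "i \<in> I - K" "j \<in> I" for i j
        using psd_on_zero_pivot[OF I F kI that(2) True] insert.prems(3)[of i j] that by (cases "i = k") auto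
    qed (use insert.prems in auto)
    then obtain f where f: "\<forall>i\<in>I. \<forall>j\<in>I. F i j = (\<Sum>r\<in>K. f r i * cnj (f r j))" by blast
    have "(\<Sum>r\<in>K. (f(k := \<lambda>_. 0)) r i * cnj ((f(k := \<lambda>_. 0)) r j)) = (\<Sum>r\<in>K. f r i * cnj (f r j))" for i j
      using insert.hyps by (intro sum.cong) auto
    then show ?thesis using f insert.hyps by (intro exI[of _ "f(k := \<lambda>_. 0)"]) (simp del: fun_upd_apply add: fun_upd_same)
  next
    case False
    define s where "s = sqrt (Re (F k k))"
    have p: "0 \<le> F k k" by (rule psd_on_diag[OF I F kI])
    have Fk: "F k k = of_real s * of_real s"
      using p by (simp add: s_def less_eq_complex_def complex_eq_iff flip: of_real_mult)
    let ?G = "\<lambda>i j. F i j - F i k * cnj (F j k) / F k k"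
    have "\<exists>f. \<forall>i\<in>I. \<forall>j\<in>I. ?G i j = (\<Sum>r\<in>K. f r i * cnj (f r j))"
    proof (rule insert.IH)
      show "psd_on I ?G" by (rule psd_on_schur_step[OF I F kI False])
      show "?G i j = 0" if "i \<in> I - K" "j \<in> I" for i j
      proof (cases "i = k")
        case True
        then show ?thesis using h[OF kI that(2)] False by simp
      next
        case ne: False
        then show ?thesis using insert.prems(3) that kI by auto
      qed
    qed (use insert.prems in auto)
    then obtain f where f: "\<forall>i\<in>I. \<forall>j\<in>I. ?G i j = (\<Sum>r\<in>K. f r i * cnj (f r j))" by blast
    define w where "w i = F i k / of_real s" for i
    have s0: "s \<noteq> 0" using False Fk by auto
    have w: "F i j = w i * cnj (w j) + (\<Sum>r\<in>K. f r i * cnj (f r j))" if "i \<in> I" "j \<in> I" for i j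
    proof -
      have "?G i j = (\<Sum>r\<in>K. f r i * cnj (f r j))" using f that by blast
      moreover have "F i k * cnj (F j k) / F k k = w i * cnj (w j)"
        unfolding w_def using s0 by (simp add: Fk)
      ultimately show ?thesis by (simp add: algebra_simps)
    qed
    have "(\<Sum>r\<in>K. (f(k := w)) r i * cnj ((f(k := w)) r j)) = (\<Sum>r\<in>K. f r i * cnj (f r j))" for i j
      using insert.hyps by (intro sum.cong) auto
    then show ?thesis using w insert.hyps by (intro exI[of _ "f(k := w)"]) (simp del: fun_upd_apply add: fun_upd_same)
  qed
qed

text \<open>The Gram representation, obtained by pivoting, replaces the spectral theorem throughout.\<close>

lemma psd_on_gramE:
  assumes "finite I" "psd_on I F"
  obtains f where "\<And>i j. i \<in> I \<Longrightarrow> j \<in> I \<Longrightarrow> F i j = (\<Sum>r\<in>I. f r i * cnj (f r j))"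
  using psd_on_gram_aux[OF assms(1,1) subset_refl assms(2)] by auto

lemma mult_cnj_nonneg: "0 \<le> z * cnj z"
  by (simp add: complex_mult_cnj less_eq_complex_def)

lemma psd_on_gramI:
  assumes "\<And>i j. i \<in> I \<Longrightarrow> j \<in> I \<Longrightarrow> F i j = (\<Sum>r\<in>R. f r i * cnj (f r j))"
  shows "psd_on I F"
  unfolding psd_on_def
proof
  fix v
  have "qform I F v = (\<Sum>i\<in>I. \<Sum>j\<in>I. \<Sum>r\<in>R. (cnj (v i) * f r i) * (cnj (f r j) * v j))"
    unfolding qform_def
    by (intro sum.cong refl) (simp add: assms sum_distrib_left sum_distrib_right mult.assoc)
  also have "\<dots> = (\<Sum>i\<in>I. \<Sum>r\<in>R. \<Sum>j\<in>I. (cnj (v i) * f r i) * (cnj (f r j) * v j))"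
    by (intro sum.cong refl sum.swap)
  also have "\<dots> = (\<Sum>r\<in>R. \<Sum>i\<in>I. \<Sum>j\<in>I. (cnj (v i) * f r i) * (cnj (f r j) * v j))"
    by (rule sum.swap)
  also have "\<dots> = (\<Sum>r\<in>R. (\<Sum>i\<in>I. cnj (v i) * f r i) * cnj (\<Sum>i\<in>I. cnj (v i) * f r i))"
    unfolding sum_product cnj_sum by (intro sum.cong refl) simp
  also have "0 \<le> \<dots>" by (intro sum_nonneg mult_cnj_nonneg)
  finally show "0 \<le> qform I F v" .
qed

section \<open>Closure of positive kernels under sums, compressions and contractions\<close>

lemma psd_on_add:
  assumes "psd_on I F" "psd_on I G"
  shows "psd_on I (\<lambda>i j. F i j + G i j)"
proof -
  have "qform I (\<lambda>i j. F i j + G i j) v = qform I F v + qform I G v" for v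
    by (simp add: qform_def algebra_simps sum.distrib)
  then show ?thesis using assms unfolding psd_on_def by simp
qed

lemma psd_on_zero: "psd_on I (\<lambda>i j. 0)"
  by (simp add: psd_on_def qform_def)

lemma psd_on_sum:
  assumes "finite R" "\<And>r. r \<in> R \<Longrightarrow> psd_on I (F r)"
  shows "psd_on I (\<lambda>i j. \<Sum>r\<in>R. F r i j)"
  using assms by (induction R rule: finite_induct) (auto simp: psd_on_zero intro: psd_on_add)

lemma psd_on_scale:
  assumes "psd_on I F" "0 \<le> c"
  shows "psd_on I (\<lambda>i j. complex_of_real c * F i j)"
proof -
  have "qform I (\<lambda>i j. of_real c * F i j) v = of_real c * qform I F v" for v
    unfolding qform_def by (simp add: sum_distrib_left mult_ac)
  then show ?thesis using assms unfolding psd_on_def by (simp add: less_eq_complex_def)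
qed

text \<open>Conjugation of \<open>F\<close> by the matrix with the single entry \<open>c i\<close>
  in row \<open>i\<close>, at column \<open>h i\<close>. Weights equal to 1 give reindexing;
  indicator weights cut out a diagonal block, as in the encoder.\<close>

lemma psd_on_pullback:
  assumes I: "finite I" and F: "psd_on I F" and h: "\<And>i. i \<in> J \<Longrightarrow> c i \<noteq> 0 \<Longrightarrow> h i \<in> I"
  shows "psd_on J (\<lambda>i j. c i * cnj (c j) * F (h i) (h j))"
proof -
  obtain f where f: "\<And>i j. i \<in> I \<Longrightarrow> j \<in> I \<Longrightarrow> F i j = (\<Sum>r\<in>I. f r i * cnj (f r j))"
    by (rule psd_on_gramE[OF I F]) blast
  show ?thesis
  proof (rule psd_on_gramI)
    fix i j assume ij: "i \<in> J" "j \<in> J"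
    show "c i * cnj (c j) * F (h i) (h j) = (\<Sum>r\<in>I. (c i * f r (h i)) * cnj (c j * f r (h j)))"
    proof (cases "c i = 0 \<or> c j = 0")
      case False
      then have "F (h i) (h j) = (\<Sum>r\<in>I. f r (h i) * cnj (f r (h j)))"
        using ij h by (intro f) auto
      then show ?thesis by (simp add: sum_distrib_left mult_ac)
    qed auto
  qed
qed

lemma psd_on_reindex:
  assumes "finite I" "psd_on I F" "\<And>i. i \<in> J \<Longrightarrow> h i \<in> I"
  shows "psd_on J (\<lambda>i j. F (h i) (h j))"
  using psd_on_pullback[OF assms(1,2), of J "\<lambda>_. 1" h] assms(3) by simp

text \<open>The link product, which composes completely positive maps on the level of Choi kernels:
  contracting Gram vectors of \<open>F\<close> and \<open>G\<close> over \<open>K\<close> gives Gram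
  vectors of the composite. One-point outer or middle systems turn it into the pairing and the
  tensor product below.\<close>

lemma psd_on_link:
  assumes fin: "finite I" "finite K" "finite J"
    and F: "psd_on (I \<times> K) F" and G: "psd_on (K \<times> J) G"
  shows "psd_on (I \<times> J) (\<lambda>p q. \<Sum>s\<in>K. \<Sum>t\<in>K. F (fst p, s) (fst q, t) * G (s, snd p) (t, snd q))"
proof -
  obtain f where f: "\<And>i j. i \<in> I \<times> K \<Longrightarrow> j \<in> I \<times> K \<Longrightarrow> F i j = (\<Sum>r\<in>I \<times> K. f r i * cnj (f r j))"
    using psd_on_gramE[OF _ F] fin by blast
  obtain g where g: "\<And>i j. i \<in> K \<times> J \<Longrightarrow> j \<in> K \<times> J \<Longrightarrow> G i j = (\<Sum>r\<in>K \<times> J. g r i * cnj (g r j))"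
    using psd_on_gramE[OF _ G] fin by blast
  let ?R = "(I \<times> K) \<times> (K \<times> J)"
  let ?h = "\<lambda>r p. \<Sum>s\<in>K. f (fst r) (fst p, s) * g (snd r) (s, snd p)"
  show ?thesis
  proof (rule psd_on_gramI)
    fix p q assume pq: "p \<in> I \<times> J" "q \<in> I \<times> J"
    have "(\<Sum>s\<in>K. \<Sum>t\<in>K. F (fst p, s) (fst q, t) * G (s, snd p) (t, snd q)) =
      (\<Sum>s\<in>K. \<Sum>t\<in>K. \<Sum>r\<in>?R. (f (fst r) (fst p, s) * g (snd r) (s, snd p)) * 
         cnj (f (fst r) (fst q, t) * g (snd r) (t, snd q)))"
    proof (intro sum.cong refl)
      fix s t assume st: "s \<in> K" "t \<in> K"
      have "F (fst p, s) (fst q, t) * G (s, snd p) (t, snd q) =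
        (\<Sum>r\<in>I \<times> K. f r (fst p, s) * cnj (f r (fst q, t))) * (\<Sum>r\<in>K \<times> J. g r (s, snd p) * cnj (g r (t, snd q)))"
        using pq st by (simp add: f[of "(fst p, s)" "(fst q, t)"] g[of "(s, snd p)" "(t, snd q)"] mem_Times_iff)
      also have "\<dots> = (\<Sum>r\<in>?R. (f (fst r) (fst p, s) * g (snd r) (s, snd p)) * 
         cnj (f (fst r) (fst q, t) * g (snd r) (t, snd q)))"
        unfolding sum_product sum.cartesian_product
        by (intro sum.cong refl) (auto simp: mult_ac)
      finally show "F (fst p, s) (fst q, t) * G (s, snd p) (t, snd q) = \<dots>" .
    qed
    also have "\<dots> = (\<Sum>s\<in>K. \<Sum>r\<in>?R. \<Sum>t\<in>K. (f (fst r) (fst p, s) * g (snd r) (s, snd p)) * 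
         cnj (f (fst r) (fst q, t) * g (snd r) (t, snd q)))"
      by (intro sum.cong refl sum.swap)
    also have "\<dots> = (\<Sum>r\<in>?R. \<Sum>s\<in>K. \<Sum>t\<in>K. (f (fst r) (fst p, s) * g (snd r) (s, snd p)) * 
         cnj (f (fst r) (fst q, t) * g (snd r) (t, snd q)))"
      by (rule sum.swap)
    also have "\<dots> = (\<Sum>r\<in>?R. ?h r p * cnj (?h r q))"
      by (simp add: sum_product)
    finally show "(\<Sum>s\<in>K. \<Sum>t\<in>K. F (fst p, s) (fst q, t) * G (s, snd p) (t, snd q)) = (\<Sum>r\<in>?R. ?h r p * cnj (?h r q))" .
  qed
qed

lemma psd_on_tensor:
  assumes fin: "finite I" "finite J" and F: "psd_on I F" and G: "psd_on J G"
  shows "psd_on (I \<times> J) (\<lambda>p q. F (fst p) (fst q) * G (snd p) (snd q))"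
proof -
  have "psd_on (I \<times> {()}) (\<lambda>p q. F (fst p) (fst q))" "psd_on ({()} \<times> J) (\<lambda>p q. G (snd p) (snd q))"
    using psd_on_reindex[OF fin(1) F, of "I \<times> {()}" fst] psd_on_reindex[OF fin(2) G, of "{()} \<times> J" snd] by auto
  from psd_on_link[OF fin(1) _ fin(2) this] show ?thesis by simp
qed

section \<open>The bilinear pairing of kernels\<close>

definition kinner :: "'i set \<Rightarrow> ('i \<Rightarrow> 'i \<Rightarrow> complex) \<Rightarrow> ('i \<Rightarrow> 'i \<Rightarrow> complex) \<Rightarrow> complex" where
  "kinner I F G = (\<Sum>p\<in>I. \<Sum>q\<in>I. F p q * G p q)"

lemma kinner_cong:
  assumes "\<And>i j. i \<in> I \<Longrightarrow> j \<in> I \<Longrightarrow> F i j = F' i j" "\<And>i j. i \<in> I \<Longrightarrow> j \<in> I \<Longrightarrow> G i j = G' i j"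
  shows "kinner I F G = kinner I F' G'"
  unfolding kinner_def by (intro sum.cong refl) (auto simp: assms)

text \<open>A link product with one-point outer systems is a positive one-by-one kernel, whose entry
  is the pairing.\<close>

lemma kinner_nonneg:
  assumes I: "finite I" and F: "psd_on I F" and G: "psd_on I G"
  shows "0 \<le> kinner I F G"
proof -
  have "psd_on ({()} \<times> I) (\<lambda>p q. F (snd p) (snd q))" "psd_on (I \<times> {()}) (\<lambda>p q. G (fst p) (fst q))"
    using psd_on_reindex[OF I F, of "{()} \<times> I" snd] psd_on_reindex[OF I G, of "I \<times> {()}" fst] by auto
  then have "psd_on ({()} \<times> {()}) (\<lambda>p q. \<Sum>s\<in>I. \<Sum>t\<in>I. F s t * G s t)"
    using psd_on_link[OF finite.emptyI[THEN finite.insertI] I finite.emptyI[THEN finite.insertI],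
      of "()" "\<lambda>p q. F (snd p) (snd q)" "()" "\<lambda>p q. G (fst p) (fst q)"] by simp
  from psd_on_diag[OF _ this, of "((), ())"] show ?thesis unfolding kinner_def by simp
qed

lemma kinner_diff_left: "kinner I (\<lambda>p q. F p q - G p q) H = kinner I F H - kinner I G H"
  unfolding kinner_def sum_subtractf[symmetric] left_diff_distrib ..

lemma kinner_sum_right: "kinner I F (\<lambda>p q. \<Sum>r\<in>R. G r p q) = (\<Sum>r\<in>R. kinner I F (G r))"
proof -
  have "kinner I F (\<lambda>p q. \<Sum>r\<in>R. G r p q) = (\<Sum>p\<in>I. \<Sum>r\<in>R. \<Sum>q\<in>I. F p q * G r p q)"
    unfolding kinner_def sum_distrib_left by (intro sum.cong refl sum.swap)
  also have "\<dots> = (\<Sum>r\<in>R. \<Sum>p\<in>I. \<Sum>q\<in>I. F p q * G r p q)" by (rule sum.swap)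
  finally show ?thesis by (simp add: kinner_def)
qed

lemma kinner_herm_real:
  assumes "herm_on I F" "herm_on I G"
  shows "Im (kinner I F G) = 0"
proof -
  have "cnj (kinner I F G) = (\<Sum>p\<in>I. \<Sum>q\<in>I. F q p * G q p)"
    unfolding kinner_def cnj_sum
  proof (intro sum.cong refl)
    fix p q assume "p \<in> I" "q \<in> I"
    then have "F q p = cnj (F p q)" "G q p = cnj (G p q)"
      using assms unfolding herm_on_def by blast+
    then show "cnj (F p q * G p q) = F q p * G q p" by simp
  qed
  also have "\<dots> = kinner I F G" unfolding kinner_def by (rule sum.swap)
  finally show ?thesis by (simp add: complex_eq_iff)
qed

section \<open>Strong duality\<close>

definition sublinear :: "(('i \<Rightarrow> real) \<Rightarrow> real) \<Rightarrow> bool" where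
  "sublinear p \<longleftrightarrow> (\<forall>x y. p (\<lambda>i. x i + y i) \<le> p x + p y) \<and>
     (\<forall>c x. 0 < c \<longrightarrow> p (\<lambda>i. c * x i) = c * p x)"

lemma sublinear_add: "sublinear p \<Longrightarrow> p (\<lambda>i. x i + y i) \<le> p x + p y"
  unfolding sublinear_def by blast

lemma sublinear_scale: "sublinear p \<Longrightarrow> 0 < c \<Longrightarrow> p (\<lambda>i. c * x i) = c * p x"
  unfolding sublinear_def by blast

lemma sublinear_zero: "sublinear p \<Longrightarrow> p (\<lambda>i. 0) = 0"
  using sublinear_scale[of p 2 "\<lambda>i. 0"] by simp

lemma sublinear_scale': "sublinear p \<Longrightarrow> 0 \<le> c \<Longrightarrow> p (\<lambda>i. c * x i) = c * p x"
  using sublinear_scale[of p c x] sublinear_zero[of p] by (cases "c = 0") auto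

lemma sublinear_uminus: "sublinear p \<Longrightarrow> 0 \<le> p x + p (\<lambda>i. - x i)"
  using sublinear_add[of p x "\<lambda>i. - x i"] sublinear_zero[of p] by simp

text \<open>The largest sublinear minorant of \<open>p\<close> taking the value \<open>- p e\<close> at \<open>- e\<close>.\<close>

definition flatten :: "(('i \<Rightarrow> real) \<Rightarrow> real) \<Rightarrow> ('i \<Rightarrow> real) \<Rightarrow> ('i \<Rightarrow> real) \<Rightarrow> real" where
  "flatten p e x = (INF t\<in>{0..}. p (\<lambda>i. x i + t * e i) - t * p e)"

lemma flatten_le:
  assumes p: "sublinear p" and t: "0 \<le> t"
  shows "flatten p e x \<le> p (\<lambda>i. x i + t * e i) - t * p e"
  unfolding flatten_def
proof (rule cINF_lower)
  \<comment> \<open>Subadditivity, applied to the shifted vector and \<open>- x\<close>, bounds the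
    values from below independently of the shift, so the infimum is a genuine real infimum.\<close>
  show "bdd_below ((\<lambda>t. p (\<lambda>i. x i + t * e i) - t * p e) ` {0..})"
  proof (rule bdd_belowI2[of _ "- p (\<lambda>i. - x i)"])
    fix s :: real assume "s \<in> {0..}"
    then have "s * p e = p (\<lambda>i. s * e i)" using sublinear_scale'[OF p, of s e] by simp
    also have "\<dots> \<le> p (\<lambda>i. x i + s * e i) + p (\<lambda>i. - x i)"
      using sublinear_add[OF p, of "\<lambda>i. x i + s * e i" "\<lambda>i. - x i"] by simp
    finally show "- p (\<lambda>i. - x i) \<le> p (\<lambda>i. x i + s * e i) - s * p e" by simp
  qed
qed (use t in auto)

lemma flatten_approx:
  assumes "\<delta> > 0"
  shows "\<exists>t\<ge>0. p (\<lambda>i. x i + t * e i) - t * p e < flatten p e x + \<delta>"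
proof -
  have "Inf ((\<lambda>t. p (\<lambda>i. x i + t * e i) - t * p e) ` {0..}) < flatten p e x + \<delta>"
    using assms by (simp add: flatten_def)
  from cInf_lessD[OF _ this] show ?thesis by auto
qed

lemma flatten_minorant: "sublinear p \<Longrightarrow> flatten p e x \<le> p x"
  using flatten_le[of p 0 e x] by simp

lemma flatten_uminus: "sublinear p \<Longrightarrow> flatten p e (\<lambda>i. - e i) \<le> - p e"
  using flatten_le[of p 1 e "\<lambda>i. - e i"] sublinear_zero[of p] by simp

text \<open>Near-optimal shifts \<open>t\<close> for \<open>x\<close> and \<open>s\<close> for
  \<open>y\<close> combine to the shift \<open>t + s\<close> for the sum, and \<open>t\<close>
  scales to \<open>c * t\<close>. The missing half of homogeneity is the same inequality for the
  scalar \<open>inverse c\<close>.\<close>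

lemma sublinear_flatten:
  assumes p: "sublinear p"
  shows "sublinear (flatten p e)"
proof -
  have add: "flatten p e (\<lambda>i. x i + y i) \<le> flatten p e x + flatten p e y" for x y
  proof (rule field_le_epsilon)
    fix \<delta> :: real assume d: "\<delta> > 0"
    obtain t where t: "t \<ge> 0" "p (\<lambda>i. x i + t * e i) - t * p e < flatten p e x + \<delta> / 2"
      using flatten_approx[of "\<delta> / 2" p x e] d by auto
    obtain s where s: "s \<ge> 0" "p (\<lambda>i. y i + s * e i) - s * p e < flatten p e y + \<delta> / 2"
      using flatten_approx[of "\<delta> / 2" p y e] d by auto
    have "flatten p e (\<lambda>i. x i + y i) \<le> p (\<lambda>i. (x i + y i) + (t + s) * e i) - (t + s) * p e"
      using t s by (intro flatten_le[OF p]) auto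
    also have "(\<lambda>i. (x i + y i) + (t + s) * e i) = (\<lambda>i. (x i + t * e i) + (y i + s * e i))"
      by (simp add: algebra_simps)
    also have "p \<dots> \<le> p (\<lambda>i. x i + t * e i) + p (\<lambda>i. y i + s * e i)" by (rule sublinear_add[OF p])
    finally show "flatten p e (\<lambda>i. x i + y i) \<le> flatten p e x + flatten p e y + \<delta>"
      using t(2) s(2) by (simp add: algebra_simps)
  qed
  have sc: "flatten p e (\<lambda>i. c * x i) \<le> c * flatten p e x" if c: "c > 0" for c x
  proof (rule field_le_epsilon)
    fix \<delta> :: real assume d: "\<delta> > 0"
    obtain t where t: "t \<ge> 0" "p (\<lambda>i. x i + t * e i) - t * p e < flatten p e x + \<delta> / c"
      using flatten_approx[of "\<delta> / c" p x e] d c by auto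
    have "flatten p e (\<lambda>i. c * x i) \<le> p (\<lambda>i. c * x i + (c * t) * e i) - (c * t) * p e"
      using t c by (intro flatten_le[OF p]) auto
    also have "(\<lambda>i. c * x i + (c * t) * e i) = (\<lambda>i. c * (x i + t * e i))" by (simp add: algebra_simps)
    also have "p \<dots> = c * p (\<lambda>i. x i + t * e i)" by (rule sublinear_scale[OF p c])
    finally have "flatten p e (\<lambda>i. c * x i) \<le> c * (p (\<lambda>i. x i + t * e i) - t * p e)"
      by (simp add: algebra_simps)
    also have "\<dots> \<le> c * (flatten p e x + \<delta> / c)" using t(2) c by (intro mult_left_mono) auto
    finally show "flatten p e (\<lambda>i. c * x i) \<le> c * flatten p e x + \<delta>" using c by (simp add: algebra_simps)
  qed
  have "flatten p e (\<lambda>i. c * x i) = c * flatten p e x" if c: "c > 0" for c x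
  proof (rule antisym[OF sc[OF c]])
    have "flatten p e (\<lambda>i. inverse c * (c * x i)) \<le> inverse c * flatten p e (\<lambda>i. c * x i)"
      using c by (intro sc) auto
    then have "c * flatten p e x \<le> c * (inverse c * flatten p e (\<lambda>i. c * x i))"
      using c by (intro mult_left_mono) (auto simp: mult.assoc[symmetric])
    then show "c * flatten p e x \<le> flatten p e (\<lambda>i. c * x i)" using c by (simp add: mult.assoc[symmetric])
  qed
  with add show ?thesis unfolding sublinear_def by blast
qed

text \<open>Flattening along one unit vector at a time replaces Zorn's lemma. Earlier directions
  survive: a sublinear functional below one that is odd at \<open>d\<close> is itself squeezed into
  being odd at \<open>d\<close>.\<close>

lemma linear_on_finite_minorant:
  assumes I: "finite I" and p: "sublinear p"
  shows "\<exists>q. sublinear q \<and> (\<forall>x. q x \<le> p x) \<and>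
    (\<forall>k\<in>I. q (\<lambda>i. - (if i = k then 1 else 0)) = - q (\<lambda>i. if i = k then 1 else 0))"
  using I
proof (induction I rule: finite_induct)
  case empty
  then show ?case using p by auto
next
  case (insert k I)
  then obtain q where q: "sublinear q" "\<And>x. q x \<le> p x"
    "\<And>k. k \<in> I \<Longrightarrow> q (\<lambda>i. - (if i = k then 1 else 0)) = - q (\<lambda>i. if i = k then 1 else 0)" by blast
  define e where "e = (\<lambda>i. if i = k then 1 else 0 :: real)"
  let ?r = "flatten q e"
  have r: "sublinear ?r" "\<And>x. ?r x \<le> q x" "?r (\<lambda>i. - e i) \<le> - q e"
    using sublinear_flatten[OF q(1)] flatten_minorant[OF q(1)] flatten_uminus[OF q(1)] by auto
  have lin: "?r (\<lambda>i. - d i) = - ?r d" if "?r (\<lambda>i. - d i) \<le> - q d" for d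
    using that r(2)[of d] sublinear_uminus[OF r(1), of d] by linarith
  show ?case
  proof (intro exI[of _ ?r] conjI allI ballI)
    show "?r x \<le> p x" for x using r(2)[of x] q(2)[of x] by linarith
    fix j assume j: "j \<in> insert k I"
    show "?r (\<lambda>i. - (if i = j then 1 else 0)) = - ?r (\<lambda>i. if i = j then 1 else 0)"
    proof (rule lin, cases "j = k")
      case True
      then show "?r (\<lambda>i. - (if i = j then 1 else 0)) \<le> - q (\<lambda>i. if i = j then 1 else 0)"
        using r(3) unfolding e_def by simp
    next
      case False
      then show "?r (\<lambda>i. - (if i = j then 1 else 0)) \<le> - q (\<lambda>i. if i = j then 1 else 0)"
        using r(2)[of "\<lambda>i. - (if i = j then 1 else 0)"] q(3)[of j] j by simp
    qed
  qed (rule r)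
qed

text \<open>Flattening along \<open>x0\<close> comes before flattening along the coordinates: it
  fixes the value at \<open>- x0\<close>, and every later minorant then keeps the value of
  \<open>p\<close> at \<open>x0\<close>. The condition \<open>loc\<close> confines functionals on an
  arbitrary index type to the coordinates in \<open>I\<close>.\<close>

lemma hahn_banach_finite:
  fixes p :: "('i \<Rightarrow> real) \<Rightarrow> real"
  assumes I: "finite I" and p: "sublinear p" and loc: "\<And>x. p (\<lambda>i. if i \<in> I then x i else 0) = p x"
  obtains c where "\<And>x. (\<Sum>i\<in>I. c i * x i) \<le> p x" "(\<Sum>i\<in>I. c i * x0 i) = p x0"
proof -
  define y0 where "y0 = (\<lambda>i. if i \<in> I then x0 i else 0)"
  have p0: "sublinear (flatten p y0)" by (rule sublinear_flatten[OF p])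
  obtain q where q: "sublinear q" "\<And>x. q x \<le> flatten p y0 x"
    "\<And>k. k \<in> I \<Longrightarrow> q (\<lambda>i. - (if i = k then 1 else 0)) = - q (\<lambda>i. if i = k then 1 else 0)"
    using linear_on_finite_minorant[OF I p0] by blast
  have qp: "q x \<le> p x" for x
    using q(2)[of x] flatten_minorant[OF p, of y0 x] by linarith
  have q0: "q y0 = p y0"
    using q(2)[of "\<lambda>i. - y0 i"] flatten_uminus[OF p, of y0] sublinear_uminus[OF q(1), of y0] qp[of y0]
    by linarith
  define c where "c k = q (\<lambda>i. if i = k then 1 else 0)" for k
  have one: "q (\<lambda>i. if i = k then t else 0) = c k * t" if k: "k \<in> I" for k t
  proof (cases "t \<ge> 0")
    case True
    have "(\<lambda>i. if i = k then t else 0) = (\<lambda>i. t * (if i = k then 1 else 0))" by auto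
    then show ?thesis using sublinear_scale'[OF q(1) True] unfolding c_def by (simp add: mult.commute)
  next
    case False
    have "(\<lambda>i. if i = k then t else 0) = (\<lambda>i. (- t) * (- (if i = k then 1 else 0)))" by auto
    then have "q (\<lambda>i. if i = k then t else 0) = (- t) * q (\<lambda>i. - (if i = k then 1 else 0))"
      using sublinear_scale'[OF q(1), of "- t"] False by (metis linear neg_0_le_iff_le)
    then show ?thesis using q(3)[OF k] unfolding c_def by simp
  qed
  \<comment> \<open>Subadditivity yields one inequality for every \<open>x\<close>; applied to
    \<open>- x\<close> it yields the other.\<close>
  have up: "q (\<lambda>i. if i \<in> K then x i else 0) \<le> (\<Sum>i\<in>K. c i * x i)" if "finite K" "K \<subseteq> I" for K x
    using that
  proof (induction K rule: finite_induct)
    case empty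
    then show ?case using sublinear_zero[OF q(1)] by simp
  next
    case (insert k K)
    have "(\<lambda>i. if i \<in> insert k K then x i else 0) =
      (\<lambda>i. (if i = k then x k else 0) + (if i \<in> K then x i else 0))" using insert.hyps by auto
    then have "q (\<lambda>i. if i \<in> insert k K then x i else 0) \<le>
      q (\<lambda>i. if i = k then x k else 0) + q (\<lambda>i. if i \<in> K then x i else 0)"
      using sublinear_add[OF q(1)] by simp
    then show ?case using insert one[of k "x k"] by simp
  qed
  show thesis
  proof
    fix x
    have eq: "q (\<lambda>i. if i \<in> I then x i else 0) = (\<Sum>i\<in>I. c i * x i)" for x
    proof (rule antisym)
      show "q (\<lambda>i. if i \<in> I then x i else 0) \<le> (\<Sum>i\<in>I. c i * x i)" using up[OF I] by blast
      have "(\<lambda>i. - (if i \<in> I then x i else 0)) = (\<lambda>i. if i \<in> I then - x i else 0)" by auto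
      then show "(\<Sum>i\<in>I. c i * x i) \<le> q (\<lambda>i. if i \<in> I then x i else 0)"
        using up[OF I subset_refl, of "\<lambda>i. - x i"] sublinear_uminus[OF q(1), of "\<lambda>i. if i \<in> I then x i else 0"]
        by (simp add: sum_negf)
    qed
    show "(\<Sum>i\<in>I. c i * x i) \<le> p x"
      unfolding eq[symmetric] using qp loc[of x] by metis
    show "(\<Sum>i\<in>I. c i * x0 i) = p x0"
      unfolding eq[symmetric] using q0 loc[of x0] unfolding y0_def by simp
  qed
qed

section \<open>The semidefinite program over channels and its dual\<close>

definition id_kron :: "('b \<Rightarrow> 'b \<Rightarrow> complex) \<Rightarrow> 'a \<times> 'b \<Rightarrow> 'a \<times> 'b \<Rightarrow> complex" where
  "id_kron T p q = (if fst p = fst q then T (snd p) (snd q) else 0)"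

lemma herm_on_id_kron:
  assumes "herm_on B T"
  shows "herm_on (A \<times> B) (id_kron T)"
proof (rule herm_onI)
  fix p q assume "p \<in> A \<times> B" "q \<in> A \<times> B"
  then have "T (snd q) (snd p) = cnj (T (snd p) (snd q))" using assms by (intro herm_onD) auto
  then show "id_kron T q p = cnj (id_kron T p q)" by (simp add: id_kron_def)
qed

definition ktrace :: "'b set \<Rightarrow> ('b \<Rightarrow> 'b \<Rightarrow> complex) \<Rightarrow> real" where
  "ktrace B T = Re (\<Sum>k\<in>B. T k k)"

definition dominates :: "'a set \<Rightarrow> 'b set \<Rightarrow> ('a \<times> 'b \<Rightarrow> 'a \<times> 'b \<Rightarrow> complex) \<Rightarrow> ('b \<Rightarrow> 'b \<Rightarrow> complex) \<Rightarrow> bool" where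
  "dominates A B X T \<longleftrightarrow> herm_on B T \<and> psd_on (A \<times> B) (\<lambda>p q. id_kron T p q - X p q)"

text \<open>The Choi kernels of channels from \<open>B\<close> to \<open>A\<close>: \<open>W (i, k) (j, l)\<close> is the \<open>(i, j)\<close> entry of the
  image of the matrix unit with index \<open>(k, l)\<close>, so that \<open>kinner\<close> needs no transpose.\<close>

definition chan_ker :: "'a set \<Rightarrow> 'b set \<Rightarrow> ('a \<times> 'b \<Rightarrow> 'a \<times> 'b \<Rightarrow> complex) \<Rightarrow> bool" where
  "chan_ker A B W \<longleftrightarrow> psd_on (A \<times> B) W \<and>
     (\<forall>k\<in>B. \<forall>l\<in>B. (\<Sum>i\<in>A. W (i, k) (i, l)) = (if k = l then 1 else 0))"

text \<open>The dual program; the primal one maximises \<open>Re (kinner (A \<times> B) X W)\<close>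
  over channel kernels \<open>W\<close>. Taking the dual side as the definition makes sublinearity
  in \<open>X\<close> a matter of adding and scaling feasible points, which is what Hahn-Banach asks
  for.\<close>

definition dualval :: "'a set \<Rightarrow> 'b set \<Rightarrow> ('a \<times> 'b \<Rightarrow> 'a \<times> 'b \<Rightarrow> complex) \<Rightarrow> real" where
  "dualval A B X = Inf (ktrace B ` {T. dominates A B X T})"

lemma kinner_prod:
  "kinner (A \<times> B) F G = (\<Sum>i\<in>A. \<Sum>k\<in>B. \<Sum>j\<in>A. \<Sum>l\<in>B. F (i, k) (j, l) * G (i, k) (j, l))"
  unfolding kinner_def by (simp add: sum.cartesian_product')

lemma kinner_id_kron:
  assumes A: "finite A"
  shows "kinner (A \<times> B) (id_kron T) W = (\<Sum>k\<in>B. \<Sum>l\<in>B. T k l * (\<Sum>i\<in>A. W (i, k) (i, l)))"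
proof -
  have "kinner (A \<times> B) (id_kron T) W = (\<Sum>i\<in>A. \<Sum>k\<in>B. \<Sum>l\<in>B. T k l * W (i, k) (i, l))"
    unfolding kinner_prod
  proof (intro sum.cong refl)
    fix i k assume i: "i \<in> A"
    have "(\<Sum>j\<in>A. \<Sum>l\<in>B. id_kron T (i, k) (j, l) * W (i, k) (j, l)) =
      (\<Sum>j\<in>A. if i = j then \<Sum>l\<in>B. T k l * W (i, k) (j, l) else 0)"
      by (intro sum.cong refl) (simp add: id_kron_def)
    then show "(\<Sum>j\<in>A. \<Sum>l\<in>B. id_kron T (i, k) (j, l) * W (i, k) (j, l)) =
      (\<Sum>l\<in>B. T k l * W (i, k) (i, l))" using A i by (simp add: sum.delta)
  qed
  also have "\<dots> = (\<Sum>k\<in>B. \<Sum>i\<in>A. \<Sum>l\<in>B. T k l * W (i, k) (i, l))" by (rule sum.swap)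
  also have "\<dots> = (\<Sum>k\<in>B. \<Sum>l\<in>B. \<Sum>i\<in>A. T k l * W (i, k) (i, l))"
    by (intro sum.cong refl sum.swap)
  finally show ?thesis by (simp add: sum_distrib_left)
qed

text \<open>Trace preservation fixes the marginal of \<open>W\<close>, so every channel gives
  \<open>1 \<otimes> T\<close> the same value. Weak duality is this together with positivity of the
  pairing.\<close>

lemma kinner_id_kron_chan:
  assumes "finite A" "finite B" "chan_ker A B W"
  shows "kinner (A \<times> B) (id_kron T) W = (\<Sum>k\<in>B. T k k)"
proof -
  have "kinner (A \<times> B) (id_kron T) W = (\<Sum>k\<in>B. \<Sum>l\<in>B. if k = l then T k l else 0)"
    unfolding kinner_id_kron[OF assms(1)] using assms(3) unfolding chan_ker_def
    by (intro sum.cong refl) simp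
  then show ?thesis using assms(2) by (simp add: sum.delta)
qed

lemma weak_duality:
  assumes A: "finite A" and B: "finite B" and T: "dominates A B X T" and W: "chan_ker A B W"
  shows "Re (kinner (A \<times> B) X W) \<le> ktrace B T"
proof -
  have "0 \<le> kinner (A \<times> B) (\<lambda>p q. id_kron T p q - X p q) W"
    using T W A B unfolding dominates_def chan_ker_def by (intro kinner_nonneg) auto
  then show ?thesis unfolding kinner_diff_left kinner_id_kron_chan[OF A B W] ktrace_def
    by (simp add: less_eq_complex_def)
qed

lemma qform_eq_kinner: "qform I F v = kinner I (\<lambda>p q. cnj (v p) * v q) F"
  unfolding qform_def kinner_def by (intro sum.cong refl) (simp add: mult_ac)

text \<open>Makes the dual program feasible for every Hermitian objective. A crude constant
  suffices, the sum of the moduli of all entries, because the product of the moduli of two entries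
  of \<open>v\<close> is at most its squared norm.\<close>

lemma herm_dominated:
  assumes I: "finite I" and X: "herm_on I X"
  obtains c :: real where "psd_on I (\<lambda>p q. (if p = q then of_real c else 0) - X p q)"
proof -
  define c where "c = (\<Sum>p\<in>I. \<Sum>q\<in>I. cmod (X p q))"
  have "0 \<le> qform I (\<lambda>p q. (if p = q then of_real c else 0) - X p q) v" for v
  proof -
    define S where "S = (\<Sum>p\<in>I. (cmod (v p))\<^sup>2)"
    have S: "(cmod (v p))\<^sup>2 \<le> S" if "p \<in> I" for p
      unfolding S_def using I that by (intro member_le_sum) auto
    have vv: "cmod (v p) * cmod (v q) \<le> S" if "p \<in> I" "q \<in> I" for p q
    proof -
      have "0 \<le> (cmod (v p) - cmod (v q))\<^sup>2" by simp
      then have "2 * (cmod (v p) * cmod (v q)) \<le> (cmod (v p))\<^sup>2 + (cmod (v q))\<^sup>2"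
        by (simp add: power2_diff)
      then show ?thesis using S[OF that(1)] S[OF that(2)] by linarith
    qed
    have "qform I (\<lambda>p q. (if p = q then of_real c else 0) - X p q) v =
      (\<Sum>p\<in>I. \<Sum>q\<in>I. if p = q then cnj (v p) * of_real c * v q else 0) - qform I X v"
      unfolding qform_def sum_subtractf[symmetric] by (intro sum.cong refl) (simp add: algebra_simps)
    also have "(\<Sum>p\<in>I. \<Sum>q\<in>I. if p = q then cnj (v p) * of_real c * v q else 0) =
      (\<Sum>p\<in>I. of_real (c * (cmod (v p))\<^sup>2))"
    proof (intro sum.cong refl)
      fix p assume "p \<in> I"
      then have "(\<Sum>q\<in>I. if p = q then cnj (v p) * of_real c * v q else 0) = of_real c * (v p * cnj (v p))"
        using I by (simp add: sum.delta mult_ac)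
      then show "(\<Sum>q\<in>I. if p = q then cnj (v p) * of_real c * v q else 0) = of_real (c * (cmod (v p))\<^sup>2)"
        unfolding complex_norm_square[symmetric] by simp
    qed
    also have "\<dots> = of_real (c * S)" unfolding S_def sum_distrib_left of_real_sum ..
    finally have q: "qform I (\<lambda>p q. (if p = q then of_real c else 0) - X p q) v = of_real (c * S) - qform I X v" .
    have "herm_on I (\<lambda>p q. cnj (v p) * v q)" unfolding herm_on_def by simp
    then have im: "Im (qform I X v) = 0" unfolding qform_eq_kinner by (rule kinner_herm_real[OF _ X])
    have "Re (qform I X v) \<le> cmod (qform I X v)" by (rule complex_Re_le_cmod)
    also have "\<dots> \<le> (\<Sum>p\<in>I. \<Sum>q\<in>I. cmod (cnj (v p) * X p q * v q))"
      unfolding qform_def by (intro order_trans[OF norm_sum] sum_mono norm_sum)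
    also have "\<dots> \<le> (\<Sum>p\<in>I. \<Sum>q\<in>I. cmod (X p q) * S)"
    proof (intro sum_mono)
      fix p q assume pq: "p \<in> I" "q \<in> I"
      have "cmod (cnj (v p) * X p q * v q) = cmod (X p q) * (cmod (v p) * cmod (v q))"
        by (simp add: norm_mult mult_ac)
      also have "\<dots> \<le> cmod (X p q) * S" using vv[OF pq] by (intro mult_left_mono) auto
      finally show "cmod (cnj (v p) * X p q * v q) \<le> cmod (X p q) * S" .
    qed
    also have "\<dots> = c * S" unfolding c_def sum_distrib_right ..
    finally show ?thesis unfolding q using im by (simp add: less_eq_complex_def)
  qed
  then show thesis using that unfolding psd_on_def by blast
qed

lemma dominates_ex:
  assumes "finite A" "finite B" "herm_on (A \<times> B) X"
  obtains T where "dominates A B X T"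
proof -
  obtain c :: real where c: "psd_on (A \<times> B) (\<lambda>p q. (if p = q then of_real c else 0) - X p q)"
    using herm_dominated[OF _ assms(3)] assms by auto
  have "(if p = q then of_real c else 0) = id_kron (\<lambda>k l. if k = l then of_real c else 0 :: complex) p q"
    for p q :: "'a \<times> 'b" by (auto simp: id_kron_def prod_eq_iff)
  then have "dominates A B X (\<lambda>k l. if k = l then of_real c else 0)"
    using c unfolding dominates_def herm_on_def by auto
  then show thesis by (rule that)
qed

text \<open>Any feasible \<open>T\<close> dominates the diagonal block of \<open>X\<close> at
  \<open>i\<close>, so the dual objective is bounded below. The same bound later shows that
  \<open>dualval\<close> is positive.\<close>

lemma dominates_bound:
  assumes A: "finite A" and B: "finite B" and i: "i \<in> A" and T: "dominates A B X T"
  shows "(\<Sum>k\<in>B. Re (X (i, k) (i, k))) \<le> ktrace B T"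
  unfolding ktrace_def Re_sum
proof (intro sum_mono)
  fix k assume k: "k \<in> B"
  have "0 \<le> id_kron T (i, k) (i, k) - X (i, k) (i, k)"
    using psd_on_diag[of "A \<times> B" "\<lambda>p q. id_kron T p q - X p q" "(i, k)"] T A B i k
    unfolding dominates_def by auto
  then show "Re (X (i, k) (i, k)) \<le> Re (T k k)" by (simp add: id_kron_def less_eq_complex_def)
qed

context
  fixes A :: "'a set" and B :: "'b set"
  assumes A: "finite A" "A \<noteq> {}" and B: "finite B"
begin

lemma dualval_le: "dominates A B X T \<Longrightarrow> dualval A B X \<le> ktrace B T"
proof -
  assume T: "dominates A B X T"
  obtain i where i: "i \<in> A" using A by blast
  have "bdd_below (ktrace B ` {T. dominates A B X T})"
    using dominates_bound[OF A(1) B i] by (intro bdd_belowI2) auto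
  then show ?thesis unfolding dualval_def using T by (intro cINF_lower) auto
qed

lemma dualval_approx:
  assumes "herm_on (A \<times> B) X" "\<delta> > 0"
  obtains T where "dominates A B X T" "ktrace B T < dualval A B X + \<delta>"
proof -
  have ne: "ktrace B ` {T. dominates A B X T} \<noteq> {}" using dominates_ex[OF A(1) B assms(1)] by blast
  have lt: "Inf (ktrace B ` {T. dominates A B X T}) < dualval A B X + \<delta>"
    using assms(2) by (simp add: dualval_def)
  from cInf_lessD[OF ne lt] that show thesis by auto
qed

lemma dominates_cong:
  assumes "\<And>p q. p \<in> A \<times> B \<Longrightarrow> q \<in> A \<times> B \<Longrightarrow> X p q = Y p q"
  shows "dominates A B X T \<longleftrightarrow> dominates A B Y T"
proof -
  have "psd_on (A \<times> B) (\<lambda>p q. id_kron T p q - X p q) \<longleftrightarrow> psd_on (A \<times> B) (\<lambda>p q. id_kron T p q - Y p q)"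
    using assms by (intro psd_on_cong) simp
  then show ?thesis unfolding dominates_def by simp
qed

lemma dualval_cong:
  assumes "\<And>p q. p \<in> A \<times> B \<Longrightarrow> q \<in> A \<times> B \<Longrightarrow> X p q = Y p q"
  shows "dualval A B X = dualval A B Y"
proof -
  have "{T. dominates A B X T} = {T. dominates A B Y T}" using dominates_cong[of X Y] assms by blast
  then show ?thesis unfolding dualval_def by simp
qed

lemma dualval_add:
  assumes "herm_on (A \<times> B) X" "herm_on (A \<times> B) Y"
  shows "dualval A B (\<lambda>p q. X p q + Y p q) \<le> dualval A B X + dualval A B Y"
proof (rule field_le_epsilon)
  fix \<delta> :: real assume d: "\<delta> > 0"
  obtain T where T: "dominates A B X T" "ktrace B T < dualval A B X + \<delta> / 2"
    using dualval_approx[OF assms(1), of "\<delta> / 2"] d by auto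
  obtain S where S: "dominates A B Y S" "ktrace B S < dualval A B Y + \<delta> / 2"
    using dualval_approx[OF assms(2), of "\<delta> / 2"] d by auto
  have "psd_on (A \<times> B) (\<lambda>p q. (id_kron T p q - X p q) + (id_kron S p q - Y p q))"
    using T S unfolding dominates_def by (intro psd_on_add) auto
  moreover have "(\<lambda>p q. (id_kron T p q - X p q) + (id_kron S p q - Y p q)) =
    (\<lambda>p q :: 'a \<times> 'b. id_kron (\<lambda>k l. T k l + S k l) p q - (X p q + Y p q))"
    by (intro ext) (simp add: id_kron_def)
  ultimately have "dominates A B (\<lambda>p q. X p q + Y p q) (\<lambda>k l. T k l + S k l)"
    using T S unfolding dominates_def by (simp add: herm_on_add)
  then have "dualval A B (\<lambda>p q. X p q + Y p q) \<le> ktrace B (\<lambda>k l. T k l + S k l)" by (rule dualval_le)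
  also have "\<dots> = ktrace B T + ktrace B S" by (simp add: ktrace_def sum.distrib)
  finally show "dualval A B (\<lambda>p q. X p q + Y p q) \<le> dualval A B X + dualval A B Y + \<delta>"
    using T S by simp
qed

lemma dualval_scale_le:
  assumes "herm_on (A \<times> B) X" "c > 0"
  shows "dualval A B (\<lambda>p q. of_real c * X p q) \<le> c * dualval A B X"
proof (rule field_le_epsilon)
  fix \<delta> :: real assume d: "\<delta> > 0"
  obtain T where T: "dominates A B X T" "ktrace B T < dualval A B X + \<delta> / c"
    using dualval_approx[OF assms(1), of "\<delta> / c"] d assms(2) by auto
  have "psd_on (A \<times> B) (\<lambda>p q. of_real c * (id_kron T p q - X p q))"
    using T assms(2) unfolding dominates_def by (intro psd_on_scale) auto
  moreover have "(\<lambda>p q. of_real c * (id_kron T p q - X p q)) =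
    (\<lambda>p q :: 'a \<times> 'b. id_kron (\<lambda>k l. of_real c * T k l) p q - of_real c * X p q)"
    by (intro ext) (simp add: id_kron_def algebra_simps)
  ultimately have "dominates A B (\<lambda>p q. of_real c * X p q) (\<lambda>k l. of_real c * T k l)"
    using T unfolding dominates_def by (simp add: herm_on_scale)
  then have "dualval A B (\<lambda>p q. of_real c * X p q) \<le> ktrace B (\<lambda>k l. of_real c * T k l)" by (rule dualval_le)
  also have "\<dots> = c * ktrace B T" by (simp add: ktrace_def sum_distrib_left)
  also have "\<dots> \<le> c * (dualval A B X + \<delta> / c)" using T assms(2) by (intro mult_left_mono) auto
  finally show "dualval A B (\<lambda>p q. of_real c * X p q) \<le> c * dualval A B X + \<delta>"
    using assms(2) by (simp add: algebra_simps)
qed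

lemma dualval_scale:
  assumes X: "herm_on (A \<times> B) X" and c: "c > 0"
  shows "dualval A B (\<lambda>p q. of_real c * X p q) = c * dualval A B X"
proof (rule antisym[OF dualval_scale_le[OF assms]])
  have "herm_on (A \<times> B) (\<lambda>p q. of_real c * X p q)" by (rule herm_on_scale[OF X])
  then have "dualval A B (\<lambda>p q. of_real (inverse c) * (of_real c * X p q)) \<le>
    inverse c * dualval A B (\<lambda>p q. of_real c * X p q)"
    by (rule dualval_scale_le) (use c in auto)
  moreover have "(\<lambda>p q. of_real (inverse c) * (of_real c * X p q)) = X"
    using c by (intro ext) (simp add: mult.assoc[symmetric])
  ultimately show "c * dualval A B X \<le> dualval A B (\<lambda>p q. of_real c * X p q)"
    using c by (simp add: field_simps)
qed

text \<open>Hahn-Banach in the real coordinates \<open>x\<close> of Hermitian kernels given by \<open>hk\<close> below yields a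
  linear functional below \<open>dualval\<close> that touches it at \<open>X\<close>; positivity and the marginal
  condition of its kernel are the inequalities at negative kernels and at \<open>id_kron T\<close>.\<close>

lemma strong_duality:
  assumes X: "herm_on (A \<times> B) X"
  obtains W where "chan_ker A B W" "Re (kinner (A \<times> B) X W) = dualval A B X"
proof -
  let ?I = "A \<times> B"
  have finI: "finite ?I" using A B by simp
  \<comment> \<open>Symmetrising for the real part and antisymmetrising for the imaginary part sends
    every real function \<open>x\<close> to a Hermitian kernel, so the coordinates are
    unconstrained; \<open>xc\<close> below is a right inverse on Hermitian kernels.\<close>
  define hk where "hk x p q = Complex (x (p, q) + x (q, p)) (x (p, q) - x (q, p))"
    for x :: "('a \<times> 'b) \<times> ('a \<times> 'b) \<Rightarrow> real" and p q
  have hk: "herm_on J (hk x)" for J x by (simp add: herm_on_def hk_def complex_eq_iff)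
  have sub: "sublinear (\<lambda>x. dualval A B (hk x))"
    unfolding sublinear_def
  proof (intro conjI allI impI)
    fix x y :: "('a \<times> 'b) \<times> ('a \<times> 'b) \<Rightarrow> real"
    have "hk (\<lambda>i. x i + y i) = (\<lambda>p q. hk x p q + hk y p q)"
      by (intro ext) (simp add: hk_def complex_eq_iff)
    then show "dualval A B (hk (\<lambda>i. x i + y i)) \<le> dualval A B (hk x) + dualval A B (hk y)"
      using dualval_add[OF hk hk] by simp
  next
    fix c :: real and x :: "('a \<times> 'b) \<times> ('a \<times> 'b) \<Rightarrow> real" assume c: "c > 0"
    have "hk (\<lambda>i. c * x i) = (\<lambda>p q. of_real c * hk x p q)"
      by (intro ext) (simp add: hk_def complex_eq_iff algebra_simps)
    then show "dualval A B (hk (\<lambda>i. c * x i)) = c * dualval A B (hk x)"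
      using dualval_scale[OF hk c] by simp
  qed
  have loc: "dualval A B (hk (\<lambda>i. if i \<in> ?I \<times> ?I then x i else 0)) = dualval A B (hk x)" for x
    by (rule dualval_cong) (simp add: hk_def)
  define xc where "xc F = (\<lambda>(p, q). (Re (F p q) + Im (F p q)) / 2)"
    for F :: "'a \<times> 'b \<Rightarrow> 'a \<times> 'b \<Rightarrow> complex"
  have hx: "dualval A B (hk (xc F)) = dualval A B F" if F: "herm_on ?I F" for F
  proof (rule dualval_cong)
    fix p q assume "p \<in> ?I" "q \<in> ?I"
    then have "F q p = cnj (F p q)" using F unfolding herm_on_def by blast
    then show "hk (xc F) p q = F p q" by (simp add: hk_def xc_def complex_eq_iff field_simps)
  qed
  obtain c where c: "\<And>x. (\<Sum>i\<in>?I \<times> ?I. c i * x i) \<le> dualval A B (hk x)"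
    "(\<Sum>i\<in>?I \<times> ?I. c i * xc X i) = dualval A B (hk (xc X))"
    using hahn_banach_finite[OF _ sub loc, of "xc X"] finI by blast
  \<comment> \<open>The kernel whose pairing with a Hermitian \<open>F\<close> is the functional
    \<open>c\<close> at \<open>xc F\<close>. The 4 combines the symmetrisation over the two orders
    of \<open>p\<close> and \<open>q\<close> with the factor 1/2 in \<open>xc\<close>.\<close>
  define W where "W p q = Complex ((c (p, q) + c (q, p)) / 4) ((c (q, p) - c (p, q)) / 4)" for p q
  have hW: "herm_on J W" for J by (simp add: herm_on_def W_def complex_eq_iff field_simps)
  have kW: "Re (kinner ?I F W) = (\<Sum>i\<in>?I \<times> ?I. c i * xc F i)" if F: "herm_on ?I F" for F
  proof -
    have sw: "(\<Sum>p\<in>?I. \<Sum>q\<in>?I. c (q, p) * (Re (F p q) - Im (F p q))) =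
      (\<Sum>p\<in>?I. \<Sum>q\<in>?I. c (p, q) * (Re (F p q) + Im (F p q)))"
    proof -
      have "(\<Sum>p\<in>?I. \<Sum>q\<in>?I. c (q, p) * (Re (F p q) - Im (F p q))) =
        (\<Sum>q\<in>?I. \<Sum>p\<in>?I. c (q, p) * (Re (F p q) - Im (F p q)))" by (rule sum.swap)
      also have "\<dots> = (\<Sum>q\<in>?I. \<Sum>p\<in>?I. c (q, p) * (Re (F q p) + Im (F q p)))"
      proof (intro sum.cong refl)
        fix q p assume "q \<in> ?I" "p \<in> ?I"
        then have "F q p = cnj (F p q)" using F unfolding herm_on_def by blast
        then show "c (q, p) * (Re (F p q) - Im (F p q)) = c (q, p) * (Re (F q p) + Im (F q p))" by simp
      qed
      finally show ?thesis .
    qed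
    have "Re (kinner ?I F W) = (\<Sum>p\<in>?I. \<Sum>q\<in>?I. c (p, q) * (Re (F p q) + Im (F p q)) / 4
       + c (q, p) * (Re (F p q) - Im (F p q)) / 4)"
      unfolding kinner_def Re_sum by (intro sum.cong refl) (simp add: W_def field_simps)
    also have "\<dots> = (\<Sum>p\<in>?I. \<Sum>q\<in>?I. c (p, q) * (Re (F p q) + Im (F p q))) / 4
       + (\<Sum>p\<in>?I. \<Sum>q\<in>?I. c (q, p) * (Re (F p q) - Im (F p q))) / 4"
      by (simp only: sum.distrib sum_divide_distrib)
    also have "\<dots> = (\<Sum>p\<in>?I. \<Sum>q\<in>?I. c (p, q) * (Re (F p q) + Im (F p q))) / 2"
      unfolding sw by simp
    also have "\<dots> = (\<Sum>i\<in>?I \<times> ?I. c i * xc F i)"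
      unfolding sum_divide_distrib sum.cartesian_product
      by (intro sum.cong refl) (auto simp: xc_def)
    finally show ?thesis .
  qed
  have le: "Re (kinner ?I F W) \<le> dualval A B F" if F: "herm_on ?I F" for F
    unfolding kW[OF F] hx[OF F, symmetric] by (rule c(1))
  have psd: "psd_on ?I W"
    unfolding psd_on_def
  proof
    fix v
    \<comment> \<open>A negative rank-one objective is dominated by \<open>T = 0\<close>, so the
      functional is nonpositive on it, which is positivity of \<open>W\<close> at
      \<open>v\<close>.\<close>
    define F where "F p q = - (cnj (v p) * v q)" for p q :: "'a \<times> 'b"
    have F: "herm_on ?I F" by (simp add: F_def herm_on_def)
    have "psd_on ?I (\<lambda>p q. cnj (v p) * v q)"
      by (rule psd_on_gramI[where R = "{()}" and f = "\<lambda>_ p. cnj (v p)"]) simp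
    then have "dominates A B F (\<lambda>_ _. 0)"
      unfolding dominates_def F_def by (simp add: id_kron_def herm_on_def)
    then have "dualval A B F \<le> 0" using dualval_le by (fastforce simp: ktrace_def)
    then have "Re (kinner ?I F W) \<le> 0" using le[OF F] by linarith
    moreover have "qform ?I W v = - kinner ?I F W"
      unfolding qform_eq_kinner kinner_def F_def by (simp add: sum_negf)
    moreover have "Im (kinner ?I F W) = 0" by (rule kinner_herm_real[OF F hW])
    ultimately show "0 \<le> qform ?I W v" by (simp add: less_eq_complex_def)
  qed
  define M where "M k l = (\<Sum>i\<in>A. W (i, k) (i, l))" for k l
  have hM: "M l k = cnj (M k l)" for k l
    unfolding M_def cnj_sum by (intro sum.cong refl) (simp add: W_def complex_eq_iff field_simps)
  have marg: "Re (\<Sum>k\<in>B. \<Sum>l\<in>B. T k l * M k l) \<le> ktrace B T" if T: "herm_on B T" for T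
  proof -
    have h: "herm_on ?I (id_kron T)" by (rule herm_on_id_kron[OF T])
    have "dominates A B (id_kron T) T" unfolding dominates_def using T psd_on_zero by simp
    from dualval_le[OF this] le[OF h] show ?thesis unfolding kinner_id_kron[OF A(1)] M_def by simp
  qed
  define D where "D k l = M k l - (if k = l then 1 else 0)" for k l
  have hD: "D l k = cnj (D k l)" for k l unfolding D_def using hM[of k l] by simp
  \<comment> \<open>\<open>D\<close> is the defect of the marginal of \<open>W\<close>. Testing with
    its conjugate bounds the sum of the squared moduli of its entries by 0.\<close>
  let ?T = "\<lambda>k l. cnj (D k l)"
  have hT: "herm_on B ?T" unfolding herm_on_def
  proof (intro ballI)
    fix k l
    have "D l k = cnj (D k l)" by (rule hD)
    then show "?T l k = cnj (?T k l)" by simp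
  qed
  have "Re (\<Sum>k\<in>B. \<Sum>l\<in>B. ?T k l * M k l) = Re (\<Sum>k\<in>B. \<Sum>l\<in>B. ?T k l * D k l) + ktrace B ?T"
  proof -
    have "(\<Sum>k\<in>B. \<Sum>l\<in>B. ?T k l * M k l) = (\<Sum>k\<in>B. \<Sum>l\<in>B. ?T k l * D k l + (if k = l then ?T k l else 0))"
      by (intro sum.cong refl) (simp add: D_def algebra_simps)
    also have "\<dots> = (\<Sum>k\<in>B. \<Sum>l\<in>B. ?T k l * D k l) + (\<Sum>k\<in>B. \<Sum>l\<in>B. if k = l then ?T k l else 0)"
      by (simp only: sum.distrib)
    also have "(\<Sum>k\<in>B. \<Sum>l\<in>B. if k = l then ?T k l else 0) = (\<Sum>k\<in>B. ?T k k)"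
      using B by (intro sum.cong refl) (simp add: sum.delta)
    finally show ?thesis unfolding ktrace_def by simp
  qed
  then have le0: "Re (\<Sum>k\<in>B. \<Sum>l\<in>B. ?T k l * D k l) \<le> 0" using marg[OF hT] by linarith
  have "Re (\<Sum>k\<in>B. \<Sum>l\<in>B. ?T k l * D k l) = (\<Sum>k\<in>B. \<Sum>l\<in>B. (cmod (D k l))\<^sup>2)"
    unfolding Re_sum by (intro sum.cong refl) (simp add: cmod_power2 flip: power2_eq_square)
  then have "(\<Sum>k\<in>B. \<Sum>l\<in>B. (cmod (D k l))\<^sup>2) \<le> 0" using le0 by linarith
  moreover have "0 \<le> (\<Sum>k\<in>B. \<Sum>l\<in>B. (cmod (D k l))\<^sup>2)" by (intro sum_nonneg) simp
  ultimately have "(\<Sum>k\<in>B. \<Sum>l\<in>B. (cmod (D k l))\<^sup>2) = 0" by (rule antisym)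
  then have "D k l = 0" if "k \<in> B" "l \<in> B" for k l
    using B that by (auto simp: sum_nonneg_eq_0_iff sum_nonneg)
  then have "chan_ker A B W" using psd unfolding chan_ker_def D_def M_def by simp
  moreover have "Re (kinner ?I X W) = dualval A B X" using c(2) unfolding kW[OF X] hx[OF X] by simp
  ultimately show thesis by (rule that)
qed

end

section \<open>Extremal values and tensor products\<close>

text \<open>By strong duality for \<open>- J\<close>, the minimum of the pairing over channels. On
  the dual side, it is the supremum of the traces of Hermitian \<open>\<tau>\<close> with
  \<open>1 \<otimes> \<tau> \<le> J\<close>, the form in which it meets
  \<open>I_doe\<close>.\<close>

definition minval :: "'a set \<Rightarrow> 'b set \<Rightarrow> ('a \<times> 'b \<Rightarrow> 'a \<times> 'b \<Rightarrow> complex) \<Rightarrow> real" where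
  "minval A B J = - dualval A B (\<lambda>p q. - J p q)"

lemma herm_on_uminus: "herm_on I F \<Longrightarrow> herm_on I (\<lambda>p q. - F p q)"
  using herm_on_scale[of I F "-1"] by simp

lemma kinner_uminus: "kinner I (\<lambda>p q. - F p q) G = - kinner I F G"
  by (simp add: kinner_def sum_negf)

context
  fixes A :: "'a set" and B :: "'b set"
  assumes A: "finite A" "A \<noteq> {}" and B: "finite B"
begin

lemma kinner_le_dualval:
  assumes "herm_on (A \<times> B) J" "chan_ker A B W"
  shows "Re (kinner (A \<times> B) J W) \<le> dualval A B J"
proof (rule field_le_epsilon)
  fix \<delta> :: real assume "\<delta> > 0"
  then obtain T where "dominates A B J T" "ktrace B T < dualval A B J + \<delta>"
    using dualval_approx[OF A B assms(1)] by blast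
  then show "Re (kinner (A \<times> B) J W) \<le> dualval A B J + \<delta>"
    using weak_duality[OF A(1) B _ assms(2)] by fastforce
qed

lemma minval_le_kinner:
  assumes "herm_on (A \<times> B) J" "chan_ker A B W"
  shows "minval A B J \<le> Re (kinner (A \<times> B) J W)"
  using kinner_le_dualval[OF herm_on_uminus[OF assms(1)] assms(2)]
  by (simp add: kinner_uminus minval_def)

lemma minval_attained:
  assumes "herm_on (A \<times> B) J"
  obtains W where "chan_ker A B W" "Re (kinner (A \<times> B) J W) = minval A B J"
  using strong_duality[OF A B herm_on_uminus[OF assms]] unfolding minval_def kinner_uminus
  by (metis add.inverse_inverse uminus_complex.simps(1))

lemma minval_nonneg:
  assumes "psd_on (A \<times> B) J"
  shows "0 \<le> minval A B J"
proof -
  have "herm_on (A \<times> B) J" using psd_on_herm[OF _ assms] A B by simp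
  then obtain W where W: "chan_ker A B W" "Re (kinner (A \<times> B) J W) = minval A B J"
    by (rule minval_attained)
  have "0 \<le> kinner (A \<times> B) J W" using kinner_nonneg[OF _ assms, of W] W(1) A B
    unfolding chan_ker_def by simp
  then show ?thesis using W(2) by (simp add: less_eq_complex_def)
qed

text \<open>A zero diagonal entry clears its row, so a nonzero \<open>J\<close> has a positive
  diagonal entry; the diagonal block containing it bounds the objective of every feasible
  \<open>T\<close> from below.\<close>

lemma dualval_pos:
  assumes J: "psd_on (A \<times> B) J" and pq: "p \<in> A \<times> B" "q \<in> A \<times> B" "J p q \<noteq> 0"
  shows "0 < dualval A B J"
proof -
  have fin: "finite (A \<times> B)" using A B by simp
  obtain i k where p: "p = (i, k)" "i \<in> A" "k \<in> B" using pq(1) by auto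
  have nn: "0 \<le> Re (J (i, l) (i, l))" if "l \<in> B" for l
    using psd_on_diag[OF fin J, of "(i, l)"] p(2) that by (simp add: less_eq_complex_def)
  have "J p p \<noteq> 0" using psd_on_zero_pivot[OF fin J pq(1,2)] pq(3) by auto
  then have "0 < Re (J (i, k) (i, k))"
    using psd_on_diag[OF fin J pq(1)] p(1) by (auto simp: less_eq_complex_def complex_eq_iff)
  also have "\<dots> \<le> (\<Sum>l\<in>B. Re (J (i, l) (i, l)))"
    using nn B p(3) by (intro member_le_sum) auto
  also have "\<dots> \<le> dualval A B J"
    unfolding dualval_def
  proof (rule cINF_greatest)
    show "{T. dominates A B J T} \<noteq> {}"
      using dominates_ex[OF A(1) B psd_on_herm[OF fin J]] by blast
  qed (use dominates_bound[OF A(1) B p(2)] in auto)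
  finally show ?thesis .
qed

end

section \<open>Tensor products on regrouped indices\<close>

definition split_ix :: "nat \<Rightarrow> nat \<Rightarrow> nat \<times> nat \<Rightarrow> (nat \<times> nat) \<times> (nat \<times> nat)" where
  "split_ix c d p = ((fst p div c, snd p div d), (fst p mod c, snd p mod d))"

text \<open>The tensor product of Choi kernels. Composite indices come as a pair over the joint
  first systems and the joint second systems, and have to be regrouped into one pair for
  \<open>F\<close> and one for \<open>G\<close>.\<close>

definition ktensor :: "nat \<Rightarrow> nat \<Rightarrow> (nat \<times> nat \<Rightarrow> nat \<times> nat \<Rightarrow> complex) \<Rightarrow>
    (nat \<times> nat \<Rightarrow> nat \<times> nat \<Rightarrow> complex) \<Rightarrow> nat \<times> nat \<Rightarrow> nat \<times> nat \<Rightarrow> complex" where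
  "ktensor c d F G p q = F (fst (split_ix c d p)) (fst (split_ix c d q)) *
     G (snd (split_ix c d p)) (snd (split_ix c d q))"

lemma mult_add_less: "i < a \<Longrightarrow> k < (c :: nat) \<Longrightarrow> i * c + k < a * c"
proof -
  assume "i < a" "k < c"
  then have "i * c + k < Suc i * c" by simp
  also have "\<dots> \<le> a * c" using \<open>i < a\<close> by (intro mult_le_mono1) simp
  finally show ?thesis .
qed

lemma div_mult_add: "k < c \<Longrightarrow> (i * c + k) div c = (i :: nat)"
  by simp

lemma mod_mult_add: "k < c \<Longrightarrow> (i * c + k) mod c = (k :: nat)"
  by simp

lemma mult_add_eq_iff: "k < c \<Longrightarrow> l < c \<Longrightarrow> i * c + k = j * c + l \<longleftrightarrow> i = j \<and> k = (l :: nat)"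
  by (metis div_mult_add mod_mult_add)

lemma split_ix_bij:
  assumes "0 < c" "0 < d"
  shows "bij_betw (split_ix c d) ({..<a * c} \<times> {..<b * d}) (({..<a} \<times> {..<b}) \<times> ({..<c} \<times> {..<d}))"
  by (rule bij_betw_byWitness[where f' = "\<lambda>(p, q). (fst p * c + fst q, snd p * d + snd q)"])
    (use assms in \<open>auto simp: split_ix_def mult_add_less less_mult_imp_div_less\<close>)

lemma sum_div_mod:
  assumes "0 < (c :: nat)"
  shows "(\<Sum>x<a * c. f (x div c) (x mod c)) = (\<Sum>i<a. \<Sum>k<c. f i k)"
  unfolding sum.cartesian_product
  by (rule sum.reindex_bij_witness[where i = "\<lambda>(i, k). i * c + k" and j = "\<lambda>x. (x div c, x mod c)"])
    (use assms in \<open>auto simp: mult_add_less less_mult_imp_div_less\<close>)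

lemma sum_mult_add: "(\<Sum>x<a * c. f x) = (\<Sum>i<a. \<Sum>k<c. f (i * c + k :: nat))"
proof (cases "c = 0")
  case False
  then show ?thesis using sum_div_mod[of c "\<lambda>i k. f (i * c + k)" a] by simp
qed simp

lemma kinner_reindex:
  assumes "bij_betw h I J"
  shows "kinner I (\<lambda>p q. F (h p) (h q)) (\<lambda>p q. G (h p) (h q)) = kinner J F G"
  unfolding kinner_def sum.reindex_bij_betw[OF assms, of "\<lambda>q. F p q * G p q" for p]
  by (rule sum.reindex_bij_betw[OF assms])

lemma kinner_tensor:
  "kinner (I \<times> J) (\<lambda>p q. F (fst p) (fst q) * F' (snd p) (snd q))
     (\<lambda>p q. G (fst p) (fst q) * G' (snd p) (snd q)) = kinner I F G * kinner J F' G'"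
proof -
  have "kinner I F G * kinner J F' G' = (\<Sum>p\<in>I. \<Sum>p'\<in>J. (\<Sum>q\<in>I. F p q * G p q) * (\<Sum>q'\<in>J. F' p' q' * G' p' q'))"
    unfolding kinner_def sum_product ..
  also have "\<dots> = (\<Sum>p\<in>I. \<Sum>p'\<in>J. \<Sum>q\<in>I. \<Sum>q'\<in>J. (F p q * G p q) * (F' p' q' * G' p' q'))"
    unfolding sum_product ..
  finally show ?thesis unfolding kinner_def sum.cartesian_product' by (simp add: mult_ac)
qed

lemma kinner_ktensor:
  assumes "0 < c" "0 < d"
  shows "kinner ({..<a * c} \<times> {..<b * d}) (ktensor c d F F') (ktensor c d G G') =
    kinner ({..<a} \<times> {..<b}) F G * kinner ({..<c} \<times> {..<d}) F' G'"
  using kinner_reindex[OF split_ix_bij[OF assms],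
      where F = "\<lambda>p q. F (fst p) (fst q) * F' (snd p) (snd q)"
        and G = "\<lambda>p q. G (fst p) (fst q) * G' (snd p) (snd q)"]
  unfolding kinner_tensor ktensor_def by blast

lemma psd_on_pullback_split:
  assumes "0 < c" "0 < d" "psd_on (({..<a} \<times> {..<b}) \<times> ({..<c} \<times> {..<d})) F"
  shows "psd_on ({..<a * c} \<times> {..<b * d}) (\<lambda>p q. F (split_ix c d p) (split_ix c d q))"
proof (rule psd_on_reindex[OF _ assms(3)])
  show "split_ix c d p \<in> ({..<a} \<times> {..<b}) \<times> {..<c} \<times> {..<d}" if "p \<in> {..<a * c} \<times> {..<b * d}" for p
    using bij_betw_apply[OF split_ix_bij[OF assms(1,2)] that] .
qed auto

lemma psd_on_ktensor:
  assumes "0 < c" "0 < d" "psd_on ({..<a} \<times> {..<b}) F" "psd_on ({..<c} \<times> {..<d}) G"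
  shows "psd_on ({..<a * c} \<times> {..<b * d}) (ktensor c d F G)"
  using psd_on_pullback_split[OF assms(1,2) psd_on_tensor[OF _ _ assms(3,4)]]
  unfolding ktensor_def by simp

lemma eq_iff_div_mod: "k = l \<longleftrightarrow> k div d = l div d \<and> k mod d = l mod (d :: nat)"
  by (metis div_mult_mod_eq)

lemma chan_ker_ktensor:
  assumes cd: "0 < c" "0 < d" and W: "chan_ker {..<a} {..<b} W" "chan_ker {..<c} {..<d} W'"
  shows "chan_ker {..<a * c} {..<b * d} (ktensor c d W W')"
  unfolding chan_ker_def
proof (intro conjI ballI)
  show "psd_on ({..<a * c} \<times> {..<b * d}) (ktensor c d W W')"
    using W unfolding chan_ker_def by (intro psd_on_ktensor[OF cd]) auto
  fix k l assume kl: "k \<in> {..<b * d}" "l \<in> {..<b * d}"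
  then have b: "k div d < b" "l div d < b" "k mod d < d" "l mod d < d"
    using cd by (auto simp: less_mult_imp_div_less)
  have "(\<Sum>i<a * c. ktensor c d W W' (i, k) (i, l)) =
    (\<Sum>i<a * c. W (i div c, k div d) (i div c, l div d) * W' (i mod c, k mod d) (i mod c, l mod d))"
    by (simp add: ktensor_def split_ix_def)
  also have "\<dots> = (\<Sum>i<a. \<Sum>i'<c. W (i, k div d) (i, l div d) * W' (i', k mod d) (i', l mod d))"
    by (rule sum_div_mod[OF cd(1)])
  also have "\<dots> = (\<Sum>i<a. W (i, k div d) (i, l div d)) * (\<Sum>i'<c. W' (i', k mod d) (i', l mod d))"
    by (simp add: sum_product)
  also have "\<dots> = (if k = l then 1 else 0)"
    using W b unfolding chan_ker_def eq_iff_div_mod[of k l d] by simp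
  finally show "(\<Sum>i<a * c. ktensor c d W W' (i, k) (i, l)) = (if k = l then 1 else 0)" .
qed

text \<open>Up to regrouping, the difference is \<open>(1 \<otimes> T - J) \<otimes> J' + (1
  \<otimes> T) \<otimes> (1 \<otimes> T' - J')\<close>, a sum of products of positive kernels. It
  uses that \<open>J'\<close> is positive and, through \<open>J\<close>, that
  \<open>1 \<otimes> T\<close> is; the argument does not carry over to \<open>- J\<close>.\<close>

lemma dominates_ktensor:
  assumes cd: "0 < c" "0 < d"
    and J: "psd_on ({..<a} \<times> {..<b}) J" "psd_on ({..<c} \<times> {..<d}) J'"
    and T: "dominates {..<a} {..<b} J T" "dominates {..<c} {..<d} J' T'"
  shows "dominates {..<a * c} {..<b * d} (ktensor c d J J')
    (\<lambda>k l. T (k div d) (l div d) * T' (k mod d) (l mod d))"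
  unfolding dominates_def
proof
  show "herm_on {..<b * d} (\<lambda>k l. T (k div d) (l div d) * T' (k mod d) (l mod d))"
  proof (rule herm_onI)
    fix k l assume kl: "k \<in> {..<b * d}" "l \<in> {..<b * d}"
    have "T (l div d) (k div d) = cnj (T (k div d) (l div d))"
      using T(1) kl unfolding dominates_def by (intro herm_onD[of "{..<b}"]) (auto simp: less_mult_imp_div_less)
    moreover have "T' (l mod d) (k mod d) = cnj (T' (k mod d) (l mod d))"
      using T(2) cd unfolding dominates_def by (intro herm_onD[of "{..<d}"]) auto
    ultimately show "T (l div d) (k div d) * T' (l mod d) (k mod d) =
      cnj (T (k div d) (l div d) * T' (k mod d) (l mod d))" by simp
  qed
  let ?I = "{..<a} \<times> {..<b}" and ?I' = "{..<c} \<times> {..<d}"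
  have K: "psd_on ?I (\<lambda>p q. id_kron T p q - J p q)" "psd_on ?I' (\<lambda>p q. id_kron T' p q - J' p q)"
    using T unfolding dominates_def by auto
  have "psd_on ?I (id_kron T)" using psd_on_add[OF K(1) J(1)] by simp
  then have "psd_on (?I \<times> ?I') (\<lambda>p q. (id_kron T (fst p) (fst q) - J (fst p) (fst q)) * J' (snd p) (snd q)
    + id_kron T (fst p) (fst q) * (id_kron T' (snd p) (snd q) - J' (snd p) (snd q)))"
    by (intro psd_on_add psd_on_tensor[OF _ _ K(1) J(2)] psd_on_tensor[OF _ _ _ K(2)]) auto
  from psd_on_pullback_split[OF cd this]
  have "psd_on ({..<a * c} \<times> {..<b * d}) (\<lambda>p q. id_kron T (fst (split_ix c d p)) (fst (split_ix c d q))
    * id_kron T' (snd (split_ix c d p)) (snd (split_ix c d q)) - ktensor c d J J' p q)"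
    by (simp add: ktensor_def algebra_simps)
  moreover have "id_kron T (fst (split_ix c d p)) (fst (split_ix c d q)) * id_kron T' (snd (split_ix c d p)) (snd (split_ix c d q))
    = id_kron (\<lambda>k l. T (k div d) (l div d) * T' (k mod d) (l mod d)) p q" for p q
    unfolding id_kron_def split_ix_def using eq_iff_div_mod[of "fst p" "fst q" c] by auto
  ultimately show "psd_on ({..<a * c} \<times> {..<b * d})
    (\<lambda>p q. id_kron (\<lambda>k l. T (k div d) (l div d) * T' (k mod d) (l mod d)) p q - ktensor c d J J' p q)"
    by simp
qed

lemma dominates_trace_real:
  assumes "dominates A B J T"
  shows "(\<Sum>k\<in>B. T k k) = of_real (ktrace B T)"
proof -
  have "Im (T k k) = 0" if "k \<in> B" for k
    using herm_onD[of B T k k] assms that unfolding dominates_def by (simp add: complex_eq_iff)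
  then show ?thesis by (simp add: complex_eq_iff ktrace_def)
qed

lemma Re_mult_nonneg: "0 \<le> z \<Longrightarrow> Re (z * w) = Re z * Re w"
  by (simp add: less_eq_complex_def)

context
  fixes a b c d :: nat and J J' :: "nat \<times> nat \<Rightarrow> nat \<times> nat \<Rightarrow> complex"
  assumes pos: "0 < a" "0 < c" "0 < d"
    and J: "psd_on ({..<a} \<times> {..<b}) J" and J': "psd_on ({..<c} \<times> {..<d}) J'"
begin

lemma factors_nonempty: "{..<a} \<noteq> {}" "{..<c} \<noteq> {}" "{..<a * c} \<noteq> {}"
  using pos by (auto simp: lessThan_empty_iff)

lemma factors_herm: "herm_on ({..<a} \<times> {..<b}) J" "herm_on ({..<c} \<times> {..<d}) J'"
  "herm_on ({..<a * c} \<times> {..<b * d}) (ktensor c d J J')"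
  using psd_on_herm[OF _ J] psd_on_herm[OF _ J'] psd_on_herm[OF _ psd_on_ktensor[OF pos(2,3) J J']] by auto

lemma Re_kinner_ktensor:
  assumes "chan_ker {..<a} {..<b} W" "chan_ker {..<c} {..<d} W'"
  shows "Re (kinner ({..<a * c} \<times> {..<b * d}) (ktensor c d J J') (ktensor c d W W')) =
    Re (kinner ({..<a} \<times> {..<b}) J W) * Re (kinner ({..<c} \<times> {..<d}) J' W')"
proof -
  have "0 \<le> kinner ({..<a} \<times> {..<b}) J W"
    using assms(1) J unfolding chan_ker_def by (intro kinner_nonneg) auto
  then show ?thesis unfolding kinner_ktensor[OF pos(2,3)] by (rule Re_mult_nonneg)
qed

lemma minval_ktensor:
  "minval {..<a * c} {..<b * d} (ktensor c d J J') \<le> minval {..<a} {..<b} J * minval {..<c} {..<d} J'"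
proof -
  obtain W where W: "chan_ker {..<a} {..<b} W" "Re (kinner ({..<a} \<times> {..<b}) J W) = minval {..<a} {..<b} J"
    using minval_attained[OF _ factors_nonempty(1) _ factors_herm(1)] by blast
  obtain W' where W': "chan_ker {..<c} {..<d} W'" "Re (kinner ({..<c} \<times> {..<d}) J' W') = minval {..<c} {..<d} J'"
    using minval_attained[OF _ factors_nonempty(2) _ factors_herm(2)] by blast
  show ?thesis
    using minval_le_kinner[OF _ factors_nonempty(3) _ factors_herm(3) chan_ker_ktensor[OF pos(2,3) W(1) W'(1)]]
    unfolding Re_kinner_ktensor[OF W(1) W'(1)] W(2) W'(2) by simp
qed

text \<open>Product channels give one inequality, products of near-optimal dominating operators the
  other.\<close>

lemma dualval_ktensor:
  "dualval {..<a * c} {..<b * d} (ktensor c d J J') = dualval {..<a} {..<b} J * dualval {..<c} {..<d} J'"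
    (is "?D = ?v * ?v'")
proof (rule antisym)
  obtain W where W: "chan_ker {..<a} {..<b} W" "Re (kinner ({..<a} \<times> {..<b}) J W) = ?v"
    using strong_duality[OF _ factors_nonempty(1) _ factors_herm(1)] by blast
  obtain W' where W': "chan_ker {..<c} {..<d} W'" "Re (kinner ({..<c} \<times> {..<d}) J' W') = ?v'"
    using strong_duality[OF _ factors_nonempty(2) _ factors_herm(2)] by blast
  show "?v * ?v' \<le> ?D"
    using kinner_le_dualval[OF _ factors_nonempty(3) _ factors_herm(3) chan_ker_ktensor[OF pos(2,3) W(1) W'(1)]]
    unfolding Re_kinner_ktensor[OF W(1) W'(1)] W(2) W'(2) by simp
  have v: "0 \<le> ?v" "0 \<le> ?v'"
    using kinner_nonneg[OF _ J, of W] kinner_nonneg[OF _ J', of W'] W W' unfolding chan_ker_def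
    by (auto simp: less_eq_complex_def)
  show "?D \<le> ?v * ?v'"
  proof (rule field_le_epsilon)
    fix e :: real assume e: "e > 0"
    \<comment> \<open>Chosen such that \<open>(?v + \<delta>) * (?v' + \<delta>)\<close> exceeds
      \<open>?v * ?v'\<close> by at most \<open>e\<close>; the cap 1 controls the quadratic
      term.\<close>
    define \<delta> where "\<delta> = min 1 (e / (?v + ?v' + 1))"
    have d: "\<delta> > 0" "\<delta> \<le> 1" "\<delta> \<le> e / (?v + ?v' + 1)" using e v by (auto simp: \<delta>_def)
    obtain T where T: "dominates {..<a} {..<b} J T" "ktrace {..<b} T < ?v + \<delta>"
      using dualval_approx[OF _ factors_nonempty(1) _ factors_herm(1) d(1)] by blast
    obtain T' where T': "dominates {..<c} {..<d} J' T'" "ktrace {..<d} T' < ?v' + \<delta>"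
      using dualval_approx[OF _ factors_nonempty(2) _ factors_herm(2) d(1)] by blast
    have t: "0 \<le> ktrace {..<b} T" "0 \<le> ktrace {..<d} T'"
      using dualval_le[OF _ factors_nonempty(1) _ T(1)] dualval_le[OF _ factors_nonempty(2) _ T'(1)] v by auto
    have "?D \<le> ktrace {..<b * d} (\<lambda>k l. T (k div d) (l div d) * T' (k mod d) (l mod d))"
      by (rule dualval_le[OF _ factors_nonempty(3) _ dominates_ktensor[OF pos(2,3) J J' T(1) T'(1)]]) auto
    also have "\<dots> = Re ((\<Sum>k<b. T k k) * (\<Sum>k<d. T' k k))"
      unfolding ktrace_def sum_product
      using sum_div_mod[OF pos(3), of "\<lambda>k l. T k k * T' l l" b] by simp
    also have "\<dots> = ktrace {..<b} T * ktrace {..<d} T'"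
      unfolding dominates_trace_real[OF T(1)] dominates_trace_real[OF T'(1)] by simp
    also have "\<dots> \<le> (?v + \<delta>) * (?v' + \<delta>)" using T(2) T'(2) t by (intro mult_mono) auto
    also have "\<dots> = ?v * ?v' + \<delta> * (?v + ?v' + \<delta>)" by (simp add: algebra_simps)
    also have "\<delta> * (?v + ?v' + \<delta>) \<le> \<delta> * (?v + ?v' + 1)" using d v by (intro mult_left_mono) auto
    also have "\<dots> \<le> e" using d(3) v by (simp add: field_simps)
    finally show "?D \<le> ?v * ?v' + e" by simp
  qed
qed

end

section \<open>Kernels of linear maps\<close>

text \<open>The unnormalised Choi matrix with the input index first. Kernels in
  \<open>chan_ker\<close> put the output index first, so a map from \<open>A\<close> to
  \<open>B\<close> and a channel from \<open>B\<close> to \<open>A\<close> are both indexed by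
  \<open>A \<times> B\<close> and can be paired directly.\<close>

definition mker :: "nat \<Rightarrow> op_map \<Rightarrow> nat \<times> nat \<Rightarrow> nat \<times> nat \<Rightarrow> complex" where
  "mker a N p q = N (mat_unit a (fst p) (fst q)) $$ (snd p, snd q)"

text \<open>\<open>tensor_map\<close> consults its arguments on matrix units only; this condition on
  them passes at once to tensor powers and to the composite inside the loop.\<close>

definition op_carrier :: "nat \<Rightarrow> nat \<Rightarrow> op_map \<Rightarrow> bool" where
  "op_carrier a b N \<longleftrightarrow> (\<forall>i<a. \<forall>j<a. N (mat_unit a i j) \<in> carrier_mat b b)"

lemma op_carrierD: "op_carrier a b N \<Longrightarrow> i < a \<Longrightarrow> j < a \<Longrightarrow> dim_row (N (mat_unit a i j)) = b \<and> dim_col (N (mat_unit a i j)) = b"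
  unfolding op_carrier_def by auto

lemma mat_unit_carrier [simp]: "mat_unit d i j \<in> carrier_mat d d"
  by (simp add: mat_unit_def)

lemma mat_unit_dim [simp]: "dim_row (mat_unit d i j) = d" "dim_col (mat_unit d i j) = d"
  by (simp_all add: mat_unit_def)

lemma mat_unit_index: "p < d \<Longrightarrow> q < d \<Longrightarrow> mat_unit d i j $$ (p, q) = (if p = i \<and> q = j then 1 else 0)"
  by (simp add: mat_unit_def)

lemma kron_dim [simp]: "dim_row (kron A B) = dim_row A * dim_row B" "dim_col (kron A B) = dim_col A * dim_col B"
  by (simp_all add: kron_def)

lemma kron_index:
  "p < dim_row A * dim_row B \<Longrightarrow> q < dim_col A * dim_col B \<Longrightarrow>
    kron A B $$ (p, q) = A $$ (p div dim_row B, q div dim_col B) * B $$ (p mod dim_row B, q mod dim_col B)"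
  by (simp add: kron_def)

lemma sum_delta2:
  fixes f :: "nat \<Rightarrow> nat \<Rightarrow> 'c :: comm_monoid_add"
  assumes "x < n" "y < m"
  shows "(\<Sum>u<n. \<Sum>v<m. if u = x \<and> v = y then f u v else 0) = f x y"
proof -
  have "(\<Sum>u<n. \<Sum>v<m. if u = x \<and> v = y then f u v else 0) = (\<Sum>u<n. if u = x then f u y else 0)"
  proof (intro sum.cong refl)
    fix u
    show "(\<Sum>v<m. if u = x \<and> v = y then f u v else 0) = (if u = x then f u y else 0)"
      using assms by (cases "u = x") (simp_all add: sum.delta')
  qed
  then show ?thesis using assms by (simp add: sum.delta')
qed

lemma mod_less_of_mult: "x < b * d \<Longrightarrow> x mod d < (d :: nat)"
  by (cases "d = 0") auto

lemma tensor_map_index: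
  assumes "op_carrier a b N" "op_carrier c d M" "x < b * d" "y < b * d"
  shows "tensor_map a b c d N M X $$ (x, y) = (\<Sum>i<a. \<Sum>j<a. \<Sum>k<c. \<Sum>l<c. X $$ (i * c + k, j * c + l) *
     (N (mat_unit a i j) $$ (x div d, y div d) * M (mat_unit c k l) $$ (x mod d, y mod d)))"
  using assms(3,4) unfolding tensor_map_def
  by (auto intro!: sum.cong simp: kron_index op_carrierD[OF assms(1)] op_carrierD[OF assms(2)])

lemma op_carrier_id: "op_carrier r r (\<lambda>X. X)"
  by (simp add: op_carrier_def)

lemma op_carrier_tensor_map: "op_carrier x (b * d) (tensor_map a b c d N M)"
  by (simp add: op_carrier_def tensor_map_def)

lemma id_tensor_index:
  assumes N: "op_carrier a b N" and xy: "x < r * b" "y < r * b"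
  shows "id_tensor r a b N X $$ (x, y) = (\<Sum>i<a. \<Sum>j<a. X $$ ((x div b) * a + i, (y div b) * a + j) *
     N (mat_unit a i j) $$ (x mod b, y mod b))"
proof -
  have d: "x div b < r" "y div b < r" using xy by (auto simp: less_mult_imp_div_less)
  have "id_tensor r a b N X $$ (x, y) = (\<Sum>p<r. \<Sum>q<r. if p = x div b \<and> q = y div b then
      \<Sum>i<a. \<Sum>j<a. X $$ (p * a + i, q * a + j) * N (mat_unit a i j) $$ (x mod b, y mod b) else 0)"
    unfolding tensor_map_index[OF op_carrier_id N xy]
    by (intro sum.cong refl) (auto simp: mat_unit_index d intro!: sum.neutral sum.cong)
  then show ?thesis unfolding sum_delta2[OF d] .
qed

lemma tensor_id_index:
  assumes N: "op_carrier a b N" and xy: "x < b * r" "y < b * r"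
  shows "tensor_id a b r N X $$ (x, y) = (\<Sum>i<a. \<Sum>j<a. X $$ (i * r + x mod r, j * r + y mod r) *
     N (mat_unit a i j) $$ (x div r, y div r))"
proof -
  have d: "x mod r < r" "y mod r < r" using xy by (auto simp: mod_less_of_mult)
  have "tensor_id a b r N X $$ (x, y) = (\<Sum>i<a. \<Sum>j<a. \<Sum>k<r. \<Sum>l<r. if k = x mod r \<and> l = y mod r then
      X $$ (i * r + k, j * r + l) * N (mat_unit a i j) $$ (x div r, y div r) else 0)"
    unfolding tensor_map_index[OF N op_carrier_id xy]
    by (intro sum.cong refl) (auto simp: mat_unit_index d)
  then show ?thesis unfolding sum_delta2[OF d] .
qed

lemma max_ent_index:
  assumes xy: "x < a * a" "y < a * a"
  shows "max_ent a $$ (x, y) = (if x div a = x mod a \<and> y div a = y mod a then 1 / of_nat a else 0)"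
proof -
  have d: "x div a < a" "y div a < a" "x mod a < a" "y mod a < a"
    using xy by (auto simp: less_mult_imp_div_less mod_less_of_mult)
  have "(\<Sum>i<a. \<Sum>j<a. kron (mat_unit a i j) (mat_unit a i j) $$ (x, y)) =
    (\<Sum>i<a. \<Sum>j<a. if i = x div a \<and> j = y div a then (if i = x mod a \<and> j = y mod a then 1 else 0) else 0)"
    using xy by (intro sum.cong refl) (auto simp: kron_index mat_unit_index d)
  also have "\<dots> = (if x div a = x mod a \<and> y div a = y mod a then 1 else 0)"
    by (rule sum_delta2[OF d(1,2)])
  finally show ?thesis using xy by (simp add: max_ent_def)
qed

lemma psd_iff_psd_on: "psd d X \<longleftrightarrow> X \<in> carrier_mat d d \<and> psd_on {..<d} (\<lambda>i j. X $$ (i, j))"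
proof (cases "X \<in> carrier_mat d d")
  case True
  have q: "(X *\<^sub>v v) \<bullet>c v = qform {..<d} (\<lambda>i j. X $$ (i, j)) (\<lambda>i. v $ i)" if v: "v \<in> carrier_vec d" for v
  proof -
    have "(X *\<^sub>v v) \<bullet>c v = (\<Sum>i<d. (\<Sum>j<d. X $$ (i, j) * v $ j) * cnj (v $ i))"
      using True v unfolding scalar_prod_def lessThan_atLeast0
      by (intro sum.cong) (auto simp: scalar_prod_def lessThan_atLeast0 intro!: sum.cong)
    also have "\<dots> = qform {..<d} (\<lambda>i j. X $$ (i, j)) (\<lambda>i. v $ i)"
      unfolding qform_def sum_distrib_right by (intro sum.cong refl) (simp add: mult_ac)
    finally show ?thesis .
  qed
  have "(\<forall>v\<in>carrier_vec d. 0 \<le> (X *\<^sub>v v) \<bullet>c v) \<longleftrightarrow> psd_on {..<d} (\<lambda>i j. X $$ (i, j))"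
    unfolding psd_on_def
  proof
    assume *: "\<forall>v\<in>carrier_vec d. 0 \<le> (X *\<^sub>v v) \<bullet>c v"
    show "\<forall>v. 0 \<le> qform {..<d} (\<lambda>i j. X $$ (i, j)) v"
    proof
      fix u :: "nat \<Rightarrow> complex"
      have w: "vec d u \<in> carrier_vec d" by simp
      have "0 \<le> qform {..<d} (\<lambda>i j. X $$ (i, j)) (\<lambda>i. vec d u $ i)"
        using bspec[OF * w] unfolding q[OF w] .
      also have "\<dots> = qform {..<d} (\<lambda>i j. X $$ (i, j)) u" by (rule qform_cong) auto
      finally show "0 \<le> qform {..<d} (\<lambda>i j. X $$ (i, j)) u" .
    qed
  next
    assume "\<forall>v. 0 \<le> qform {..<d} (\<lambda>i j. X $$ (i, j)) v"
    then show "\<forall>v\<in>carrier_vec d. 0 \<le> (X *\<^sub>v v) \<bullet>c v" using q by simp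
  qed
  then show ?thesis unfolding psd_def using True by simp
qed (simp add: psd_def)

section \<open>Passage between completely positive maps and their Choi kernels\<close>

definition pair_ix :: "nat \<Rightarrow> nat \<times> nat \<Rightarrow> nat" where
  "pair_ix b p = fst p * b + snd p"

lemma pair_ix_less: "p \<in> {..<a} \<times> {..<b} \<Longrightarrow> pair_ix b p < a * b"
  unfolding pair_ix_def by (auto intro: mult_add_less)

lemma pair_ix_div_mod: "snd p < b \<Longrightarrow> pair_ix b p div b = fst p \<and> pair_ix b p mod b = snd p"
  unfolding pair_ix_def by simp

lemma psd_on_pair_ix:
  "psd_on {..<a * b} F \<longleftrightarrow> psd_on ({..<a} \<times> {..<b}) (\<lambda>p q. F (pair_ix b p) (pair_ix b q))"
proof
  assume F: "psd_on {..<a * b} F"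
  show "psd_on ({..<a} \<times> {..<b}) (\<lambda>p q. F (pair_ix b p) (pair_ix b q))"
  proof (rule psd_on_reindex[OF _ F])
    show "pair_ix b p \<in> {..<a * b}" if "p \<in> {..<a} \<times> {..<b}" for p using pair_ix_less[OF that] by simp
  qed simp
next
  assume F: "psd_on ({..<a} \<times> {..<b}) (\<lambda>p q. F (pair_ix b p) (pair_ix b q))"
  have "psd_on {..<a * b} (\<lambda>x y. F (pair_ix b (x div b, x mod b)) (pair_ix b (y div b, y mod b)))"
    by (rule psd_on_reindex[OF _ F, where h = "\<lambda>x. (x div b, x mod b)"])
      (auto simp: less_mult_imp_div_less mod_less_of_mult)
  then show "psd_on {..<a * b} F" by (simp add: pair_ix_def)
qed

lemma psd_iff_pair:
  "psd (a * b) X \<longleftrightarrow> X \<in> carrier_mat (a * b) (a * b) \<and>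
     psd_on ({..<a} \<times> {..<b}) (\<lambda>p q. X $$ (pair_ix b p, pair_ix b q))"
  unfolding psd_iff_psd_on psd_on_pair_ix[of a b "\<lambda>i j. X $$ (i, j)"] ..

lemma choi_carrier: "choi a b N \<in> carrier_mat (a * b) (a * b)"
  by (simp add: choi_def tensor_map_def)

lemma choi_index:
  assumes N: "op_carrier a b N" and pq: "p \<in> {..<a} \<times> {..<b}" "q \<in> {..<a} \<times> {..<b}"
  shows "choi a b N $$ (pair_ix b p, pair_ix b q) = mker a N p q / of_nat a"
proof -
  have b: "snd p < b" "snd q < b" "fst p < a" "fst q < a" using pq by auto
  have "choi a b N $$ (pair_ix b p, pair_ix b q) = (\<Sum>i<a. \<Sum>j<a. max_ent a $$ (fst p * a + i, fst q * a + j) *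
     N (mat_unit a i j) $$ (snd p, snd q))"
    unfolding choi_def id_tensor_index[OF N pair_ix_less[OF pq(1)] pair_ix_less[OF pq(2)]]
    using pair_ix_div_mod[of p b] pair_ix_div_mod[of q b] b by simp
  also have "\<dots> = (\<Sum>i<a. \<Sum>j<a. if i = fst p \<and> j = fst q then N (mat_unit a i j) $$ (snd p, snd q) / of_nat a else 0)"
    using b by (intro sum.cong refl) (auto simp: max_ent_index mult_add_less)
  also have "\<dots> = mker a N p q / of_nat a" unfolding sum_delta2[OF b(3,4)] mker_def ..
  finally show ?thesis .
qed

lemma psd_on_scale_iff:
  assumes "0 < c"
  shows "psd_on I (\<lambda>i j. complex_of_real c * F i j) \<longleftrightarrow> psd_on I F"
proof
  assume "psd_on I (\<lambda>i j. complex_of_real c * F i j)"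
  then have "psd_on I (\<lambda>i j. of_real (inverse c) * (complex_of_real c * F i j))"
    by (rule psd_on_scale) (use assms in auto)
  then show "psd_on I F" using assms by (simp add: mult.assoc[symmetric])
qed (use assms in \<open>auto intro: psd_on_scale\<close>)

text \<open>Complete positivity is applied to a single input, the maximally entangled state with a
  reference of dimension \<open>a\<close>, which is positive because it has rank one.\<close>

lemma cp_map_kernel:
  assumes a: "0 < a" and N: "cp_map a b N"
  shows "op_carrier a b N" "psd_on ({..<a} \<times> {..<b}) (mker a N)"
proof -
  show c: "op_carrier a b N"
    using N unfolding cp_map_def linear_op_map_def op_carrier_def by simp
  have "psd_on {..<a * a} (\<lambda>x y. max_ent a $$ (x, y))"
    by (rule psd_on_gramI[where R = "{()}" and
          f = "\<lambda>_ x. if x div a = x mod a then of_real (1 / sqrt (real a)) else 0"])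
      (auto simp: max_ent_index simp flip: of_real_mult)
  then have "psd (a * a) (max_ent a)" unfolding psd_iff_psd_on by (simp add: max_ent_def)
  then have "psd (a * b) (choi a b N)" using N unfolding cp_map_def choi_def by blast
  then have "psd_on ({..<a} \<times> {..<b}) (\<lambda>p q. choi a b N $$ (pair_ix b p, pair_ix b q))"
    unfolding psd_iff_pair by simp
  then have "psd_on ({..<a} \<times> {..<b}) (\<lambda>p q. mker a N p q / of_nat a)"
    by (subst psd_on_cong[where G = "\<lambda>p q. choi a b N $$ (pair_ix b p, pair_ix b q)"])
      (simp_all add: choi_index[OF c])
  then show "psd_on ({..<a} \<times> {..<b}) (mker a N)"
    using psd_on_scale_iff[of "inverse (real a)" "{..<a} \<times> {..<b}" "mker a N"] a
    by (simp add: field_simps)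
qed

lemma channel_kernel:
  assumes a: "0 < a" and N: "channel a b N"
  shows "op_carrier a b N" "psd_on ({..<a} \<times> {..<b}) (mker a N)"
    "\<And>i j. i < a \<Longrightarrow> j < a \<Longrightarrow> (\<Sum>k<b. N (mat_unit a i j) $$ (k, k)) = (if i = j then 1 else 0)"
proof -
  have cp: "cp_map a b N" using N unfolding channel_def by simp
  show c: "op_carrier a b N" "psd_on ({..<a} \<times> {..<b}) (mker a N)" using cp_map_kernel[OF a cp] by auto
  fix i j assume ij: "i < a" "j < a"
  have "(\<Sum>k<b. N (mat_unit a i j) $$ (k, k)) = mtrace (N (mat_unit a i j))"
    using op_carrierD[OF c(1) ij] unfolding mtrace_def by simp
  also have "\<dots> = mtrace (mat_unit a i j)" using N unfolding channel_def by simp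
  also have "\<dots> = (\<Sum>k<a. if k = i then (if i = j then 1 else 0) else 0)"
    unfolding mtrace_def by (intro sum.cong) (auto simp: mat_unit_index)
  also have "\<dots> = (if i = j then 1 else 0)" using ij by (simp add: sum.delta')
  finally show "(\<Sum>k<b. N (mat_unit a i j) $$ (k, k)) = (if i = j then 1 else 0)" .
qed

text \<open>Linearity is given for binary sums and scalar multiples, so \<open>X\<close> is
  assembled entry by entry; \<open>R K\<close> keeps the entries in \<open>K\<close>. The purpose is
  to see that a nonzero map has a nonzero kernel.\<close>

lemma linear_op_map_index:
  assumes N: "linear_op_map a b N" and X: "X \<in> carrier_mat a a" and kl: "k < b" "l < b"
  shows "N X $$ (k, l) = (\<Sum>i<a. \<Sum>j<a. X $$ (i, j) * N (mat_unit a i j) $$ (k, l))"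
proof -
  define R where "R K = mat a a (\<lambda>p. if p \<in> K then X $$ p else 0)" for K
  have add: "N (Y + Z) = N Y + N Z" if "Y \<in> carrier_mat a a" "Z \<in> carrier_mat a a" for Y Z
    using N that unfolding linear_op_map_def by blast
  have sc: "N (c \<cdot>\<^sub>m Y) = c \<cdot>\<^sub>m N Y" if "Y \<in> carrier_mat a a" for c Y
    using N that unfolding linear_op_map_def by blast
  have car: "N Y \<in> carrier_mat b b" if "Y \<in> carrier_mat a a" for Y
    using N that unfolding linear_op_map_def by blast
  have RK: "N (R K) $$ (k, l) = (\<Sum>p\<in>K. X $$ p * N (mat_unit a (fst p) (snd p)) $$ (k, l))"
    if "finite K" "K \<subseteq> {..<a} \<times> {..<a}" for K
    using that
  proof (induction K rule: finite_induct)
    case empty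
    have R0: "R {} = 0\<^sub>m a a" by (intro eq_matI) (auto simp: R_def)
    have "N (0\<^sub>m a a) $$ (k, l) = (0 \<cdot>\<^sub>m N (0\<^sub>m a a)) $$ (k, l)" using sc[of "0\<^sub>m a a" 0] by simp
    also have "\<dots> = 0" using car[of "0\<^sub>m a a"] kl by simp
    finally show ?case using R0 by simp
  next
    case (insert p K)
    have "R (insert p K) = R K + X $$ p \<cdot>\<^sub>m mat_unit a (fst p) (snd p)"
      using insert.hyps by (intro eq_matI) (auto simp: R_def mat_unit_index)
    moreover have "R K \<in> carrier_mat a a" by (simp add: R_def)
    ultimately have "N (R (insert p K)) = N (R K) + X $$ p \<cdot>\<^sub>m N (mat_unit a (fst p) (snd p))"
      using add sc by simp
    then show ?case
      using insert kl car[OF \<open>R K \<in> carrier_mat a a\<close>] car[of "mat_unit a (fst p) (snd p)"]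
      by (simp add: add.commute)
  qed
  have "R ({..<a} \<times> {..<a}) = X" using X by (intro eq_matI) (auto simp: R_def)
  then show ?thesis using RK[of "{..<a} \<times> {..<a}"] by (simp add: sum.cartesian_product split_beta)
qed

lemma mker_nonzero:
  assumes N: "linear_op_map a b N" and nz: "\<exists>X\<in>carrier_mat a a. N X \<noteq> 0\<^sub>m b b"
  obtains p q where "p \<in> {..<a} \<times> {..<b}" "q \<in> {..<a} \<times> {..<b}" "mker a N p q \<noteq> 0"
proof (rule ccontr)
  note found = that
  assume "\<not> thesis"
  then have z: "mker a N p q = 0" if "p \<in> {..<a} \<times> {..<b}" "q \<in> {..<a} \<times> {..<b}" for p q
    using found that by blast
  obtain X where X: "X \<in> carrier_mat a a" "N X \<noteq> 0\<^sub>m b b" using nz by blast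
  have "N X $$ (k, l) = 0" if "k < b" "l < b" for k l
    unfolding linear_op_map_index[OF N X(1) that]
  proof (intro sum.neutral ballI)
    fix i j assume "i \<in> {..<a}" "j \<in> {..<a}"
    then show "X $$ (i, j) * N (mat_unit a i j) $$ (k, l) = 0"
      using z[of "(i, k)" "(j, l)"] that by (simp add: mker_def)
  qed
  moreover have "N X \<in> carrier_mat b b" using N X(1) unfolding linear_op_map_def by blast
  ultimately have "N X = 0\<^sub>m b b" by (intro eq_matI) auto
  with X(2) show False by simp
qed

definition ker_map :: "nat \<Rightarrow> nat \<Rightarrow> (nat \<times> nat \<Rightarrow> nat \<times> nat \<Rightarrow> complex) \<Rightarrow> op_map" where
  "ker_map a b F X = mat b b (\<lambda>(k, l). \<Sum>i<a. \<Sum>j<a. X $$ (i, j) * F (i, k) (j, l))"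

lemma ker_map_mat_unit:
  assumes "i < a" "j < a" "k < b" "l < b"
  shows "ker_map a b F (mat_unit a i j) $$ (k, l) = F (i, k) (j, l)"
proof -
  have "ker_map a b F (mat_unit a i j) $$ (k, l) = (\<Sum>u<a. \<Sum>v<a. if u = i \<and> v = j then F (u, k) (v, l) else 0)"
    using assms unfolding ker_map_def by (auto simp: mat_unit_index intro!: sum.cong)
  then show ?thesis unfolding sum_delta2[OF assms(1,2)] .
qed

lemma op_carrier_ker_map: "op_carrier a b (ker_map a b F)"
  by (simp add: op_carrier_def ker_map_def)

text \<open>The converse half of Choi's theorem: applying the map to one part of a positive operator
  is the link product of that operator with \<open>F\<close>, for a reference of any
  dimension.\<close>

lemma channel_ker_map:
  assumes F: "psd_on ({..<a} \<times> {..<b}) F"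
    and tr: "\<And>i j. i < a \<Longrightarrow> j < a \<Longrightarrow> (\<Sum>k<b. F (i, k) (j, k)) = (if i = j then 1 else 0)"
  shows "channel a b (ker_map a b F)"
  unfolding channel_def cp_map_def
proof (intro conjI allI impI ballI)
  show "linear_op_map a b (ker_map a b F)"
    unfolding linear_op_map_def
    by (auto simp: ker_map_def sum.distrib algebra_simps sum_distrib_left intro!: eq_matI)
  fix r X assume X: "psd (r * a) X"
  then have X: "psd_on ({..<r} \<times> {..<a}) (\<lambda>p q. X $$ (pair_ix a p, pair_ix a q))"
    unfolding psd_iff_pair by simp
  show "psd (r * b) (id_tensor r a b (ker_map a b F) X)"
    unfolding psd_iff_pair
  proof
    show "id_tensor r a b (ker_map a b F) X \<in> carrier_mat (r * b) (r * b)" by (simp add: tensor_map_def)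
    have "psd_on ({..<r} \<times> {..<b}) (\<lambda>p q. \<Sum>s<a. \<Sum>t<a. X $$ (pair_ix a (fst p, s), pair_ix a (fst q, t)) * F (s, snd p) (t, snd q))"
      by (rule psd_on_link[OF _ _ _ X F]) auto
    then show "psd_on ({..<r} \<times> {..<b}) (\<lambda>p q. id_tensor r a b (ker_map a b F) X $$ (pair_ix b p, pair_ix b q))"
    proof (subst psd_on_cong)
      fix p q assume pq: "p \<in> {..<r} \<times> {..<b}" "q \<in> {..<r} \<times> {..<b}"
      show "id_tensor r a b (ker_map a b F) X $$ (pair_ix b p, pair_ix b q) =
        (\<Sum>s<a. \<Sum>t<a. X $$ (pair_ix a (fst p, s), pair_ix a (fst q, t)) * F (s, snd p) (t, snd q))"
        unfolding id_tensor_index[OF op_carrier_ker_map pair_ix_less[OF pq(1)] pair_ix_less[OF pq(2)]]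
        using pair_ix_div_mod[of p b] pair_ix_div_mod[of q b] pq
        by (intro sum.cong refl) (auto simp: ker_map_mat_unit pair_ix_def)
    qed
  qed
next
  fix X :: "complex mat" assume X: "X \<in> carrier_mat a a"
  have "mtrace (ker_map a b F X) = (\<Sum>k<b. \<Sum>i<a. \<Sum>j<a. X $$ (i, j) * F (i, k) (j, k))"
    by (simp add: mtrace_def ker_map_def)
  also have "\<dots> = (\<Sum>i<a. \<Sum>k<b. \<Sum>j<a. X $$ (i, j) * F (i, k) (j, k))" by (rule sum.swap)
  also have "\<dots> = (\<Sum>i<a. \<Sum>j<a. \<Sum>k<b. X $$ (i, j) * F (i, k) (j, k))"
    by (intro sum.cong refl sum.swap)
  also have "\<dots> = (\<Sum>i<a. \<Sum>j<a. if j = i then X $$ (i, j) else 0)"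
    unfolding sum_distrib_left[symmetric] by (intro sum.cong refl) (simp add: tr)
  also have "\<dots> = mtrace X" using X by (simp add: mtrace_def sum.delta)
  finally show "mtrace (ker_map a b F X) = mtrace X" .
qed

section \<open>The information quantities\<close>

lemma max_mixed_kron_index:
  assumes "S \<in> carrier_mat b b" "p \<in> {..<a} \<times> {..<b}" "q \<in> {..<a} \<times> {..<b}"
  shows "kron (max_mixed a) S $$ (pair_ix b p, pair_ix b q) =
    of_real (inverse (real a)) * id_kron (\<lambda>k l. S $$ (k, l)) p q"
  using assms pair_ix_div_mod[of p b] pair_ix_div_mod[of q b] pair_ix_less[OF assms(2)] pair_ix_less[OF assms(3)]
  by (auto simp: kron_index max_mixed_def id_kron_def field_simps)

lemma max_mixed_kron_carrier: "S \<in> carrier_mat b b \<Longrightarrow> kron (max_mixed a) S \<in> carrier_mat (a * b) (a * b)"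
  by (auto simp: max_mixed_def kron_def)

lemma max_mixed_dim [simp]: "dim_row (max_mixed a) = a" "dim_col (max_mixed a) = a"
  by (simp_all add: max_mixed_def)

lemma mat_adjoint_index:
  "S \<in> carrier_mat d d \<Longrightarrow> i < d \<Longrightarrow> j < d \<Longrightarrow> mat_adjoint S $$ (i, j) = cnj (S $$ (j, i))"
  by (auto simp: mat_adjoint_def mat_of_rows_def)

lemma hermitian_mat:
  assumes "herm_on {..<d} T"
  shows "hermitian d (mat d d (\<lambda>(i, j). T i j))"
  unfolding hermitian_def
proof
  show "mat_adjoint (mat d d (\<lambda>(i, j). T i j)) = mat d d (\<lambda>(i, j). T i j)"
  proof (rule eq_matI)
    fix i j assume "i < dim_row (mat d d (\<lambda>(i, j). T i j))" "j < dim_col (mat d d (\<lambda>(i, j). T i j))"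
    then have ij: "i < d" "j < d" by auto
    then show "mat_adjoint (mat d d (\<lambda>(i, j). T i j)) $$ (i, j) = mat d d (\<lambda>(i, j). T i j) $$ (i, j)"
      using herm_onD[OF assms, of j i] by (simp add: mat_adjoint_index[of _ d])
  qed (simp_all add: mat_adjoint_def)
qed simp

lemma mtrace_mat: "mtrace (mat d d (\<lambda>(i, j). T i j)) = (\<Sum>i<d. T i i)"
  by (simp add: mtrace_def)

lemma elog2_mono: "x \<le> y \<Longrightarrow> elog2 x \<le> elog2 y"
  by (auto simp: elog2_def)

context
  fixes a b :: nat and N :: op_map
  assumes a: "0 < a" and N: "op_carrier a b N" and J: "psd_on ({..<a} \<times> {..<b}) (mker a N)"
begin

lemma nonempty: "{..<a} \<noteq> {}"
  using a by (auto simp: lessThan_empty_iff)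

lemma mker_herm: "herm_on ({..<a} \<times> {..<b}) (mker a N)"
  by (rule psd_on_herm[OF _ J]) simp

text \<open>The factor \<open>1 / a\<close> occurs both in the Choi operator and in
  \<open>max_mixed\<close> and cancels, which leaves dual feasibility of \<open>x\<close> times
  \<open>S\<close> for the unnormalised kernel.\<close>

lemma loewner_max:
  assumes S: "S \<in> carrier_mat b b"
  shows "loewner_le (a * b) (choi a b N) (complex_of_real x \<cdot>\<^sub>m kron (max_mixed a) S) \<longleftrightarrow>
    psd_on ({..<a} \<times> {..<b}) (\<lambda>p q. id_kron (\<lambda>k l. of_real x * S $$ (k, l)) p q - mker a N p q)"
proof -
  let ?K = "complex_of_real x \<cdot>\<^sub>m kron (max_mixed a) S"
  have K: "?K \<in> carrier_mat (a * b) (a * b)" using max_mixed_kron_carrier[OF S] by simp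
  have "loewner_le (a * b) (choi a b N) ?K \<longleftrightarrow>
    psd_on ({..<a} \<times> {..<b}) (\<lambda>p q. (?K - choi a b N) $$ (pair_ix b p, pair_ix b q))"
    unfolding loewner_le_def psd_iff_pair using K choi_carrier[of a b N] by auto
  also have "\<dots> \<longleftrightarrow> psd_on ({..<a} \<times> {..<b}) (\<lambda>p q. of_real (inverse (real a)) *
      (id_kron (\<lambda>k l. of_real x * S $$ (k, l)) p q - mker a N p q))"
  proof (rule psd_on_cong)
    fix p q assume pq: "p \<in> {..<a} \<times> {..<b}" "q \<in> {..<a} \<times> {..<b}"
    have "(?K - choi a b N) $$ (pair_ix b p, pair_ix b q) =
      of_real x * kron (max_mixed a) S $$ (pair_ix b p, pair_ix b q) - choi a b N $$ (pair_ix b p, pair_ix b q)"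
      using carrier_matD[OF choi_carrier[of a b N]] carrier_matD[OF S] pair_ix_less[OF pq(1)] pair_ix_less[OF pq(2)]
      by simp
    also have "\<dots> = of_real (inverse (real a)) * (id_kron (\<lambda>k l. of_real x * S $$ (k, l)) p q - mker a N p q)"
      unfolding max_mixed_kron_index[OF S pq] choi_index[OF N pq]
      by (simp add: id_kron_def divide_inverse algebra_simps)
    finally show "(?K - choi a b N) $$ (pair_ix b p, pair_ix b q) =
      of_real (inverse (real a)) * (id_kron (\<lambda>k l. of_real x * S $$ (k, l)) p q - mker a N p q)" .
  qed
  also have "\<dots> \<longleftrightarrow> psd_on ({..<a} \<times> {..<b}) (\<lambda>p q. id_kron (\<lambda>k l. of_real x * S $$ (k, l)) p q - mker a N p q)"
    by (rule psd_on_scale_iff) (use a in simp)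
  finally show ?thesis .
qed

lemma loewner_doe:
  assumes S: "S \<in> carrier_mat b b"
  shows "loewner_le (a * b) (kron (max_mixed a) S) (complex_of_real x \<cdot>\<^sub>m choi a b N) \<longleftrightarrow>
    psd_on ({..<a} \<times> {..<b}) (\<lambda>p q. of_real x * mker a N p q - id_kron (\<lambda>k l. S $$ (k, l)) p q)"
proof -
  let ?K = "complex_of_real x \<cdot>\<^sub>m choi a b N"
  have K: "?K \<in> carrier_mat (a * b) (a * b)" using choi_carrier[of a b N] by simp
  have "loewner_le (a * b) (kron (max_mixed a) S) ?K \<longleftrightarrow>
    psd_on ({..<a} \<times> {..<b}) (\<lambda>p q. (?K - kron (max_mixed a) S) $$ (pair_ix b p, pair_ix b q))"
    unfolding loewner_le_def psd_iff_pair using K max_mixed_kron_carrier[OF S, of a] minus_carrier_mat[OF max_mixed_kron_carrier[OF S, of a]]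
    by simp
  also have "\<dots> \<longleftrightarrow> psd_on ({..<a} \<times> {..<b}) (\<lambda>p q. of_real (inverse (real a)) *
      (of_real x * mker a N p q - id_kron (\<lambda>k l. S $$ (k, l)) p q))"
  proof (rule psd_on_cong)
    fix p q assume pq: "p \<in> {..<a} \<times> {..<b}" "q \<in> {..<a} \<times> {..<b}"
    have "(?K - kron (max_mixed a) S) $$ (pair_ix b p, pair_ix b q) =
      of_real x * choi a b N $$ (pair_ix b p, pair_ix b q) - kron (max_mixed a) S $$ (pair_ix b p, pair_ix b q)"
      using carrier_matD[OF choi_carrier[of a b N]] carrier_matD[OF S] pair_ix_less[OF pq(1)] pair_ix_less[OF pq(2)]
      by simp
    also have "\<dots> = of_real (inverse (real a)) * (of_real x * mker a N p q - id_kron (\<lambda>k l. S $$ (k, l)) p q)"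
      unfolding max_mixed_kron_index[OF S pq] choi_index[OF N pq] by (simp add: divide_inverse algebra_simps)
    finally show "(?K - kron (max_mixed a) S) $$ (pair_ix b p, pair_ix b q) =
      of_real (inverse (real a)) * (of_real x * mker a N p q - id_kron (\<lambda>k l. S $$ (k, l)) p q)" .
  qed
  also have "\<dots> \<longleftrightarrow> psd_on ({..<a} \<times> {..<b}) (\<lambda>p q. of_real x * mker a N p q - id_kron (\<lambda>k l. S $$ (k, l)) p q)"
    by (rule psd_on_scale_iff) (use a in simp)
  finally show ?thesis .
qed

text \<open>A feasible pair of a number and a state is a dual feasible \<open>T\<close>, split into
  its trace and its normalisation.\<close>

lemma I_max_eq:
  assumes pos: "0 < dualval {..<a} {..<b} (mker a N)"
  shows "I_max a b N = ereal (log 2 (dualval {..<a} {..<b} (mker a N)))"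
    (is "_ = ereal (log 2 ?V)")
proof (rule antisym)
  show "ereal (log 2 ?V) \<le> I_max a b N"
    unfolding I_max_def
  proof (rule Inf_greatest, clarify)
    fix x S assume S: "S \<in> states b"
      and le: "loewner_le (a * b) (choi a b N) (complex_of_real x \<cdot>\<^sub>m kron (max_mixed a) S)"
    have p: "psd b S" and t: "mtrace S = 1" using S unfolding states_def by auto
    then have c: "S \<in> carrier_mat b b" and "psd_on {..<b} (\<lambda>k l. S $$ (k, l))"
      unfolding psd_iff_psd_on by auto
    then have "herm_on {..<b} (\<lambda>k l. of_real x * S $$ (k, l))"
      by (intro herm_on_scale psd_on_herm) auto
    then have "dominates {..<a} {..<b} (mker a N) (\<lambda>k l. of_real x * S $$ (k, l))"
      using le unfolding loewner_max[OF c] dominates_def by simp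
    from dualval_le[OF _ nonempty _ this]
    have "?V \<le> ktrace {..<b} (\<lambda>k l. of_real x * S $$ (k, l))" by simp
    also have "\<dots> = x * Re (mtrace S)"
      using c by (simp add: ktrace_def mtrace_def sum_distrib_left)
    finally have "?V \<le> x" unfolding t by simp
    then show "ereal (log 2 ?V) \<le> elog2 x" using elog2_mono[of ?V x] pos by (simp add: elog2_def)
  qed
next
  show "I_max a b N \<le> ereal (log 2 ?V)"
  proof (rule ereal_le_epsilon2)
    fix e :: real assume e: "0 < e"
    \<comment> \<open>The slack \<open>?V * (2 powr e - 1)\<close> raises \<open>?V\<close> to
      \<open>?V * 2 powr e\<close>, so the logarithm grows by exactly \<open>e\<close>.\<close>
    have "1 < 2 powr e" using e by simp
    then have "0 < ?V * (2 powr e - 1)" using pos by simp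
    then obtain T where T: "dominates {..<a} {..<b} (mker a N) T"
      "ktrace {..<b} T < ?V + ?V * (2 powr e - 1)"
      using dualval_approx[OF _ nonempty _ mker_herm] by blast
    define t where "t = ktrace {..<b} T"
    have t: "?V \<le> t" "t < ?V * 2 powr e"
      using dualval_le[OF _ nonempty _ T(1)] T(2) unfolding t_def by (auto simp: algebra_simps)
    have t0: "0 < t" using t pos by linarith
    define S where "S = mat b b (\<lambda>(k, l). of_real (inverse t) * T k l)"
    have c: "S \<in> carrier_mat b b" by (simp add: S_def)
    \<comment> \<open>\<open>1 \<otimes> T\<close> is the sum of the positive kernels
      \<open>1 \<otimes> T - J\<close> and \<open>J\<close>, and its block at index 0 of
      \<open>A\<close> is \<open>T\<close>. Thus a merely Hermitian certificate normalises to a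
      state.\<close>
    have "psd_on ({..<a} \<times> {..<b}) (\<lambda>p q. (id_kron T p q - mker a N p q) + mker a N p q)"
      using T(1) J unfolding dominates_def by (intro psd_on_add) auto
    then have "psd_on {..<b} (\<lambda>k l. (id_kron T :: nat \<times> nat \<Rightarrow> _) (0, k) (0, l))"
      using a by (intro psd_on_reindex[where h = "\<lambda>k. (0, k)" and I = "{..<a} \<times> {..<b}"]) auto
    then have "psd_on {..<b} T" by (simp add: id_kron_def)
    then have "psd_on {..<b} (\<lambda>k l. of_real (inverse t) * T k l)"
      by (rule psd_on_scale) (use t0 in simp)
    then have "psd_on {..<b} (\<lambda>k l. S $$ (k, l))"
      by (subst psd_on_cong[where G = "\<lambda>k l. of_real (inverse t) * T k l"]) (auto simp: S_def)
    moreover have "mtrace S = 1"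
    proof -
      have "mtrace S = of_real (inverse t) * (\<Sum>k<b. T k k)"
        by (simp add: S_def mtrace_def sum_distrib_left)
      then show ?thesis unfolding dominates_trace_real[OF T(1)] t_def[symmetric]
        using t0 by (simp flip: of_real_mult)
    qed
    ultimately have "S \<in> states b" using c unfolding states_def psd_iff_psd_on by simp
    moreover have "loewner_le (a * b) (choi a b N) (complex_of_real t \<cdot>\<^sub>m kron (max_mixed a) S)"
      unfolding loewner_max[OF c]
    proof (subst psd_on_cong)
      fix p q assume "p \<in> {..<a} \<times> {..<b}" "q \<in> {..<a} \<times> {..<b}"
      then show "id_kron (\<lambda>k l. of_real t * S $$ (k, l)) p q - mker a N p q = id_kron T p q - mker a N p q"
        using t0 by (auto simp: id_kron_def S_def)
    qed (use T(1) in \<open>simp add: dominates_def\<close>)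
    ultimately have "I_max a b N \<le> elog2 t" unfolding I_max_def by (intro Inf_lower) blast
    also have "\<dots> \<le> elog2 (?V * 2 powr e)" using t by (intro elog2_mono) simp
    also have "\<dots> = ereal (log 2 ?V) + ereal e" using pos by (simp add: elog2_def log_mult)
    finally show "I_max a b N \<le> ereal (log 2 ?V) + ereal e" .
  qed
qed

text \<open>A feasible pair \<open>(x, S)\<close> corresponds to \<open>T = - S / x\<close>
  dominating \<open>- J\<close>, of trace \<open>- 1 / x\<close>. If \<open>?q = 0\<close>, no pair
  is feasible and both sides are infinite.\<close>

lemma I_doe_eq: "I_doe a b N = - elog2 (minval {..<a} {..<b} (mker a N))" (is "_ = - elog2 ?q")
proof (rule antisym)
  have q0: "0 \<le> ?q" by (rule minval_nonneg[OF _ nonempty _ J]) auto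
  show "- elog2 ?q \<le> I_doe a b N"
    unfolding I_doe_def
  proof (rule Inf_greatest, clarify)
    fix x S assume S: "S \<in> aff_states b"
      and le: "loewner_le (a * b) (kron (max_mixed a) S) (complex_of_real x \<cdot>\<^sub>m choi a b N)"
    have h: "hermitian b S" and t: "mtrace S = 1" using S unfolding aff_states_def by auto
    then have c: "S \<in> carrier_mat b b" unfolding hermitian_def by auto
    \<comment> \<open>Pairing the operator inequality with a minimising channel gives
      \<open>1 \<le> x * ?q\<close>, which excludes \<open>?q = 0\<close> and makes \<open>x\<close>
      positive.\<close>
    obtain W where W: "chan_ker {..<a} {..<b} W" "Re (kinner ({..<a} \<times> {..<b}) (mker a N) W) = ?q"
      using minval_attained[OF _ nonempty _ mker_herm] by blast
    have "0 \<le> kinner ({..<a} \<times> {..<b}) (\<lambda>p q. of_real x * mker a N p q - id_kron (\<lambda>k l. S $$ (k, l)) p q) W"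
      using le W(1) unfolding loewner_doe[OF c] chan_ker_def by (intro kinner_nonneg) auto
    moreover have "kinner ({..<a} \<times> {..<b}) (id_kron (\<lambda>k l. S $$ (k, l))) W = mtrace S"
      using c kinner_id_kron_chan[OF _ _ W(1)] by (simp add: mtrace_def)
    moreover have "kinner ({..<a} \<times> {..<b}) (\<lambda>p q. of_real x * mker a N p q) W =
      of_real x * kinner ({..<a} \<times> {..<b}) (mker a N) W"
      by (simp add: kinner_def sum_distrib_left mult.assoc)
    ultimately have xq: "1 \<le> x * ?q"
      using W(2) unfolding kinner_diff_left t by (simp add: less_eq_complex_def)
    then have "?q \<noteq> 0" by auto
    then have q: "0 < ?q" using q0 by simp
    then have x: "inverse ?q \<le> x" using xq by (simp add: field_simps)
    then have "elog2 (inverse ?q) \<le> elog2 x" by (rule elog2_mono)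
    then show "- elog2 ?q \<le> elog2 x" using q by (simp add: elog2_def log_inverse)
  qed
  show "I_doe a b N \<le> - elog2 ?q"
  proof (cases "?q = 0")
    case True
    then show ?thesis by (simp add: elog2_def)
  next
    case False
    then have q: "0 < ?q" using q0 by simp
    show ?thesis
    proof (rule ereal_le_epsilon2)
      fix e :: real assume e: "0 < e"
      \<comment> \<open>With this factor the reciprocal of the near-optimal trace stays below
        \<open>2 powr e / ?q\<close>, a loss of at most \<open>e\<close> in the logarithm.\<close>
      define r where "r = 2 powr (- e)"
      have r: "0 < r" "r < 1" using e by (auto simp: r_def powr_less_one)
      then have "0 < ?q * (1 - r)" using q by simp
      then obtain T where T: "dominates {..<a} {..<b} (\<lambda>p q. - mker a N p q) T"
        "ktrace {..<b} T < dualval {..<a} {..<b} (\<lambda>p q. - mker a N p q) + ?q * (1 - r)"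
        using dualval_approx[OF _ nonempty _ herm_on_uminus[OF mker_herm]] by blast
      define t where "t = - ktrace {..<b} T"
      have t: "?q * r < t" using T(2) by (simp add: t_def minval_def algebra_simps)
      have t0: "0 < t" using t q r by (meson less_trans mult_pos_pos)
      have ht: "herm_on {..<b} T" using T(1) unfolding dominates_def by simp
      define S where "S = mat b b (\<lambda>(k, l). of_real (- inverse t) * T k l)"
      have c: "S \<in> carrier_mat b b" by (simp add: S_def)
      have "hermitian b S" unfolding S_def by (rule hermitian_mat[OF herm_on_scale[OF ht]])
      moreover have "mtrace S = 1"
      proof -
        have "mtrace S = of_real (- inverse t) * (\<Sum>k<b. T k k)"
          unfolding S_def mtrace_mat by (simp add: sum_distrib_left)
        also have "\<dots> = of_real (- inverse t * - t)"
          unfolding dominates_trace_real[OF T(1)] t_def by simp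
        finally show ?thesis using t0 by simp
      qed
      ultimately have "S \<in> aff_states b" unfolding aff_states_def by simp
      moreover have "loewner_le (a * b) (kron (max_mixed a) S) (complex_of_real (inverse t) \<cdot>\<^sub>m choi a b N)"
        unfolding loewner_doe[OF c]
      proof (subst psd_on_cong)
        fix p q assume "p \<in> {..<a} \<times> {..<b}" "q \<in> {..<a} \<times> {..<b}"
        then show "of_real (inverse t) * mker a N p q - id_kron (\<lambda>k l. S $$ (k, l)) p q =
          of_real (inverse t) * (id_kron T p q - - mker a N p q)"
          by (auto simp: id_kron_def S_def algebra_simps)
      next
        show "psd_on ({..<a} \<times> {..<b}) (\<lambda>p q. of_real (inverse t) * (id_kron T p q - - mker a N p q))"
          by (rule psd_on_scale) (use T(1) t0 in \<open>simp_all add: dominates_def\<close>)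
      qed
      ultimately have "I_doe a b N \<le> elog2 (inverse t)" unfolding I_doe_def by (intro Inf_lower) blast
      also have "\<dots> \<le> elog2 (inverse (?q * r))" using t q r
        by (intro elog2_mono le_imp_inverse_le) auto
      also have "\<dots> = - elog2 ?q + ereal e"
        using q r by (simp add: elog2_def log_inverse log_mult r_def)
      finally show "I_doe a b N \<le> - elog2 ?q + ereal e" .
    qed
  qed
qed

end

section \<open>The looped map\<close>

lemma tensor_map_carrier: "tensor_map a b c d N M X \<in> carrier_mat (b * d) (b * d)"
  by (simp add: tensor_map_def)

lemma sum_pair_delta:
  fixes f :: "nat \<Rightarrow> 'c :: comm_monoid_add"
  assumes "\<And>x. x < n * m \<Longrightarrow> x div m \<noteq> x mod m \<Longrightarrow> f x = 0" "n \<le> m"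
  shows "(\<Sum>x<n * m. f x) = (\<Sum>i<n. f (i * m + i))"
  unfolding sum_mult_add
proof (intro sum.cong refl)
  fix i assume i: "i \<in> {..<n}"
  have "(\<Sum>k<m. f (i * m + k)) = (\<Sum>k<m. if k = i then f (i * m + k) else 0)"
  proof (intro sum.cong refl)
    fix k assume "k \<in> {..<m}"
    then show "f (i * m + k) = (if k = i then f (i * m + k) else 0)"
      using assms(1)[of "i * m + k"] i by (auto simp: mult_add_less)
  qed
  also have "\<dots> = f (i * m + i)" using i assms(2) by (simp add: sum.delta')
  finally show "(\<Sum>k<m. f (i * m + k)) = f (i * m + i)" .
qed

lemma div_mod_iff: "y < a \<Longrightarrow> u div a = k \<and> u mod a = y \<longleftrightarrow> u = k * a + (y :: nat)"
  by (metis div_mult_mod_eq div_mult_add mod_mult_add)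

lemma loop_tensor_index:
  assumes T: "op_carrier (e * a) (f * a) T" and k: "k < e"
    and x: "x < f * a" "x' < f * a" and y: "y < a" "y' < a"
  shows "tensor_id (e * a) (f * a) a T (kron (mat_unit e k k) (max_ent a)) $$ (x * a + y, x' * a + y') =
    T (mat_unit (e * a) (k * a + y) (k * a + y')) $$ (x, x') / of_nat a"
proof -
  let ?R = "kron (mat_unit e k k) (max_ent a)"
  have dim: "dim_row (max_ent a) = a * a" "dim_col (max_ent a) = a * a" by (simp_all add: max_ent_def)
  have R: "?R $$ (u * a + y, v * a + y') = (if u = k * a + y \<and> v = k * a + y' then 1 / of_nat a else 0)"
    if u: "u < e * a" "v < e * a" for u v
  proof -
    have i: "w * a + z = (w div a) * (a * a) + ((w mod a) * a + z)" for w z :: nat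
    proof -
      have "w * a + z = (w div a * a + w mod a) * a + z" by simp
      also have "\<dots> = (w div a) * (a * a) + ((w mod a) * a + z)"
        by (simp only: add_mult_distrib mult.assoc add.assoc)
      finally show ?thesis .
    qed
    have l: "(w mod a) * a + z < a * a" if "z < a" for w z
      using that by (intro mult_add_less) auto
    have l2: "w * a + z < e * (a * a)" if "w < e * a" "z < a" for w z
      using mult_add_less[OF that] by (simp add: mult.assoc)
    have d: "(w * a + z) div (a * a) = w div a" "(w * a + z) mod (a * a) = (w mod a) * a + z" if "z < a" for w z
      unfolding i[of w z] by (rule div_mult_add[OF l[OF that]] mod_mult_add[OF l[OF that]])+
    have de: "u div a < e" "v div a < e" using u by (simp_all add: less_mult_imp_div_less)
    have "?R $$ (u * a + y, v * a + y') = mat_unit e k k $$ (u div a, v div a) * max_ent a $$ ((u mod a) * a + y, (v mod a) * a + y')"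
      using u y by (simp add: kron_index dim l2 d)
    also have "\<dots> = (if u div a = k \<and> v div a = k \<and> u mod a = y \<and> v mod a = y' then 1 / of_nat a else 0)"
      using y by (simp add: mat_unit_index de max_ent_index l)
    also have "(u div a = k \<and> v div a = k \<and> u mod a = y \<and> v mod a = y') \<longleftrightarrow> u = k * a + y \<and> v = k * a + y'"
      using div_mod_iff[OF y(1), of u k] div_mod_iff[OF y(2), of v k] by blast
    finally show ?thesis .
  qed
  have xl: "x * a + y < f * a * a" "x' * a + y' < f * a * a" using x y by (simp_all add: mult_add_less)
  have "tensor_id (e * a) (f * a) a T ?R $$ (x * a + y, x' * a + y') =
    (\<Sum>u<e * a. \<Sum>v<e * a. ?R $$ (u * a + y, v * a + y') * T (mat_unit (e * a) u v) $$ (x, x'))"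
    unfolding tensor_id_index[OF T xl] using y by simp
  also have "\<dots> = (\<Sum>u<e * a. \<Sum>v<e * a. if u = k * a + y \<and> v = k * a + y' then
      T (mat_unit (e * a) u v) $$ (x, x') / of_nat a else 0)"
    by (intro sum.cong refl) (simp add: R)
  also have "\<dots> = T (mat_unit (e * a) (k * a + y) (k * a + y')) $$ (x, x') / of_nat a"
    by (rule sum_delta2) (use k y in \<open>auto intro: mult_add_less\<close>)
  finally show ?thesis .
qed

text \<open>Feeding in half of an entangled pair and projecting on the pair afterwards closes the
  wire: the row index of \<open>A\<close> in the output is identified with the one in the input, and
  likewise for columns. Each of the two maximally entangled operators contributes a factor
  \<open>1 / a\<close>; these cancel in the success ratio.\<close>

lemma loop_index:
  assumes T: "op_carrier (e * a) (f * a) T" and k: "k < e" and pq: "p < f" "q < f"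
  shows "loop a e f T (mat_unit e k k) $$ (p, q) = (\<Sum>i<a. \<Sum>j<a.
    T (mat_unit (e * a) (k * a + j) (k * a + i)) $$ (p * a + j, q * a + i)) / of_nat (a * a)"
proof -
  let ?K = "kron (1\<^sub>m f) (max_ent a)"
  let ?W = "tensor_id (e * a) (f * a) a T (kron (mat_unit e k k) (max_ent a))"
  have dim: "dim_row (max_ent a) = a * a" "dim_col (max_ent a) = a * a" by (simp_all add: max_ent_def)
  have W: "dim_row ?W = f * a * a" "dim_col ?W = f * a * a" by (simp_all add: tensor_map_def)
  have KW: "(?K * ?W) $$ (p * (a * a) + s, q * (a * a) + s) =
    (\<Sum>t<a * a. max_ent a $$ (s, t) * ?W $$ (p * (a * a) + t, q * (a * a) + s))" if s: "s < a * a" for s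
  proof -
    have l: "p * (a * a) + s < f * (a * a)" "q * (a * a) + s < f * (a * a)"
      using s pq by (auto intro: mult_add_less)
    have "(?K * ?W) $$ (p * (a * a) + s, q * (a * a) + s) =
      (\<Sum>z<f * (a * a). ?K $$ (p * (a * a) + s, z) * ?W $$ (z, q * (a * a) + s))"
      using l by (simp add: scalar_prod_def dim W mult.assoc lessThan_atLeast0)
    also have "\<dots> = (\<Sum>r<f. \<Sum>t<a * a. ?K $$ (p * (a * a) + s, r * (a * a) + t) * ?W $$ (r * (a * a) + t, q * (a * a) + s))"
      by (rule sum_mult_add)
    also have "\<dots> = (\<Sum>r<f. if r = p then \<Sum>t<a * a. max_ent a $$ (s, t) * ?W $$ (r * (a * a) + t, q * (a * a) + s) else 0)"
    proof (intro sum.cong refl)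
      fix r assume r: "r \<in> {..<f}"
      have "?K $$ (p * (a * a) + s, r * (a * a) + t) = (if r = p then max_ent a $$ (s, t) else 0)"
        if t: "t < a * a" for t
      proof -
        have "r * (a * a) + t < f * (a * a)" using r t by (auto intro: mult_add_less)
        then have "?K $$ (p * (a * a) + s, r * (a * a) + t) =
          1\<^sub>m f $$ ((p * (a * a) + s) div (a * a), (r * (a * a) + t) div (a * a)) *
          max_ent a $$ ((p * (a * a) + s) mod (a * a), (r * (a * a) + t) mod (a * a))"
          using l by (subst kron_index) (simp_all add: dim)
        then show ?thesis unfolding div_mult_add[OF s] div_mult_add[OF t] mod_mult_add[OF s] mod_mult_add[OF t]
          using r pq by simp
      qed
      then show "(\<Sum>t<a * a. ?K $$ (p * (a * a) + s, r * (a * a) + t) * ?W $$ (r * (a * a) + t, q * (a * a) + s)) =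
        (if r = p then \<Sum>t<a * a. max_ent a $$ (s, t) * ?W $$ (r * (a * a) + t, q * (a * a) + s) else 0)"
        by (cases "r = p") (auto intro!: sum.cong sum.neutral)
    qed
    also have "\<dots> = (\<Sum>t<a * a. max_ent a $$ (s, t) * ?W $$ (p * (a * a) + t, q * (a * a) + s))"
      using pq by (simp add: sum.delta')
    finally show ?thesis .
  qed
  have ixe: "p * (a * a) + (i * a + i') = (p * a + i) * a + i'" for p i i' :: nat by (simp add: algebra_simps)
  have "loop a e f T (mat_unit e k k) $$ (p, q) = (\<Sum>s<a * a. \<Sum>t<a * a.
      max_ent a $$ (s, t) * ?W $$ (p * (a * a) + t, q * (a * a) + s))"
    unfolding loop_def ptrace_snd_def using pq by (simp add: KW)
  also have "\<dots> = (\<Sum>i<a. \<Sum>t<a * a. max_ent a $$ (i * a + i, t) * ?W $$ (p * (a * a) + t, q * (a * a) + (i * a + i)))"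
    by (rule sum_pair_delta) (auto simp: max_ent_index intro!: sum.neutral)
  also have "\<dots> = (\<Sum>i<a. \<Sum>j<a. max_ent a $$ (i * a + i, j * a + j) *
      ?W $$ (p * (a * a) + (j * a + j), q * (a * a) + (i * a + i)))"
    by (intro sum.cong refl sum_pair_delta) (auto simp: max_ent_index mult_add_less)
  also have "\<dots> = (\<Sum>i<a. \<Sum>j<a. T (mat_unit (e * a) (k * a + j) (k * a + i)) $$ (p * a + j, q * a + i) / of_nat (a * a))"
  proof (intro sum.cong refl)
    fix i j assume "i \<in> {..<a}" "j \<in> {..<a}"
    then have ij: "i < a" "j < a" by auto
    then show "max_ent a $$ (i * a + i, j * a + j) * ?W $$ (p * (a * a) + (j * a + j), q * (a * a) + (i * a + i)) =
      T (mat_unit (e * a) (k * a + j) (k * a + i)) $$ (p * a + j, q * a + i) / of_nat (a * a)"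
      unfolding ixe using pq
      by (subst loop_tensor_index[OF T k]) (auto simp: max_ent_index mult_add_less)
  qed
  finally show ?thesis by (simp add: sum_divide_distrib)
qed

text \<open>The Choi kernel of the branch from \<open>B\<close> to \<open>A\<close> of encoder and decoder on which the message is \<open>k\<close>
  and the decoder outputs \<open>p\<close>.\<close>

definition branch_ker ::
    "nat \<Rightarrow> nat \<Rightarrow> nat \<Rightarrow> op_map \<Rightarrow> op_map \<Rightarrow> nat \<Rightarrow> nat \<Rightarrow> nat \<times> nat \<Rightarrow> nat \<times> nat \<Rightarrow> complex" where
  "branch_ker b m l E D k p x y = (\<Sum>s<l. \<Sum>t<l. D (mat_unit b (snd x) (snd y)) $$ (p * l + s, p * l + t) *
     E (mat_unit (m * l) (k * l + s) (k * l + t)) $$ (fst x, fst y))"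

context
  fixes a b m l :: nat and E D N :: op_map
  assumes E: "op_carrier (m * l) a E" and D: "op_carrier b (m * l) D" and N: "op_carrier a b N"
begin

text \<open>The message register stays in the block \<open>(k, k)\<close> through \<open>N\<close>
  and \<open>D\<close>, so the composition can be evaluated stage by stage on that block
  alone.\<close>

lemma step_N:
  assumes "k < m" "i < a" "j < a" "x < m * b" "y < m * b"
  shows "id_tensor m a b N (mat_unit (m * a) (k * a + j) (k * a + i)) $$ (x, y) =
    (if x div b = k \<and> y div b = k then N (mat_unit a j i) $$ (x mod b, y mod b) else 0)"
proof -
  have d: "x div b < m" "y div b < m" using assms by (simp_all add: less_mult_imp_div_less)
  have "id_tensor m a b N (mat_unit (m * a) (k * a + j) (k * a + i)) $$ (x, y) =
    (\<Sum>i'<a. \<Sum>j'<a. if i' = j \<and> j' = i then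
       if x div b = k \<and> y div b = k then N (mat_unit a i' j') $$ (x mod b, y mod b) else 0 else 0)"
    unfolding id_tensor_index[OF N assms(4,5)]
    using assms d by (intro sum.cong refl) (auto simp: mat_unit_index mult_add_less mult_add_eq_iff)
  then show ?thesis unfolding sum_delta2[OF assms(3,2)] .
qed

lemma step_D:
  assumes X: "\<And>x y. x < m * b \<Longrightarrow> y < m * b \<Longrightarrow>
      X $$ (x, y) = (if x div b = k \<and> y div b = k then Y (x mod b) (y mod b) else 0)"
    and xy: "x < m * (m * l)" "y < m * (m * l)"
  shows "id_tensor m b (m * l) D X $$ (x, y) = (if x div (m * l) = k \<and> y div (m * l) = k then
    \<Sum>\<kappa><b. \<Sum>\<mu><b. Y \<kappa> \<mu> * D (mat_unit b \<kappa> \<mu>) $$ (x mod (m * l), y mod (m * l)) else 0)"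
proof -
  have d: "x div (m * l) < m" "y div (m * l) < m" using xy by (simp_all add: less_mult_imp_div_less)
  have "X $$ (x div (m * l) * b + \<kappa>, y div (m * l) * b + \<mu>) =
    (if x div (m * l) = k \<and> y div (m * l) = k then Y \<kappa> \<mu> else 0)" if "\<kappa> < b" "\<mu> < b" for \<kappa> \<mu>
    using that d by (subst X) (auto simp: mult_add_less)
  then show ?thesis unfolding id_tensor_index[OF D xy] by (auto intro!: sum.cong sum.neutral)
qed

lemma step_swap:
  assumes xy: "x < m * m * l" "y < m * m * l"
  shows "tensor_id (m * m) (m * m) l (swap_map m m) X $$ (x, y) =
    X $$ ((x div l mod m * m + x div l div m) * l + x mod l, (y div l mod m * m + y div l div m) * l + y mod l)"
proof -
  have d: "x div l < m * m" "y div l < m * m" using xy by (simp_all add: less_mult_imp_div_less)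
  have s: "z mod m * m + z div m < m * m" if "z < m * m" for z
    using that by (intro mult_add_less) (auto simp: less_mult_imp_div_less mod_less_of_mult)
  have c: "op_carrier (m * m) (m * m) (swap_map m m)" by (simp add: op_carrier_def swap_map_def)
  have "tensor_id (m * m) (m * m) l (swap_map m m) X $$ (x, y) =
    (\<Sum>u<m * m. \<Sum>v<m * m. if u = x div l mod m * m + x div l div m \<and> v = y div l mod m * m + y div l div m
       then X $$ (u * l + x mod l, v * l + y mod l) else 0)"
    unfolding tensor_id_index[OF c xy] using d s
    by (intro sum.cong refl) (auto simp: swap_map_def mat_unit_index)
  then show ?thesis unfolding sum_delta2[OF s[OF d(1)] s[OF d(2)]] .
qed

text \<open>Only diagonal entries matter, since the error is read off in the message basis. On them
  the loop contracts \<open>N\<close> with the linked encoder and decoder along both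
  \<open>A\<close> and \<open>B\<close>, which is exactly \<open>kinner\<close>.\<close>

lemma retro_map_diag:
  assumes k: "k < m" and p: "p < m"
  shows "retro_map a b m l E D N (mat_unit m k k) $$ (p, p) =
    kinner ({..<a} \<times> {..<b}) (mker a N) (branch_ker b m l E D k p) / of_nat (a * a)"
proof -
  let ?T = "id_tensor m (m * l) a E \<circ> tensor_id (m * m) (m * m) l (swap_map m m) \<circ>
      id_tensor m b (m * l) D \<circ> id_tensor m a b N"
  have T: "op_carrier (m * a) (m * a) ?T" unfolding op_carrier_def comp_def by (simp add: tensor_map_carrier)
  have "?T (mat_unit (m * a) (k * a + j) (k * a + i)) $$ (p * a + j, p * a + i) =
    (\<Sum>\<kappa><b. \<Sum>\<mu><b. mker a N (j, \<kappa>) (i, \<mu>) * branch_ker b m l E D k p (j, \<kappa>) (i, \<mu>))"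
    if ij: "i < a" "j < a" for i j
  proof -
    define X1 where "X1 = id_tensor m a b N (mat_unit (m * a) (k * a + j) (k * a + i))"
    define X2 where "X2 = id_tensor m b (m * l) D X1"
    define X3 where "X3 = tensor_id (m * m) (m * m) l (swap_map m m) X2"
    let ?Y = "\<lambda>\<kappa> \<mu>. N (mat_unit a j i) $$ (\<kappa>, \<mu>)"
    define Z where "Z u v = (\<Sum>\<kappa><b. \<Sum>\<mu><b. ?Y \<kappa> \<mu> * D (mat_unit b \<kappa> \<mu>) $$ (u, v))" for u v
    have X1: "X1 $$ (x, y) = (if x div b = k \<and> y div b = k then ?Y (x mod b) (y mod b) else 0)"
      if "x < m * b" "y < m * b" for x y
      unfolding X1_def by (rule step_N[OF k ij that])
    have X2: "X2 $$ (x, y) = (if x div (m * l) = k \<and> y div (m * l) = k then Z (x mod (m * l)) (y mod (m * l)) else 0)"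
      if "x < m * (m * l)" "y < m * (m * l)" for x y
      unfolding X2_def Z_def by (rule step_D[where Y = ?Y, OF X1 that])
    \<comment> \<open>After the swap the decoder's output \<open>p\<close> leads, and the register
      handed to the encoder holds the message, so both \<open>r\<close> and \<open>r'\<close> must
      equal \<open>k\<close>.\<close>
    have X3: "X3 $$ (p * (m * l) + (r * l + s), p * (m * l) + (r' * l + t)) =
      (if r = k \<and> r' = k then Z (p * l + s) (p * l + t) else 0)"
      if rs: "r < m" "r' < m" "s < l" "t < l" for r r' s t
    proof -
      have ix: "p * (m * l) + (r * l + s) = (p * m + r) * l + s" for r s by (simp add: algebra_simps)
      have lt: "(p * m + r) * l + s < m * m * l" "(p * m + r') * l + t < m * m * l"
        using p rs by (auto intro!: mult_add_less)
      have ix2: "(r * m + p) * l + s = r * (m * l) + (p * l + s)" for r s by (simp add: algebra_simps)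
      have pl: "p * l + s < m * l" "p * l + t < m * l" using p rs by (auto intro: mult_add_less)
      have lt2: "r * (m * l) + (p * l + s) < m * (m * l)" "r' * (m * l) + (p * l + t) < m * (m * l)"
        using pl rs by (auto intro: mult_add_less)
      have dm: "((p * m + r) * l + s) div l = p * m + r \<and> ((p * m + r) * l + s) mod l = s"
        "((p * m + r') * l + t) div l = p * m + r' \<and> ((p * m + r') * l + t) mod l = t"
        using rs by simp_all
      have "X3 $$ (p * (m * l) + (r * l + s), p * (m * l) + (r' * l + t)) =
        X2 $$ (r * (m * l) + (p * l + s), r' * (m * l) + (p * l + t))"
        unfolding ix X3_def step_swap[OF lt] ix2[symmetric] using dm rs by simp
      also have "\<dots> = (if r = k \<and> r' = k then Z (p * l + s) (p * l + t) else 0)"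
        unfolding X2[OF lt2] div_mult_add[OF pl(1)] div_mult_add[OF pl(2)] mod_mult_add[OF pl(1)] mod_mult_add[OF pl(2)] ..
      finally show ?thesis .
    qed
    have pa: "p * a + j < m * a" "p * a + i < m * a" using p ij by (auto intro: mult_add_less)
    have "?T (mat_unit (m * a) (k * a + j) (k * a + i)) $$ (p * a + j, p * a + i) =
      (\<Sum>u<m * l. \<Sum>v<m * l. X3 $$ (p * (m * l) + u, p * (m * l) + v) * E (mat_unit (m * l) u v) $$ (j, i))"
      unfolding comp_def X1_def[symmetric] X2_def[symmetric] X3_def[symmetric] id_tensor_index[OF E pa]
      using ij by simp
    also have "\<dots> = (\<Sum>r<m. \<Sum>s<l. \<Sum>r'<m. \<Sum>t<l. X3 $$ (p * (m * l) + (r * l + s), p * (m * l) + (r' * l + t)) *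
        E (mat_unit (m * l) (r * l + s) (r' * l + t)) $$ (j, i))"
      unfolding sum_mult_add ..
    also have "\<dots> = (\<Sum>r<m. \<Sum>r'<m. \<Sum>s<l. \<Sum>t<l. X3 $$ (p * (m * l) + (r * l + s), p * (m * l) + (r' * l + t)) *
        E (mat_unit (m * l) (r * l + s) (r' * l + t)) $$ (j, i))"
      by (intro sum.cong refl sum.swap)
    also have "\<dots> = (\<Sum>r<m. \<Sum>r'<m. if r = k \<and> r' = k then \<Sum>s<l. \<Sum>t<l. Z (p * l + s) (p * l + t) *
        E (mat_unit (m * l) (r * l + s) (r' * l + t)) $$ (j, i) else 0)"
    proof (intro sum.cong refl)
      fix r r' assume "r \<in> {..<m}" "r' \<in> {..<m}"
      then show "(\<Sum>s<l. \<Sum>t<l. X3 $$ (p * (m * l) + (r * l + s), p * (m * l) + (r' * l + t)) *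
          E (mat_unit (m * l) (r * l + s) (r' * l + t)) $$ (j, i)) =
        (if r = k \<and> r' = k then \<Sum>s<l. \<Sum>t<l. Z (p * l + s) (p * l + t) *
          E (mat_unit (m * l) (r * l + s) (r' * l + t)) $$ (j, i) else 0)"
        by (cases "r = k \<and> r' = k") (auto simp: X3 intro!: sum.cong sum.neutral)
    qed
    also have "\<dots> = (\<Sum>s<l. \<Sum>t<l. Z (p * l + s) (p * l + t) * E (mat_unit (m * l) (k * l + s) (k * l + t)) $$ (j, i))"
      by (rule sum_delta2[OF k k])
    also have "\<dots> = (\<Sum>s<l. \<Sum>t<l. \<Sum>\<kappa><b. \<Sum>\<mu><b. ?Y \<kappa> \<mu> * (D (mat_unit b \<kappa> \<mu>) $$ (p * l + s, p * l + t) *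
        E (mat_unit (m * l) (k * l + s) (k * l + t)) $$ (j, i)))"
      unfolding Z_def sum_distrib_right by (simp add: mult.assoc)
    also have "\<dots> = (\<Sum>x\<in>{..<l} \<times> {..<l}. \<Sum>y\<in>{..<b} \<times> {..<b}. ?Y (fst y) (snd y) *
        (D (mat_unit b (fst y) (snd y)) $$ (p * l + fst x, p * l + snd x) *
        E (mat_unit (m * l) (k * l + fst x) (k * l + snd x)) $$ (j, i)))"
      by (simp add: sum.cartesian_product')
    also have "\<dots> = (\<Sum>y\<in>{..<b} \<times> {..<b}. \<Sum>x\<in>{..<l} \<times> {..<l}. ?Y (fst y) (snd y) *
        (D (mat_unit b (fst y) (snd y)) $$ (p * l + fst x, p * l + snd x) *
        E (mat_unit (m * l) (k * l + fst x) (k * l + snd x)) $$ (j, i)))"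
      by (rule sum.swap)
    also have "\<dots> = (\<Sum>\<kappa><b. \<Sum>\<mu><b. ?Y \<kappa> \<mu> * branch_ker b m l E D k p (j, \<kappa>) (i, \<mu>))"
      by (simp add: branch_ker_def sum.cartesian_product' sum_distrib_left)
    finally show ?thesis unfolding mker_def by simp
  qed
  then have "retro_map a b m l E D N (mat_unit m k k) $$ (p, p) = (\<Sum>i<a. \<Sum>j<a.
    \<Sum>\<kappa><b. \<Sum>\<mu><b. mker a N (j, \<kappa>) (i, \<mu>) * branch_ker b m l E D k p (j, \<kappa>) (i, \<mu>)) / of_nat (a * a)"
    unfolding retro_map_def loop_index[OF T k p p] by simp
  also have "(\<Sum>i<a. \<Sum>j<a. \<Sum>\<kappa><b. \<Sum>\<mu><b. mker a N (j, \<kappa>) (i, \<mu>) * branch_ker b m l E D k p (j, \<kappa>) (i, \<mu>)) =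
    (\<Sum>j<a. \<Sum>i<a. \<Sum>\<kappa><b. \<Sum>\<mu><b. mker a N (j, \<kappa>) (i, \<mu>) * branch_ker b m l E D k p (j, \<kappa>) (i, \<mu>))"
    by (rule sum.swap)
  also have "\<dots> = (\<Sum>j<a. \<Sum>\<kappa><b. \<Sum>i<a. \<Sum>\<mu><b. mker a N (j, \<kappa>) (i, \<mu>) * branch_ker b m l E D k p (j, \<kappa>) (i, \<mu>))"
    by (intro sum.cong refl sum.swap)
  finally show ?thesis unfolding kinner_prod .
qed

lemma retro_map_carrier: "retro_map a b m l E D N X \<in> carrier_mat m m"
  unfolding retro_map_def loop_def ptrace_snd_def by (rule mat_carrier)

lemma mtrace_retro:
  "mtrace (retro_map a b m l E D N X) = (\<Sum>p<m. retro_map a b m l E D N X $$ (p, p))"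
  by (simp add: mtrace_def carrier_matD[OF retro_map_carrier])

lemma mtrace_unit_retro:
  assumes k: "k < m"
  shows "mtrace (mat_unit m k k * retro_map a b m l E D N X) = retro_map a b m l E D N X $$ (k, k)"
proof -
  let ?R = "retro_map a b m l E D N X"
  have R: "?R \<in> carrier_mat m m" by (rule retro_map_carrier)
  have "(mat_unit m k k * ?R) $$ (p, p) = (if p = k then ?R $$ (k, k) else 0)" if p: "p < m" for p
  proof -
    have "(mat_unit m k k * ?R) $$ (p, p) = (\<Sum>i<m. mat_unit m k k $$ (p, i) * ?R $$ (i, p))"
      using R p by (simp add: scalar_prod_def lessThan_atLeast0)
    also have "\<dots> = (\<Sum>i<m. if i = k then (if p = k then ?R $$ (k, k) else 0) else 0)"
      using p by (intro sum.cong) (auto simp: mat_unit_index)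
    also have "\<dots> = (if p = k then ?R $$ (k, k) else 0)" using k by (simp add: sum.delta')
    finally show ?thesis .
  qed
  then have "mtrace (mat_unit m k k * ?R) = (\<Sum>p<m. if p = k then ?R $$ (k, k) else 0)"
    unfolding mtrace_def by (intro sum.cong) auto
  then show ?thesis using k by (simp add: sum.delta')
qed

end

section \<open>One-shot bounds\<close>

text \<open>Fixing the output block \<open>p\<close> of the decoder and the message block
  \<open>k\<close> of the encoder are compressions; the results are linked over \<open>L\<close>,
  and a swap puts the index of \<open>A\<close> first.\<close>

lemma psd_on_branch_ker:
  assumes D: "psd_on ({..<b} \<times> {..<m * l}) (mker b D)" and E: "psd_on ({..<m * l} \<times> {..<a}) (mker (m * l) E)"
    and kp: "k < m" "p < m"
  shows "psd_on ({..<a} \<times> {..<b}) (branch_ker b m l E D k p)"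
proof -
  have D': "psd_on ({..<b} \<times> {..<l}) (\<lambda>x y. mker b D (fst x, p * l + snd x) (fst y, p * l + snd y))"
    by (rule psd_on_reindex[OF _ D, where h = "\<lambda>x. (fst x, p * l + snd x)"]) (use kp in \<open>auto intro: mult_add_less\<close>)
  have E': "psd_on ({..<l} \<times> {..<a}) (\<lambda>x y. mker (m * l) E (k * l + fst x, snd x) (k * l + fst y, snd y))"
    by (rule psd_on_reindex[OF _ E, where h = "\<lambda>x. (k * l + fst x, snd x)"]) (use kp in \<open>auto intro: mult_add_less\<close>)
  have "psd_on ({..<b} \<times> {..<a}) (\<lambda>x y. \<Sum>s<l. \<Sum>t<l. mker b D (fst x, p * l + s) (fst y, p * l + t) *
      mker (m * l) E (k * l + s, snd x) (k * l + t, snd y))"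
    using psd_on_link[OF _ _ _ D' E'] by simp
  from psd_on_reindex[OF _ this, where h = prod.swap and J = "{..<a} \<times> {..<b}"]
  have "psd_on ({..<a} \<times> {..<b}) (\<lambda>x y. \<Sum>s<l. \<Sum>t<l. mker b D (snd x, p * l + s) (snd y, p * l + t) *
      mker (m * l) E (k * l + s, fst x) (k * l + t, fst y))" by auto
  then show ?thesis unfolding branch_ker_def[abs_def] mker_def by simp
qed

text \<open>For every fixed message the branches add up to a channel; since the decoder acts before the
  message is encoded, so do the branches in which the message equals the output.\<close>

lemma chan_ker_branch_sum:
  assumes D: "op_carrier b (m * l) D" "psd_on ({..<b} \<times> {..<m * l}) (mker b D)"
    "\<And>i j. i < b \<Longrightarrow> j < b \<Longrightarrow> (\<Sum>k<m * l. D (mat_unit b i j) $$ (k, k)) = (if i = j then 1 else 0)"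
    and E: "psd_on ({..<m * l} \<times> {..<a}) (mker (m * l) E)"
    "\<And>i j. i < m * l \<Longrightarrow> j < m * l \<Longrightarrow> (\<Sum>k<a. E (mat_unit (m * l) i j) $$ (k, k)) = (if i = j then 1 else 0)"
    and g: "\<And>p. p < m \<Longrightarrow> g p < m"
  shows "chan_ker {..<a} {..<b} (\<lambda>x y. \<Sum>p<m. branch_ker b m l E D (g p) p x y)"
  unfolding chan_ker_def
proof (intro conjI ballI)
  show "psd_on ({..<a} \<times> {..<b}) (\<lambda>x y. \<Sum>p<m. branch_ker b m l E D (g p) p x y)"
    by (rule psd_on_sum) (use psd_on_branch_ker[OF D(2) E(1)] g in auto)
  fix k k' assume kk: "k \<in> {..<b}" "k' \<in> {..<b}"
  \<comment> \<open>The encoder's trace preservation removes \<open>g p\<close> from the marginal,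
    so a constant \<open>g\<close> (fixed message) and the identity (message equal to output) are
    covered alike.\<close>
  have "(\<Sum>i<a. branch_ker b m l E D (g p) p (i, k) (i, k')) = (\<Sum>s<l. D (mat_unit b k k') $$ (p * l + s, p * l + s))"
    if p: "p < m" for p
  proof -
    let ?D = "\<lambda>s t. D (mat_unit b k k') $$ (p * l + s, p * l + t)"
    let ?E = "\<lambda>s t i. E (mat_unit (m * l) (g p * l + s) (g p * l + t)) $$ (i, i)"
    have "(\<Sum>i<a. branch_ker b m l E D (g p) p (i, k) (i, k')) = (\<Sum>i<a. \<Sum>s<l. \<Sum>t<l. ?D s t * ?E s t i)"
      by (simp add: branch_ker_def)
    also have "\<dots> = (\<Sum>s<l. \<Sum>i<a. \<Sum>t<l. ?D s t * ?E s t i)" by (rule sum.swap)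
    also have "\<dots> = (\<Sum>s<l. \<Sum>t<l. \<Sum>i<a. ?D s t * ?E s t i)" by (intro sum.cong refl sum.swap)
    also have "\<dots> = (\<Sum>s<l. \<Sum>t<l. if t = s then ?D s t else 0)"
      unfolding sum_distrib_left[symmetric] using g[OF p]
      by (intro sum.cong refl) (auto simp: E(2) mult_add_less)
    also have "\<dots> = (\<Sum>s<l. ?D s s)" by (intro sum.cong refl) (simp add: sum.delta')
    finally show ?thesis .
  qed
  then have "(\<Sum>p<m. \<Sum>i<a. branch_ker b m l E D (g p) p (i, k) (i, k')) =
    (\<Sum>p<m. \<Sum>s<l. D (mat_unit b k k') $$ (p * l + s, p * l + s))" by simp
  also have "\<dots> = (\<Sum>u<m * l. D (mat_unit b k k') $$ (u, u))" by (rule sum_mult_add[symmetric])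
  also have "\<dots> = (if k = k' then 1 else 0)" using D(3) kk by simp
  finally show "(\<Sum>i<a. \<Sum>p<m. branch_ker b m l E D (g p) p (i, k) (i, k')) = (if k = k' then 1 else 0)"
    by (subst sum.swap)
qed

lemma complex_nonneg_of_real: "0 \<le> z \<Longrightarrow> z = of_real (Re z)"
  by (simp add: less_eq_complex_def complex_eq_iff)

context
  fixes a b :: nat and N :: op_map
  assumes a: "0 < a" and b: "0 < b" and N: "op_carrier a b N" and J: "psd_on ({..<a} \<times> {..<b}) (mker a N)"
begin

lemma retro_values:
  assumes ml: "0 < m" "0 < l" and ch: "channel (m * l) a E" "channel b (m * l) D" and k: "k < m"
  defines "w \<equiv> \<lambda>p. Re (kinner ({..<a} \<times> {..<b}) (mker a N) (branch_ker b m l E D k p))"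
  shows "Re (mtrace (mat_unit m k k * retro_map a b m l E D N (mat_unit m k k)) /
      mtrace (retro_map a b m l E D N (mat_unit m k k))) = w k / (\<Sum>p<m. w p)"
    and "mtrace (retro_map a b m l E D N (mat_unit m k k)) \<noteq> 0 \<longleftrightarrow> (\<Sum>p<m. w p) \<noteq> 0"
    and "\<And>p. p < m \<Longrightarrow> 0 \<le> w p"
proof -
  have ml': "0 < m * l" using ml by simp
  note E = channel_kernel[OF ml' ch(1)] and D = channel_kernel[OF b ch(2)]
  have nn: "0 \<le> kinner ({..<a} \<times> {..<b}) (mker a N) (branch_ker b m l E D k p)" if "p < m" for p
    by (rule kinner_nonneg[OF _ J psd_on_branch_ker[OF D(2) E(2) k that]]) simp
  then show "0 \<le> w p" if "p < m" for p using that unfolding w_def less_eq_complex_def by simp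
  have wp: "retro_map a b m l E D N (mat_unit m k k) $$ (p, p) = of_real (w p / real (a * a))" if "p < m" for p
    unfolding retro_map_diag[OF E(1) D(1) N k that] w_def
    using complex_nonneg_of_real[OF nn[OF that]] by simp
  then have t: "mtrace (retro_map a b m l E D N (mat_unit m k k)) = of_real ((\<Sum>p<m. w p) / real (a * a))"
    unfolding mtrace_retro[OF E(1) D(1) N] by (simp add: sum_divide_distrib)
  have s: "mtrace (mat_unit m k k * retro_map a b m l E D N (mat_unit m k k)) = of_real (w k / real (a * a))"
    unfolding mtrace_unit_retro[OF E(1) D(1) N k] by (rule wp[OF k])
  show "Re (mtrace (mat_unit m k k * retro_map a b m l E D N (mat_unit m k k)) /
      mtrace (retro_map a b m l E D N (mat_unit m k k))) = w k / (\<Sum>p<m. w p)"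
    unfolding s t of_real_divide[symmetric] Re_complex_of_real using a by simp
  show "mtrace (retro_map a b m l E D N (mat_unit m k k)) \<noteq> 0 \<longleftrightarrow> (\<Sum>p<m. w p) \<noteq> 0"
    unfolding t of_real_eq_0_iff using a by simp
qed

lemma retro_converse:
  assumes ml: "0 < m" "0 < l" and st: "retro_strategy a b m l E D N"
    and err: "p_error a b m l E D N \<le> \<epsilon>" and eps: "\<epsilon> < 1"
  shows "real m * ((1 - \<epsilon>) * minval {..<a} {..<b} (mker a N)) \<le> dualval {..<a} {..<b} (mker a N)"
proof -
  have ch: "channel (m * l) a E" "channel b (m * l) D" using st unfolding retro_strategy_def by auto
  have ml': "0 < m * l" using ml by simp
  note E = channel_kernel[OF ml' ch(1)] and D = channel_kernel[OF b ch(2)]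
  let ?I = "{..<a} \<times> {..<b}" and ?J = "mker a N"
  let ?w = "\<lambda>k p. Re (kinner ?I ?J (branch_ker b m l E D k p))"
  have ne: "{..<a} \<noteq> {}" using a by (auto simp: lessThan_empty_iff)
  have herm: "herm_on ?I ?J" by (rule psd_on_herm[OF _ J]) simp
  have chan: "chan_ker {..<a} {..<b} (\<lambda>x y. \<Sum>p<m. branch_ker b m l E D (g p) p x y)"
    if "\<And>p. p < m \<Longrightarrow> g p < m" for g
    by (rule chan_ker_branch_sum[OF D E(2,3) that]) auto
  have "(1 - \<epsilon>) * minval {..<a} {..<b} ?J \<le> ?w k k" if k: "k < m" for k
  proof -
    let ?R = "\<lambda>k. Re (mtrace (mat_unit m k k * retro_map a b m l E D N (mat_unit m k k)) /
      mtrace (retro_map a b m l E D N (mat_unit m k k)))"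
    have "Min (?R ` {..<m}) \<le> ?R k" using k by (intro Min_le) auto
    then have "1 - \<epsilon> \<le> ?R k" using err unfolding p_error_def by linarith
    then have r: "1 - \<epsilon> \<le> ?w k k / (\<Sum>p<m. ?w k p)" unfolding retro_values(1)[OF ml ch k] .
    have "(\<Sum>p<m. ?w k p) \<noteq> 0" using st k unfolding retro_strategy_def retro_values(2)[OF ml ch k, symmetric] by simp
    moreover have "0 \<le> (\<Sum>p<m. ?w k p)" by (intro sum_nonneg) (use retro_values(3)[OF ml ch k] in auto)
    ultimately have "(1 - \<epsilon>) * (\<Sum>p<m. ?w k p) \<le> ?w k k" using r by (simp add: pos_le_divide_eq)
    \<comment> \<open>A constant \<open>g\<close> makes the denominator of the success ratio the
      value of a channel.\<close>
    moreover have "minval {..<a} {..<b} ?J \<le> (\<Sum>p<m. ?w k p)"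
      using minval_le_kinner[OF _ ne _ herm chan[of "\<lambda>_. k"]] k unfolding kinner_sum_right by simp
    ultimately show ?thesis using eps
      by (meson diff_gt_0_iff_gt dual_order.trans less_imp_le mult_left_mono)
  qed
  then have "(\<Sum>k<m. (1 - \<epsilon>) * minval {..<a} {..<b} ?J) \<le> (\<Sum>k<m. ?w k k)" by (intro sum_mono) simp
  \<comment> \<open>With \<open>g\<close> the identity, the numerators for all messages add up to
    the value of one channel.\<close>
  also have "\<dots> \<le> dualval {..<a} {..<b} ?J"
    using kinner_le_dualval[OF _ ne _ herm chan[of "\<lambda>p. p"]] unfolding kinner_sum_right by simp
  finally show ?thesis by simp
qed

end

section \<open>Achievability by guessing the message\<close>

text \<open>The decoder emits a uniformly random guess, keeps a copy of it and the channel output in \<open>L\<close>; the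
  encoder then applies \<open>W\<close> if the message agrees with the copy and \<open>W'\<close> otherwise.  The loop
  thus postselects on the guess being correct.\<close>

definition dec_ker :: "nat \<Rightarrow> nat \<Rightarrow> nat \<times> nat \<Rightarrow> nat \<times> nat \<Rightarrow> complex" where
  "dec_ker m b x y = (\<Sum>p<m. if snd x = (p * m + p) * b + fst x \<and> snd y = (p * m + p) * b + fst y
     then 1 / of_nat m else 0)"

text \<open>An input index is \<open>(message * m + copy) * b\<close> plus the index of the channel
  output, so \<open>div b\<close> isolates message and copy. The kernel is block diagonal in them:
  the encoder measures both before choosing between \<open>W\<close> and \<open>W'\<close>.\<close>

definition enc_ker :: "nat \<Rightarrow> nat \<Rightarrow> (nat \<times> nat \<Rightarrow> nat \<times> nat \<Rightarrow> complex) \<Rightarrow>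
    (nat \<times> nat \<Rightarrow> nat \<times> nat \<Rightarrow> complex) \<Rightarrow> nat \<times> nat \<Rightarrow> nat \<times> nat \<Rightarrow> complex" where
  "enc_ker m b W W' x y = (if fst x div b = fst y div b
     then (if fst x div b div m = fst x div b mod m then W else W') (snd x, fst x mod b) (snd y, fst y mod b) else 0)"

lemma channel_dec_ker:
  assumes m: "0 < m"
  shows "channel b (m * (m * b)) (ker_map b (m * (m * b)) (dec_ker m b))"
proof (rule channel_ker_map)
  show "psd_on ({..<b} \<times> {..<m * (m * b)}) (dec_ker m b)"
    by (rule psd_on_gramI[where R = "{..<m}" and
          f = "\<lambda>p x. if snd x = (p * m + p) * b + fst x then of_real (1 / sqrt (real m)) else 0"])
      (auto simp: dec_ker_def simp flip: of_real_mult intro!: sum.cong)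
  fix i j assume ij: "i < b" "j < b"
  have "(\<Sum>k<m * (m * b). dec_ker m b (i, k) (j, k)) = (\<Sum>p<m. \<Sum>k<m * (m * b).
      if k = (p * m + p) * b + i \<and> k = (p * m + p) * b + j then 1 / of_nat m else 0)"
    unfolding dec_ker_def fst_conv snd_conv by (rule sum.swap)
  also have "\<dots> = (\<Sum>p<m. if i = j then 1 / of_nat m else 0)"
  proof (intro sum.cong refl)
    fix p assume p: "p \<in> {..<m}"
    then have "(p * m + p) * b + i < m * m * b" using ij by (intro mult_add_less) auto
    then have l: "(p * m + p) * b + i < m * (m * b)" by (simp only: mult.assoc)
    have "(\<Sum>k<m * (m * b). if k = (p * m + p) * b + i \<and> k = (p * m + p) * b + j then 1 / of_nat m else 0) =
      (\<Sum>k<m * (m * b). if k = (p * m + p) * b + i then (if i = j then 1 / of_nat m else 0) else 0 :: complex)"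
      by (intro sum.cong refl) auto
    then show "(\<Sum>k<m * (m * b). if k = (p * m + p) * b + i \<and> k = (p * m + p) * b + j then 1 / of_nat m else 0) =
      (if i = j then 1 / of_nat m else 0 :: complex)" using l by (simp add: sum.delta')
  qed
  also have "\<dots> = (if i = j then 1 else 0)" using m by simp
  finally show "(\<Sum>k<m * (m * b). dec_ker m b (i, k) (j, k)) = (if i = j then 1 else 0)" .
qed

lemma channel_enc_ker:
  assumes W: "chan_ker {..<a} {..<b} W" "chan_ker {..<a} {..<b} W'"
  shows "channel (m * (m * b)) a (ker_map (m * (m * b)) a (enc_ker m b W W'))"
proof (rule channel_ker_map)
  let ?I = "{..<m * (m * b)} \<times> {..<a}"
  define V where "V r = (if r div m = r mod m then W else W')" for r
  have V: "psd_on ({..<a} \<times> {..<b}) (V r)" for r using W unfolding V_def chan_ker_def by simp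
  \<comment> \<open>Indicator of the block \<open>r\<close> of message and copy; the encoder kernel
    is the sum of its diagonal blocks.\<close>
  let ?c = "\<lambda>r x. if fst x div b = r then 1 else 0 :: complex"
  have "psd_on ?I (\<lambda>x y. ?c r x * cnj (?c r y) * V r (snd x, fst x mod b) (snd y, fst y mod b))" for r
    by (rule psd_on_pullback[OF _ V, where h = "\<lambda>x. (snd x, fst x mod b)"])
      (auto simp: mod_less_of_mult mult.assoc[symmetric])
  then have "psd_on ?I (\<lambda>x y. \<Sum>r<m * m. ?c r x * cnj (?c r y) * V r (snd x, fst x mod b) (snd y, fst y mod b))"
    by (intro psd_on_sum) auto
  then show "psd_on ?I (enc_ker m b W W')"
  proof (subst psd_on_cong)
    fix x y assume xy: "x \<in> ?I" "y \<in> ?I"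
    then have "fst x < m * m * b" by (auto simp: mult.assoc)
    then have l: "fst x div b < m * m" by (rule less_mult_imp_div_less)
    have "(\<Sum>r<m * m. ?c r x * cnj (?c r y) * V r (snd x, fst x mod b) (snd y, fst y mod b)) =
      (\<Sum>r<m * m. if r = fst x div b then (if fst y div b = r then V r (snd x, fst x mod b) (snd y, fst y mod b) else 0) else 0)"
      by (intro sum.cong refl) auto
    also have "\<dots> = enc_ker m b W W' x y" using l by (simp add: sum.delta' enc_ker_def V_def)
    finally show "enc_ker m b W W' x y =
      (\<Sum>r<m * m. ?c r x * cnj (?c r y) * V r (snd x, fst x mod b) (snd y, fst y mod b))" by (rule sym)
  qed
  fix u v assume uv: "u < m * (m * b)" "v < m * (m * b)"
  then have "u mod b < b" "v mod b < b" by (auto simp: mod_less_of_mult mult.assoc[symmetric])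
  then have c: "(\<Sum>i<a. V r (i, u mod b) (i, v mod b)) = (if u mod b = v mod b then 1 else 0)" for r
    using W unfolding V_def chan_ker_def by simp
  have "(\<Sum>i<a. enc_ker m b W W' (u, i) (v, i)) =
    (if u div b = v div b then \<Sum>i<a. V (u div b) (i, u mod b) (i, v mod b) else 0)"
    unfolding enc_ker_def V_def fst_conv snd_conv by auto
  then show "(\<Sum>i<a. enc_ker m b W W' (u, i) (v, i)) = (if u = v then 1 else 0)"
    unfolding c eq_iff_div_mod[of u v b] by simp
qed

text \<open>Output \<open>p\<close> of the decoder forces the copy in \<open>L\<close> to be
  \<open>p\<close> as well, so the encoder's test becomes \<open>k = p\<close>. The weight
  \<open>1 / m\<close> is common to all branches and drops out of the success ratio.\<close>

lemma branch_ker_guess: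
  assumes kp: "k < m" "p < m" and x: "x \<in> {..<a} \<times> {..<b}" and y: "y \<in> {..<a} \<times> {..<b}"
  shows "branch_ker b m (m * b) (ker_map (m * (m * b)) a (enc_ker m b W W')) (ker_map b (m * (m * b)) (dec_ker m b)) k p x y
    = (if k = p then W else W') x y / of_nat m"
proof -
  obtain i u j v where xy: "x = (i, u)" "y = (j, v)" "i < a" "u < b" "j < a" "v < b" using x y by auto
  have l: "p * b + u < m * b" "p * b + v < m * b" using kp xy by (auto intro: mult_add_less)
  have ix: "(p' * m + p') * b + z = p' * (m * b) + (p' * b + z)" for p' z :: nat by (simp add: algebra_simps)
  have ix': "k * (m * b) + (p * b + z) = (k * m + p) * b + z" for z by (simp add: algebra_simps)
  have dec: "dec_ker m b (u, p * (m * b) + s) (v, p * (m * b) + t) =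
    (if s = p * b + u \<and> t = p * b + v then 1 / of_nat m else 0)" if st: "s < m * b" "t < m * b" for s t
  proof -
    have "dec_ker m b (u, p * (m * b) + s) (v, p * (m * b) + t) = (\<Sum>p'<m. if p' = p then
        (if s = p * b + u \<and> t = p * b + v then 1 / of_nat m else 0) else 0)"
      unfolding dec_ker_def fst_conv snd_conv ix
    proof (intro sum.cong refl)
      fix p' assume "p' \<in> {..<m}"
      then have l': "p' * b + u < m * b" "p' * b + v < m * b" using xy by (auto intro: mult_add_less)
      show "(if p * (m * b) + s = p' * (m * b) + (p' * b + u) \<and> p * (m * b) + t = p' * (m * b) + (p' * b + v)
          then 1 / of_nat m else 0 :: complex) =
        (if p' = p then (if s = p * b + u \<and> t = p * b + v then 1 / of_nat m else 0) else 0)"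
        unfolding mult_add_eq_iff[OF st(1) l'(1)] mult_add_eq_iff[OF st(2) l'(2)] by auto
    qed
    then show ?thesis using kp by (simp add: sum.delta')
  qed
  have "branch_ker b m (m * b) (ker_map (m * (m * b)) a (enc_ker m b W W')) (ker_map b (m * (m * b)) (dec_ker m b)) k p x y =
    (\<Sum>s<m * b. \<Sum>t<m * b. dec_ker m b (u, p * (m * b) + s) (v, p * (m * b) + t) *
      enc_ker m b W W' (k * (m * b) + s, i) (k * (m * b) + t, j))"
    unfolding branch_ker_def xy fst_conv snd_conv using kp xy
    by (intro sum.cong refl) (simp add: ker_map_mat_unit mult_add_less)
  also have "\<dots> = (\<Sum>s<m * b. \<Sum>t<m * b. if s = p * b + u \<and> t = p * b + v then
      enc_ker m b W W' (k * (m * b) + s, i) (k * (m * b) + t, j) / of_nat m else 0)"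
    by (intro sum.cong refl) (simp add: dec)
  also have "\<dots> = enc_ker m b W W' (k * (m * b) + (p * b + u), i) (k * (m * b) + (p * b + v), j) / of_nat m"
    by (rule sum_delta2[OF l])
  also have "enc_ker m b W W' (k * (m * b) + (p * b + u), i) (k * (m * b) + (p * b + v), j) =
    (if k = p then W else W') (i, u) (j, v)"
    unfolding ix' enc_ker_def fst_conv snd_conv div_mult_add[OF xy(4)] div_mult_add[OF xy(6)]
      mod_mult_add[OF xy(4)] mod_mult_add[OF xy(6)] div_mult_add[OF kp(2)] mod_mult_add[OF kp(2)] by simp
  finally show ?thesis unfolding xy .
qed

context
  fixes a b :: nat and N :: op_map
  assumes a: "0 < a" and b: "0 < b" and N: "op_carrier a b N" and J: "psd_on ({..<a} \<times> {..<b}) (mker a N)"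
begin

text \<open>The hypothesis \<open>le\<close> is the bound
  \<open>V / (V + (m - 1) q) \<ge> 1 - \<epsilon>\<close> with the denominator cleared. For
  \<open>q = 0\<close> and nonnegative \<open>\<epsilon>\<close> it holds for every
  \<open>m\<close>, which the degenerate case exploits.\<close>

lemma retro_achievable:
  assumes m: "0 < m" and pos: "0 < dualval {..<a} {..<b} (mker a N)"
    and le: "(1 - \<epsilon>) * ((real m - 1) * minval {..<a} {..<b} (mker a N)) \<le> \<epsilon> * dualval {..<a} {..<b} (mker a N)"
  obtains l E D where "0 < l" "retro_strategy a b m l E D N" "p_error a b m l E D N \<le> \<epsilon>"
proof -
  let ?I = "{..<a} \<times> {..<b}" and ?J = "mker a N"
  let ?V = "dualval {..<a} {..<b} ?J" and ?q = "minval {..<a} {..<b} ?J"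
  have ne: "{..<a} \<noteq> {}" using a by (auto simp: lessThan_empty_iff)
  have herm: "herm_on ?I ?J" by (rule psd_on_herm[OF _ J]) simp
  have q: "0 \<le> ?q" by (rule minval_nonneg[OF _ ne _ J]) auto
  obtain W where W: "chan_ker {..<a} {..<b} W" "Re (kinner ?I ?J W) = ?V"
    using strong_duality[OF _ ne _ herm] by blast
  obtain W' where W': "chan_ker {..<a} {..<b} W'" "Re (kinner ?I ?J W') = ?q"
    using minval_attained[OF _ ne _ herm] by blast
  define E where "E = ker_map (m * (m * b)) a (enc_ker m b W W')"
  define D where "D = ker_map b (m * (m * b)) (dec_ker m b)"
  have l: "0 < m * b" using m b by simp
  have ch: "channel (m * (m * b)) a E" "channel b (m * (m * b)) D"
    unfolding E_def D_def by (rule channel_enc_ker[OF W(1) W'(1)] channel_dec_ker[OF m])+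
  define w where "w k p = Re (kinner ?I ?J (branch_ker b m (m * b) E D k p))" for k p
  have w: "w k p = (if k = p then ?V else ?q) / real m" if "k < m" "p < m" for k p
  proof -
    have "kinner ?I ?J (branch_ker b m (m * b) E D k p) = kinner ?I ?J (\<lambda>x y. (if k = p then W else W') x y / of_nat m)"
      unfolding E_def D_def by (rule kinner_cong) (simp_all add: branch_ker_guess[OF that])
    also have "\<dots> = kinner ?I ?J (if k = p then W else W') / of_nat m"
      by (simp add: kinner_def sum_divide_distrib)
    finally show ?thesis unfolding w_def using W(2) W'(2) by simp
  qed
  have sw: "(\<Sum>p<m. w k p) = (?V + (real m - 1) * ?q) / real m" if k: "k < m" for k
  proof -
    have "(\<Sum>p<m. w k p) = (\<Sum>p<m. (if p = k then (?V - ?q) / real m else 0) + ?q / real m)"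
      using w[OF k] by (intro sum.cong refl) (auto simp: diff_divide_distrib)
    also have "\<dots> = (?V - ?q) / real m + real m * (?q / real m)" using k by (simp add: sum.distrib sum.delta')
    finally show ?thesis using m by (simp add: field_simps)
  qed
  have den: "0 < ?V + (real m - 1) * ?q" using pos q m by (intro add_pos_nonneg) auto
  have "(\<Sum>p<m. w k p) \<noteq> 0" if "k < m" for k using sw[OF that] den m by simp
  then have st: "retro_strategy a b m (m * b) E D N"
    unfolding retro_strategy_def using ch retro_values(2)[OF a b N J m l ch] unfolding w_def by simp
  let ?R = "\<lambda>k. Re (mtrace (mat_unit m k k * retro_map a b m (m * b) E D N (mat_unit m k k)) /
      mtrace (retro_map a b m (m * b) E D N (mat_unit m k k)))"
  have "1 - \<epsilon> \<le> ?R k" if k: "k < m" for k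
  proof -
    have "(1 - \<epsilon>) * (?V + (real m - 1) * ?q) \<le> ?V" using le by (simp add: algebra_simps)
    then have "1 - \<epsilon> \<le> ?V / (?V + (real m - 1) * ?q)" by (subst pos_le_divide_eq[OF den])
    also have "\<dots> = w k k / (\<Sum>p<m. w k p)" unfolding w[OF k k] sw[OF k] using m by simp
    also have "\<dots> = ?R k"
      unfolding w_def by (rule retro_values(1)[OF a b N J m l ch k, symmetric])
    finally show ?thesis .
  qed
  then have "1 - \<epsilon> \<le> Min (?R ` {..<m})" using m by (intro Min.boundedI) auto
  then have "p_error a b m (m * b) E D N \<le> \<epsilon>" unfolding p_error_def by linarith
  with l st show thesis by (rule that)
qed

lemma C_retro_oneshot_lower:
  assumes "0 < m" and "0 < dualval {..<a} {..<b} (mker a N)"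
    and "(1 - \<epsilon>) * ((real m - 1) * minval {..<a} {..<b} (mker a N)) \<le> \<epsilon> * dualval {..<a} {..<b} (mker a N)"
  shows "ereal (log 2 (real m)) \<le> C_retro_oneshot \<epsilon> a b N"
proof -
  obtain l E D where "0 < l" "retro_strategy a b m l E D N" "p_error a b m l E D N \<le> \<epsilon>"
    by (rule retro_achievable[OF assms])
  then show ?thesis unfolding C_retro_oneshot_def using assms(1) by (intro Sup_upper) blast
qed

lemma C_retro_oneshot_upper:
  assumes eps: "\<epsilon> < 1" and q: "0 < minval {..<a} {..<b} (mker a N)"
  shows "C_retro_oneshot \<epsilon> a b N \<le>
    ereal (log 2 (dualval {..<a} {..<b} (mker a N) / ((1 - \<epsilon>) * minval {..<a} {..<b} (mker a N))))"
  unfolding C_retro_oneshot_def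
proof (rule Sup_least, clarify)
  fix m l E D
  assume *: "0 < m" "0 < l" "retro_strategy a b m l E D N" "p_error a b m l E D N \<le> \<epsilon>"
  have "real m * ((1 - \<epsilon>) * minval {..<a} {..<b} (mker a N)) \<le> dualval {..<a} {..<b} (mker a N)"
    by (rule retro_converse[OF a b N J *(1-4) eps])
  then have "real m \<le> dualval {..<a} {..<b} (mker a N) / ((1 - \<epsilon>) * minval {..<a} {..<b} (mker a N))"
    using eps q by (subst pos_le_divide_eq) auto
  then show "ereal (log 2 (real m)) \<le> ereal (log 2 (dualval {..<a} {..<b} (mker a N) /
      ((1 - \<epsilon>) * minval {..<a} {..<b} (mker a N))))"
    using *(1) by simp
qed

end

section \<open>Tensor powers and regularization\<close>

lemma mker_tensor_map:
  assumes N: "op_carrier a b N" and M: "op_carrier c d M"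
    and pq: "p \<in> {..<a * c} \<times> {..<b * d}" "q \<in> {..<a * c} \<times> {..<b * d}"
  shows "mker (a * c) (tensor_map a b c d N M) p q = ktensor c d (mker a N) (mker c M) p q"
proof -
  let ?x = "fst p" and ?y = "fst q" and ?u = "snd p" and ?v = "snd q"
  let ?t = "\<lambda>i j k l. N (mat_unit a i j) $$ (?u div d, ?v div d) * M (mat_unit c k l) $$ (?u mod d, ?v mod d)"
  have l: "?x < a * c" "?y < a * c" "?u < b * d" "?v < b * d" using pq by auto
  have d: "?x div c < a" "?y div c < a" "?x mod c < c" "?y mod c < c"
    using l by (auto simp: less_mult_imp_div_less mod_less_of_mult)
  have "mker (a * c) (tensor_map a b c d N M) p q = (\<Sum>i<a. \<Sum>j<a. \<Sum>k<c. \<Sum>l<c.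
      mat_unit (a * c) ?x ?y $$ (i * c + k, j * c + l) * ?t i j k l)"
    unfolding mker_def by (rule tensor_map_index[OF N M l(3,4)])
  also have "\<dots> = (\<Sum>i<a. \<Sum>j<a. if i = ?x div c \<and> j = ?y div c then
      \<Sum>k<c. \<Sum>l<c. if k = ?x mod c \<and> l = ?y mod c then ?t i j k l else 0 else 0)"
  proof (intro sum.cong refl)
    fix i j assume ij: "i \<in> {..<a}" "j \<in> {..<a}"
    have u: "mat_unit (a * c) ?x ?y $$ (i * c + k, j * c + l) =
      (if (i = ?x div c \<and> j = ?y div c) \<and> k = ?x mod c \<and> l = ?y mod c then 1 else 0)"
      if kl: "k < c" "l < c" for k l
    proof -
      have "i * c + k < a * c" "j * c + l < a * c" using ij kl by (auto intro: mult_add_less)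
      moreover have "i * c + k = ?x \<longleftrightarrow> i = ?x div c \<and> k = ?x mod c" "j * c + l = ?y \<longleftrightarrow> j = ?y div c \<and> l = ?y mod c"
        by (metis div_mod_iff[OF kl(1)], metis div_mod_iff[OF kl(2)])
      ultimately show ?thesis by (subst mat_unit_index) auto
    qed
    show "(\<Sum>k<c. \<Sum>l<c. mat_unit (a * c) ?x ?y $$ (i * c + k, j * c + l) * ?t i j k l) =
      (if i = ?x div c \<and> j = ?y div c then
      \<Sum>k<c. \<Sum>l<c. if k = ?x mod c \<and> l = ?y mod c then ?t i j k l else 0 else 0)"
    proof (cases "i = ?x div c \<and> j = ?y div c")
      case True
      have "(\<Sum>k<c. \<Sum>l<c. mat_unit (a * c) ?x ?y $$ (i * c + k, j * c + l) * ?t i j k l) =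
        (\<Sum>k<c. \<Sum>l<c. if k = ?x mod c \<and> l = ?y mod c then ?t i j k l else 0)"
      proof (intro sum.cong refl)
        fix k l assume "k \<in> {..<c}" "l \<in> {..<c}"
        then have kl: "k < c" "l < c" by auto
        show "mat_unit (a * c) ?x ?y $$ (i * c + k, j * c + l) * ?t i j k l =
          (if k = ?x mod c \<and> l = ?y mod c then ?t i j k l else 0)"
          unfolding u[OF kl] using True by (cases "k = ?x mod c \<and> l = ?y mod c") (simp_all only: simp_thms if_True if_False mult_1_left mult_zero_left)
      qed
      then show ?thesis using True by (simp only: if_True simp_thms)
    next
      case False
      have "(\<Sum>k<c. \<Sum>l<c. mat_unit (a * c) ?x ?y $$ (i * c + k, j * c + l) * ?t i j k l) = 0"
      proof (intro sum.neutral ballI)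
        fix k l assume "k \<in> {..<c}" "l \<in> {..<c}"
        then have kl: "k < c" "l < c" by auto
        show "mat_unit (a * c) ?x ?y $$ (i * c + k, j * c + l) * ?t i j k l = 0"
          unfolding u[OF kl] using False by (simp only: simp_thms if_False mult_zero_left)
      qed
      then show ?thesis using False by (simp only: if_False)
    qed
  qed
  also have "\<dots> = ?t (?x div c) (?y div c) (?x mod c) (?y mod c)"
    unfolding sum_delta2[OF d(1,2)] sum_delta2[OF d(3,4)] ..
  finally show ?thesis by (simp add: ktensor_def split_ix_def mker_def)
qed

text \<open>Fekete's lemma, in the extended reals so that no upper bound is needed.\<close>

lemma superadditive_converges:
  fixes x :: "nat \<Rightarrow> real"
  assumes sup: "\<And>n m. x n + x m \<le> x (n + m)"
  obtains L :: ereal where "L \<noteq> - \<infinity>" "(\<lambda>n. ereal (x n / real n)) \<longlonglongrightarrow> L"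
proof
  let ?L = "SUP n\<in>{1..}. ereal (x n / real n)"
  have up: "ereal (x n / real n) \<le> ?L" if "n \<ge> 1" for n using that by (intro SUP_upper) auto
  show "?L \<noteq> - \<infinity>" using up[of 1] by auto
  have mult: "real q * x k + x r \<le> x (q * k + r)" for q k r
  proof (induction q)
    case (Suc q)
    then show ?case using sup[of k "q * k + r"] by (simp add: algebra_simps)
  qed simp
  show "(\<lambda>n. ereal (x n / real n)) \<longlonglongrightarrow> ?L"
  proof (rule order_tendstoI)
    fix y assume "?L < y"
    then have "ereal (x n / real n) < y" if "n \<ge> 1" for n using up[OF that] by (rule order.strict_trans1[rotated])
    then show "\<forall>\<^sub>F n in sequentially. ereal (x n / real n) < y"
      unfolding eventually_sequentially by blast
  next
    fix y assume "y < ?L"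
    then obtain k where k: "k \<ge> 1" "y < ereal (x k / real k)" unfolding less_SUP_iff by auto
    \<comment> \<open>The remainder modulo \<open>k\<close> contributes at least \<open>c\<close>,
      and \<open>\<bar>x k\<bar>\<close> pays for replacing \<open>n div k\<close> by the real
      quotient; both disappear after division by \<open>n\<close>.\<close>
    define c where "c = Min (x ` {..<k})"
    have c: "c \<le> x r" if "r < k" for r unfolding c_def using that by (intro Min_le) auto
    have low: "x k / real k + (c - \<bar>x k\<bar>) / real n \<le> x n / real n" if n: "n \<ge> 1" for n
    proof -
      have r: "n mod k < k" using k(1) by simp
      have 1: "x n \<ge> real (n div k) * x k + c" using mult[of "n div k" k "n mod k"] c[OF r] by simp
      have "real n = real (n div k) * real k + real (n mod k)"
        by (simp flip: of_nat_mult of_nat_add)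
      then have "real (n div k) = real n / real k - real (n mod k) / real k" using k(1) by (simp add: field_simps)
      then have "real (n div k) * x k = real n * (x k / real k) - real (n mod k) / real k * x k"
        by (simp add: left_diff_distrib)
      moreover have "real (n mod k) / real k * x k \<le> \<bar>x k\<bar>"
      proof -
        have "real (n mod k) / real k * x k \<le> real (n mod k) / real k * \<bar>x k\<bar>"
          by (intro mult_left_mono) auto
        also have "\<dots> \<le> 1 * \<bar>x k\<bar>" using r by (intro mult_right_mono) (auto simp: divide_le_eq)
        finally show ?thesis by simp
      qed
      ultimately have "real n * (x k / real k) + (c - \<bar>x k\<bar>) \<le> x n" using 1 by linarith
      then have "(real n * (x k / real k) + (c - \<bar>x k\<bar>)) / real n \<le> x n / real n"
        using n by (intro divide_right_mono) auto
      then show ?thesis using n by (simp add: add_divide_distrib)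
    qed
    have "(\<lambda>n. x k / real k + (c - \<bar>x k\<bar>) / real n) \<longlonglongrightarrow> x k / real k + 0"
      by (intro tendsto_intros lim_const_over_n)
    then have "(\<lambda>n. ereal (x k / real k + (c - \<bar>x k\<bar>) / real n)) \<longlonglongrightarrow> ereal (x k / real k)" by simp
    then have "\<forall>\<^sub>F n in sequentially. y < ereal (x k / real k + (c - \<bar>x k\<bar>) / real n)"
      using k(2) by (rule order_tendstoD)
    then show "\<forall>\<^sub>F n in sequentially. y < ereal (x n / real n)"
      using eventually_ge_at_top[of 1]
    proof eventually_elim
      case (elim n)
      have "ereal (x k / real k + (c - \<bar>x k\<bar>) / real n) \<le> ereal (x n / real n)" using low[OF elim(2)] by simp
      then show ?case by (rule order.strict_trans2[OF elim(1)])
    qed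
  qed
qed

section \<open>Extremal values of tensor powers and the limit of the rates\<close>

context
  fixes a b :: nat and N :: op_map
  assumes a: "0 < a" and b: "0 < b" and N: "op_carrier a b N" and J: "psd_on ({..<a} \<times> {..<b}) (mker a N)"
    and pos: "0 < dualval {..<a} {..<b} (mker a N)"
begin

abbreviation (input) Npow :: "nat \<Rightarrow> op_map" where "Npow n \<equiv> tensor_power a b N n"

abbreviation (input) Jpow :: "nat \<Rightarrow> nat \<times> nat \<Rightarrow> nat \<times> nat \<Rightarrow> complex" where
  "Jpow n \<equiv> mker (a ^ n) (Npow n)"

abbreviation (input) Ipow :: "nat \<Rightarrow> (nat \<times> nat) set" where "Ipow n \<equiv> {..<a ^ n} \<times> {..<b ^ n}"

definition vmax :: "nat \<Rightarrow> real" where "vmax n = dualval {..<a ^ n} {..<b ^ n} (Jpow n)"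

definition vmin :: "nat \<Rightarrow> real" where "vmin n = minval {..<a ^ n} {..<b ^ n} (Jpow n)"

lemma pow_pos: "0 < a ^ n" "0 < b ^ n"
  using a b by auto

lemma pow_nonempty: "{..<a ^ n} \<noteq> {}"
  using pow_pos[of n] by (auto simp: lessThan_empty_iff)

lemma op_carrier_Npow: "op_carrier (a ^ n) (b ^ n) (Npow n)"
  by (cases n) (simp_all add: op_carrier_id op_carrier_tensor_map)

lemma Jpow_Suc:
  "p \<in> Ipow (Suc n) \<Longrightarrow> q \<in> Ipow (Suc n) \<Longrightarrow> Jpow (Suc n) p q = ktensor (a ^ n) (b ^ n) (mker a N) (Jpow n) p q"
  using mker_tensor_map[OF N op_carrier_Npow, of p n q] by simp

lemma mker_id: "mker (Suc 0) (\<lambda>X. X) (0, 0) (0, 0) = 1"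
  by (simp add: mker_def mat_unit_index)

lemma psd_on_Jpow: "psd_on (Ipow n) (Jpow n)"
proof (induction n)
  case 0
  show ?case
    by (rule psd_on_gramI[where R = "{()}" and f = "\<lambda>_ _. 1"]) (auto simp: mker_id)
next
  case (Suc n)
  have "psd_on ({..<a * a ^ n} \<times> {..<b * b ^ n}) (ktensor (a ^ n) (b ^ n) (mker a N) (Jpow n))"
    by (rule psd_on_ktensor[OF pow_pos J Suc])
  then show ?case using psd_on_cong[of "Ipow (Suc n)" "Jpow (Suc n)"] Jpow_Suc by simp
qed

lemma herm_on_Jpow: "herm_on (Ipow n) (Jpow n)"
  by (rule psd_on_herm[OF _ psd_on_Jpow]) simp

text \<open>\<open>tensor_power\<close> splits off the first factor only, while Fekete's lemma asks
  for every splitting \<open>n + m\<close>. This is associativity of \<open>ktensor\<close>, carried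
  by identities for iterated quotients and remainders.\<close>

lemma Jpow_add:
  "p \<in> Ipow (n + m) \<Longrightarrow> q \<in> Ipow (n + m) \<Longrightarrow> Jpow (n + m) p q = ktensor (a ^ m) (b ^ m) (Jpow n) (Jpow m) p q"
proof (induction n arbitrary: p q)
  case 0
  then show ?case using mker_id by (auto simp: ktensor_def split_ix_def)
next
  case (Suc n)
  have md: "z mod c ^ (n + m) div c ^ m = z div c ^ m mod c ^ n" "z mod c ^ (n + m) mod c ^ m = z mod c ^ m"
    "z div c ^ (n + m) = z div c ^ m div c ^ n" if "0 < c" for z c :: nat
  proof -
    have e: "c ^ (n + m) = c ^ m * c ^ n" by (simp add: power_add)
    have "z mod c ^ (n + m) = (z div c ^ m mod c ^ n) * c ^ m + z mod c ^ m"
      unfolding e mod_mult2_eq by (simp add: mult.commute)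
    then show "z mod c ^ (n + m) div c ^ m = z div c ^ m mod c ^ n" "z mod c ^ (n + m) mod c ^ m = z mod c ^ m"
      using that by simp_all
    show "z div c ^ (n + m) = z div c ^ m div c ^ n" unfolding e by (rule div_mult2_eq)
  qed
  have s: "snd (split_ix (a ^ (n + m)) (b ^ (n + m)) p) \<in> Ipow (n + m)" for p
    using pow_pos[of "n + m"] by (simp add: split_ix_def)
  have s': "fst (split_ix (a ^ m) (b ^ m) p) \<in> Ipow (Suc n)" if "p \<in> Ipow (Suc n + m)" for p
    using that by (auto simp: split_ix_def power_add mult.assoc intro!: less_mult_imp_div_less)
  have "Jpow (Suc n + m) p q = ktensor (a ^ (n + m)) (b ^ (n + m)) (mker a N) (Jpow (n + m)) p q"
    using Jpow_Suc[of p "n + m" q] Suc.prems by simp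
  also have "\<dots> = mker a N (fst (split_ix (a ^ (n + m)) (b ^ (n + m)) p)) (fst (split_ix (a ^ (n + m)) (b ^ (n + m)) q)) *
    ktensor (a ^ m) (b ^ m) (Jpow n) (Jpow m) (snd (split_ix (a ^ (n + m)) (b ^ (n + m)) p)) (snd (split_ix (a ^ (n + m)) (b ^ (n + m)) q))"
    unfolding ktensor_def[of "a ^ (n + m)"] using Suc.IH[OF s s] by simp
  also have "\<dots> = ktensor (a ^ n) (b ^ n) (mker a N) (Jpow n) (fst (split_ix (a ^ m) (b ^ m) p)) (fst (split_ix (a ^ m) (b ^ m) q)) *
    Jpow m (snd (split_ix (a ^ m) (b ^ m) p)) (snd (split_ix (a ^ m) (b ^ m) q))"
    unfolding ktensor_def split_ix_def fst_conv snd_conv md[OF a] md[OF b] by (simp only: mult.assoc)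
  also have "\<dots> = ktensor (a ^ m) (b ^ m) (Jpow (Suc n)) (Jpow m) p q"
    unfolding ktensor_def[of "a ^ m"] using Jpow_Suc[OF s'[OF Suc.prems(1)] s'[OF Suc.prems(2)]] by simp
  finally show ?case .
qed

lemma vmin_nonneg: "0 \<le> vmin n"
  unfolding vmin_def by (rule minval_nonneg[OF _ pow_nonempty _ psd_on_Jpow]) auto

lemma vmin_add: "vmin (n + m) \<le> vmin n * vmin m"
proof -
  have "vmin (n + m) = minval {..<a ^ (n + m)} {..<b ^ (n + m)} (ktensor (a ^ m) (b ^ m) (Jpow n) (Jpow m))"
    unfolding vmin_def minval_def
    using dualval_cong[OF _ pow_nonempty, where X = "\<lambda>p q. - Jpow (n + m) p q"
        and Y = "\<lambda>p q. - ktensor (a ^ m) (b ^ m) (Jpow n) (Jpow m) p q" and B = "{..<b ^ (n + m)}"] Jpow_add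
    by simp
  also have "\<dots> \<le> vmin n * vmin m"
    unfolding vmin_def power_add
    by (rule minval_ktensor[OF pow_pos(1) pow_pos psd_on_Jpow psd_on_Jpow])
  finally show ?thesis .
qed

text \<open>For the zeroth power all systems are trivial, and trace preservation leaves a single
  channel, of value 1.\<close>

lemma val_0: "vmax 0 = 1" "vmin 0 = 1"
proof -
  have k: "kinner (Ipow 0) (Jpow 0) W = 1" if "chan_ker {..<a ^ 0} {..<b ^ 0} W" for W
  proof -
    have "W (0, 0) (0, 0) = 1" using that unfolding chan_ker_def by simp
    then show ?thesis using mker_id by (simp add: kinner_prod)
  qed
  obtain W where "chan_ker {..<a ^ 0} {..<b ^ 0} W" "Re (kinner (Ipow 0) (Jpow 0) W) = dualval {..<a ^ 0} {..<b ^ 0} (Jpow 0)"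
    using strong_duality[OF _ pow_nonempty _ herm_on_Jpow] by blast
  then show "vmax 0 = 1" using k unfolding vmax_def by simp
  obtain W where "chan_ker {..<a ^ 0} {..<b ^ 0} W" "Re (kinner (Ipow 0) (Jpow 0) W) = minval {..<a ^ 0} {..<b ^ 0} (Jpow 0)"
    using minval_attained[OF _ pow_nonempty _ herm_on_Jpow] by blast
  then show "vmin 0 = 1" using k unfolding vmin_def by simp
qed

lemma vmax_power: "vmax n = dualval {..<a} {..<b} (mker a N) ^ n"
proof (induction n)
  case 0
  show ?case using val_0 by simp
next
  case (Suc n)
  have "vmax (Suc n) = dualval {..<a ^ Suc n} {..<b ^ Suc n} (ktensor (a ^ n) (b ^ n) (mker a N) (Jpow n))"
    unfolding vmax_def using Jpow_Suc by (intro dualval_cong[OF _ pow_nonempty]) auto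
  also have "\<dots> = dualval {..<a} {..<b} (mker a N) * vmax n"
    unfolding vmax_def power_Suc by (rule dualval_ktensor[OF a pow_pos J psd_on_Jpow])
  finally show ?case using Suc by simp
qed

lemma vmax_pos: "0 < vmax n"
  unfolding vmax_power using pos by simp

text \<open>By submultiplicativity a zero of \<open>vmin\<close> persists for all later powers.
  There the minimiser gives wrong guesses no weight at all, so the number of messages is unbounded
  already in one shot.\<close>

lemma rate_limit_degenerate:
  assumes n0: "vmin n0 = 0" and eps: "0 < \<epsilon>"
  shows "I_doe_reg a b N = \<infinity>" "C_retro_rate \<epsilon> a b N \<longlonglongrightarrow> \<infinity>"
proof -
  have z: "vmin n = 0" if "n \<ge> n0" for n
    using vmin_add[of n0 "n - n0"] vmin_nonneg[of n] n0 that by simp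
  have "I_doe (a ^ n) (b ^ n) (Npow n) / ereal (real n) = \<infinity>" if "n \<ge> max n0 1" for n
    using that z[of n] I_doe_eq[OF pow_pos(1) op_carrier_Npow psd_on_Jpow, of n]
    unfolding vmin_def[symmetric] by (simp add: elog2_def)
  then have "\<forall>\<^sub>F n in sequentially. I_doe (a ^ n) (b ^ n) (Npow n) / ereal (real n) = \<infinity>"
    unfolding eventually_sequentially by blast
  then have "(\<lambda>n. I_doe (a ^ n) (b ^ n) (Npow n) / ereal (real n)) \<longlonglongrightarrow> \<infinity>"
    by (rule tendsto_eventually)
  then show "I_doe_reg a b N = \<infinity>" unfolding I_doe_reg_def by (rule limI)
  have "C_retro_rate \<epsilon> a b N n = \<infinity>" if n: "n \<ge> max n0 1" for n
  proof -
    have lo: "ereal (log 2 (real m)) \<le> C_retro_oneshot \<epsilon> (a ^ n) (b ^ n) (Npow n)" if "0 < m" for m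
      using z[of n] vmax_pos[of n] n eps
      by (intro C_retro_oneshot_lower[OF pow_pos op_carrier_Npow psd_on_Jpow that])
        (simp_all add: vmin_def vmax_def)
    have "ereal (real k) \<le> C_retro_oneshot \<epsilon> (a ^ n) (b ^ n) (Npow n)" for k
      using lo[of "2 ^ k"] by simp
    then have "C_retro_oneshot \<epsilon> (a ^ n) (b ^ n) (Npow n) = \<infinity>"
      by (intro ereal_top) (meson ereal_less_eq(3) le_less_linear less_le_trans order_trans real_arch_simple)
    then show ?thesis using n unfolding C_retro_rate_def by simp
  qed
  then have "\<forall>\<^sub>F n in sequentially. C_retro_rate \<epsilon> a b N n = \<infinity>"
    unfolding eventually_sequentially by blast
  then show "C_retro_rate \<epsilon> a b N \<longlonglongrightarrow> \<infinity>" by (rule tendsto_eventually)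
qed

lemma rate_limit_regular:
  assumes q: "\<And>n. 0 < vmin n" and eps: "0 < \<epsilon>" "\<epsilon> < 1"
  shows "C_retro_rate \<epsilon> a b N \<longlonglongrightarrow> ereal (log 2 (dualval {..<a} {..<b} (mker a N))) + I_doe_reg a b N"
proof -
  let ?v = "log 2 (dualval {..<a} {..<b} (mker a N))"
  define x where "x n = - log 2 (vmin n)" for n
  have "x n + x m \<le> x (n + m)" for n m
  proof -
    have "log 2 (vmin (n + m)) \<le> log 2 (vmin n * vmin m)" using q vmin_add[of n m] by simp
    then show ?thesis using q[of n] q[of m] by (simp add: x_def log_mult)
  qed
  then obtain L where L: "L \<noteq> - \<infinity>" "(\<lambda>n. ereal (x n / real n)) \<longlonglongrightarrow> L"
    by (rule superadditive_converges)
  have "I_doe (a ^ n) (b ^ n) (Npow n) / ereal (real n) = ereal (x n / real n)" if "n \<ge> 1" for n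
    using that q[of n] I_doe_eq[OF pow_pos(1) op_carrier_Npow psd_on_Jpow, of n]
    unfolding vmin_def[symmetric] by (simp add: elog2_def x_def)
  then have "\<forall>\<^sub>F n in sequentially. ereal (x n / real n) = I_doe (a ^ n) (b ^ n) (Npow n) / ereal (real n)"
    unfolding eventually_sequentially by (metis)
  then have "(\<lambda>n. I_doe (a ^ n) (b ^ n) (Npow n) / ereal (real n)) \<longlonglongrightarrow> L"
    by (rule Lim_transform_eventually[OF L(2)])
  then have reg: "I_doe_reg a b N = L" unfolding I_doe_reg_def by (rule limI)
  \<comment> \<open>\<open>L\<close> may be \<open>\<infinity>\<close>; the sum is continuous here
    because neither summand tends to \<open>- \<infinity>\<close>.\<close>
  have lim: "(\<lambda>n. ereal (?v + c / real n) + ereal (x n / real n)) \<longlonglongrightarrow> ereal ?v + L" for c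
  proof -
    have "(\<lambda>n. ?v + c / real n) \<longlonglongrightarrow> ?v + 0" by (intro tendsto_intros lim_const_over_n)
    then have "(\<lambda>n. ereal (?v + c / real n)) \<longlonglongrightarrow> ereal ?v" by simp
    then show ?thesis using L by (intro tendsto_add_ereal_nonneg) auto
  qed
  have scale: "ereal (real n * ?v + x n + c) / ereal (real n) = ereal (?v + c / real n) + ereal (x n / real n)"
    if "n \<ge> 1" for n c using that by (simp add: field_simps)
  \<comment> \<open>\<open>t\<close> will be \<open>1 / (1 - \<epsilon>)\<close> in the upper and
    \<open>\<epsilon> / (1 - \<epsilon>)\<close> in the lower bound; its logarithm vanishes after
    division by \<open>n\<close>.\<close>
  have lv: "log 2 (vmax n * t / vmin n) = real n * ?v + x n + log 2 t" if t: "t > 0" for n t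
    using q[of n] vmax_pos[of n] t pos unfolding vmax_power
    by (simp add: log_divide log_mult log_nat_power x_def)
  have up: "C_retro_rate \<epsilon> a b N n \<le> ereal (?v + log 2 (1 / (1 - \<epsilon>)) / real n) + ereal (x n / real n)" if n: "n \<ge> 1" for n
  proof -
    have "C_retro_oneshot \<epsilon> (a ^ n) (b ^ n) (Npow n) \<le> ereal (log 2 (vmax n / ((1 - \<epsilon>) * vmin n)))"
      unfolding vmax_def vmin_def
      by (rule C_retro_oneshot_upper[OF pow_pos op_carrier_Npow psd_on_Jpow eps(2) q[unfolded vmin_def]])
    also have "vmax n / ((1 - \<epsilon>) * vmin n) = vmax n * (1 / (1 - \<epsilon>)) / vmin n" by simp
    also have "log 2 \<dots> = real n * ?v + x n + log 2 (1 / (1 - \<epsilon>))" by (rule lv) (use eps in simp)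
    finally show ?thesis unfolding C_retro_rate_def scale[OF n, symmetric]
      using n by (intro ereal_divide_right_mono) auto
  qed
  have low: "ereal (?v + log 2 (\<epsilon> / (1 - \<epsilon>)) / real n) + ereal (x n / real n) \<le> C_retro_rate \<epsilon> a b N n" if n: "n \<ge> 1" for n
  proof -
    let ?t = "vmax n * (\<epsilon> / (1 - \<epsilon>)) / vmin n"
    have t: "0 < ?t" using q[of n] vmax_pos[of n] eps by simp
    \<comment> \<open>Achievability limits \<open>m - 1\<close> by \<open>?t\<close>, while the rate
      asks for \<open>m\<close> to be at least \<open>?t\<close>; the floor plus one meets both and
      is positive even when \<open>?t\<close> is below 1.\<close>
    define m where "m = nat \<lfloor>?t\<rfloor> + 1"
    have m: "0 < m" "?t \<le> real m" "real m - 1 \<le> ?t" using t unfolding m_def by linarith+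
    have "(1 - \<epsilon>) * ((real m - 1) * vmin n) \<le> (1 - \<epsilon>) * (?t * vmin n)"
      using m(3) eps q[of n] by (intro mult_left_mono mult_right_mono) auto
    also have "\<dots> = \<epsilon> * vmax n" using eps q[of n] by simp
    finally have "ereal (log 2 (real m)) \<le> C_retro_oneshot \<epsilon> (a ^ n) (b ^ n) (Npow n)"
      unfolding vmin_def vmax_def
      by (rule C_retro_oneshot_lower[OF pow_pos op_carrier_Npow psd_on_Jpow m(1) vmax_pos[unfolded vmax_def]])
    moreover have "log 2 ?t \<le> log 2 (real m)" using t m by simp
    ultimately have "ereal (log 2 ?t) \<le> C_retro_oneshot \<epsilon> (a ^ n) (b ^ n) (Npow n)"
      by (meson ereal_less_eq(3) order_trans)
    moreover have "log 2 ?t = real n * ?v + x n + log 2 (\<epsilon> / (1 - \<epsilon>))" by (rule lv) (use eps in simp)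
    ultimately show ?thesis unfolding C_retro_rate_def scale[OF n, symmetric]
      using n by (intro ereal_divide_right_mono) auto
  qed
  show ?thesis unfolding reg
  proof (rule tendsto_sandwich[OF _ _ lim lim])
    show "\<forall>\<^sub>F n in sequentially. ereal (?v + log 2 (\<epsilon> / (1 - \<epsilon>)) / real n) + ereal (x n / real n) \<le> C_retro_rate \<epsilon> a b N n"
      using low unfolding eventually_sequentially by blast
    show "\<forall>\<^sub>F n in sequentially. C_retro_rate \<epsilon> a b N n \<le> ereal (?v + log 2 (1 / (1 - \<epsilon>)) / real n) + ereal (x n / real n)"
      using up unfolding eventually_sequentially by blast
  qed
qed

lemma rate_limit:
  assumes eps: "0 < \<epsilon>" "\<epsilon> < 1"
  shows "C_retro_rate \<epsilon> a b N \<longlonglongrightarrow> I_max a b N + I_doe_reg a b N"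
proof (cases "\<exists>n. vmin n = 0")
  case True
  then show ?thesis using rate_limit_degenerate eps unfolding I_max_eq[OF a N J pos] by fastforce
next
  case False
  then have "0 < vmin n" for n using vmin_nonneg[of n] by (metis less_eq_real_def)
  then show ?thesis unfolding I_max_eq[OF a N J pos] by (rule rate_limit_regular[OF _ eps])
qed

end

theorem theorem5:
  fixes a b :: nat and N :: "complex mat \<Rightarrow> complex mat" and \<epsilon> :: real
  assumes "1 \<le> a" and "1 \<le> b"
    and "cp_map a b N"
    and "\<exists>X\<in>carrier_mat a a. N X \<noteq> 0\<^sub>m b b"
    and "0 < \<epsilon>" and "\<epsilon> < 1"
  shows "C_retro_rate \<epsilon> a b N \<longlonglongrightarrow> I_max a b N + I_doe_reg a b N \<and>
    C_retro a b N = I_max a b N + I_doe_reg a b N"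
proof
  have a: "0 < a" and b: "0 < b" using assms(1,2) by auto
  note N = cp_map_kernel[OF a assms(3)]
  have "linear_op_map a b N" using assms(3) unfolding cp_map_def by simp
  then obtain p q where "p \<in> {..<a} \<times> {..<b}" "q \<in> {..<a} \<times> {..<b}" "mker a N p q \<noteq> 0"
    using mker_nonzero assms(4) by blast
  moreover have "{..<a} \<noteq> {}" using a by (auto simp: lessThan_empty_iff)
  ultimately have pos: "0 < dualval {..<a} {..<b} (mker a N)"
    by (intro dualval_pos[OF _ _ _ N(2)]) auto
  have lim: "C_retro_rate \<delta> a b N \<longlonglongrightarrow> I_max a b N + I_doe_reg a b N" if "0 < \<delta>" "\<delta> < 1" for \<delta>
    by (rule rate_limit[OF a b N pos that])
  then show "C_retro_rate \<epsilon> a b N \<longlonglongrightarrow> I_max a b N + I_doe_reg a b N" using assms(5,6) by blast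
  have "liminf (C_retro_rate \<delta> a b N) = I_max a b N + I_doe_reg a b N" if "\<delta> \<in> {0<..<1}" for \<delta>
    using that by (intro lim_imp_Liminf lim) auto
  then have "C_retro a b N = (INF \<delta>\<in>{0<..<1::real}. I_max a b N + I_doe_reg a b N)"
    unfolding C_retro_def by (intro INF_cong) auto
  also have "\<dots> = I_max a b N + I_doe_reg a b N" by (intro cINF_const) (simp add: dense)
  finally show "C_retro a b N = I_max a b N + I_doe_reg a b N" .
qed

end
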